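(* Let $n\geq 1$ and $x_1,\dots,x_n>0$. (1) We have $$\mathcal{F}_n^{\mathsf{Bur}}=\frac{(2\pi)^{n/2}}{\prod_{j=1}^n x_j^{1/2}}\sum_{\ell=1}^n\sum_{[I_1\sqcup\dots\sqcup I_\ell]=\{1,\dots,n\}}\frac{-e^{\frac{1}{24}\sum_{j=1}^\ell x_{I_j}^3}}{(2\pi)^\ell}\int_{\mathbb{R}^\ell}\frac{\prod_{j=1}^\ell e^{-\frac{f_j^2}{2x_{I_j}}}\frac{df_j}{x_{I_j}}}{\prod_{j=1}^\ell\Big[\mathsf{i}\Big(\frac{f_j}{x_{I_j}}-\frac{f_{j+1}}{x_{I_{j+1}}}\Big)-\frac{x_{I_j}+x_{I_{j+1}}}{2}\Big]},$$ where the inner sum is over cyclically ordered partitions of $\{1,\dots,n\}$, i.e. ordered sequences $(I_1,\dots,I_\ell)$ of nonempty pairwise disjoint subsets with union $\{1,\dots,n\}$, with $(I_1,\dots,I_\ell)$ identified with $(I_2,\dots,I_\ell,I_1)$; and $I_{\ell+1}:=I_1$, $f_{\ell+1}:=f_1$. (2) For every such cyclically ordered partition $[I_1\sqcup\dots\sqcup I_\ell]$, $$\frac{e^{\frac{1}{24}\sum_{j=1}^\ell x_{I_j}^3}}{(2\pi)^\ell}\int_{\mathbb{R}^\ell}\frac{\prod_{j=1}^\ell e^{-\frac{f_j^2}{2x_{I_j}}}\frac{df_j}{x_{I_j}}}{\prod_{j=1}^\ell\Big[\mathsf{i}\Big(\frac{f_j}{x_{I_j}}-\frac{f_{j+1}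}{x_{I_{j+1}}}\Big)-\frac{x_{I_j}+x_{I_{j+1}}}{2}\Big]}=(-1)^\ell\,\mathcal{E}\Big(\frac{x_{I_1}}{2^{1/3}},\dots,\frac{x_{I_\ell}}{2^{1/3}}\Big).$$
   Context: $\mathsf{i}=\sqrt{-1}$, and $x_I:=\sum_{j\in I}x_j$ for $I\subset\{1,\dots,n\}$. Let $\zeta(x) := e^{x/2}-e^{-x/2}$. Define $P_1(a_1;x_1):=1/x_1$ and, for $n\geq 2$, $$P_n(a_1,\dots,a_n;x_1,\dots,x_n) := \sum_{\substack{\tau\in S_n\\ \tau(1)=1}} \frac{\prod_{j=2}^{n-1} x_{\tau(j)} \prod_{j=1}^{n-1}\zeta\Big(\big(\sum_{k=1}^{j} a_{\tau(k)}\big)x_{\tau(j+1)} - a_{\tau(j+1)}\big(\sum_{k=1}^{j} x_{\tau(k)}\big)\Big)}{\prod_{j=1}^{n-1}\big(a_{\tau(j)}x_{\tau(j+1)} - a_{\tau(j+1)}x_{\tau(j)}\big)},$$ a formal power series in all its variables, and $$\mathcal{F}_n^{\mathsf{Bur}}(x_1,\dots,x_n) := \frac{e^{(\sum_{j=1}^n x_j)^3/24}}{(\sum_{j=1}^n x_j)\prod_{j=1}^n\sqrt{2\pi x_j}}\int_{\mathbb{R}^n}\Big[\prod_{j=1}^n e^{-a_j^2/(2x_j)}da_j\Big] P_n(\mathsf{i}a_1,\dots,\mathsf{i}a_n;x_1,\dots,x_n).$$ For $\ell\geq 1$ define $$\mathcal{E}(y_1,\dots,y_\ell) := \frac{e^{(\sum_{j=1}^\ell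 y_j^3)/12}}{\prod_{j=1}^\ell\sqrt{4\pi y_j}}\int_{\mathbb{R}_{\geq 0}^\ell}\Big[\prod_{j=1}^\ell ds_j\Big]\exp\Big(-\sum_{j=1}^\ell\Big(\frac{(s_j-s_{j+1})^2}{4y_j}+\frac{(s_j+s_{j+1})y_j}{2}\Big)\Big),$$ with $s_{\ell+1}:=s_1$. *)

theory Defs
  imports "HOL-Analysis.Analysis" "HOL-Combinatorics.Permutations"
begin

definition xI :: "(nat \<Rightarrow> real) \<Rightarrow> nat set \<Rightarrow> real" where
  "xI x I = (\<Sum>j\<in>I. x j)"

definition zeta :: "complex \<Rightarrow> complex" where
  "zeta z = exp (z / 2) - exp (- z / 2)"

text \<open>P_n(a_1..a_n; x_1..x_n), variables indexed by 1..n; evaluated pointwise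
  (the denominators vanish only on a null set of the a-variables).\<close>
definition Pn :: "nat \<Rightarrow> (nat \<Rightarrow> complex) \<Rightarrow> (nat \<Rightarrow> real) \<Rightarrow> complex" where
  "Pn n a x =
    (if n = 1 then 1 / complex_of_real (x 1)
     else (\<Sum>\<tau> \<in> {\<tau>. \<tau> permutes {1..n} \<and> \<tau> 1 = 1}.
        ((\<Prod>j=2..n-1. complex_of_real (x (\<tau> j))) *
         (\<Prod>j=1..n-1. zeta ((\<Sum>k=1..j. a (\<tau> k)) * complex_of_real (x (\<tau> (j+1)))
                             - a (\<tau> (j+1)) * complex_of_real (\<Sum>k=1..j. x (\<tau> k)))))
        / (\<Prod>j=1..n-1. a (\<tau> j) * complex_of_real (x (\<tau> (j+1)))
                        - a (\<tau> (j+1)) * complex_of_real (x (\<tau> j)))))"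

definition F_Bur :: "nat \<Rightarrow> (nat \<Rightarrow> real) \<Rightarrow> complex" where
  "F_Bur n x =
    complex_of_real (exp ((\<Sum>j=1..n. x j) ^ 3 / 24)
       / ((\<Sum>j=1..n. x j) * (\<Prod>j=1..n. sqrt (2 * pi * x j))))
    * integral\<^sup>L (PiM {1..n} (\<lambda>_. lborel))
        (\<lambda>a. complex_of_real (\<Prod>j=1..n. exp (- ((a j) ^ 2) / (2 * x j)))
              * Pn n (\<lambda>j. \<i> * complex_of_real (a j)) x)"

definition E_fun :: "real list \<Rightarrow> real" where
  "E_fun ys =
    (let l = length ys in
     exp ((\<Sum>j<l. (ys!j)^3) / 12) / (\<Prod>j<l. sqrt (4 * pi * (ys!j)))
     * (LINT s : {s. \<forall>j<l. 0 \<le> s j} | PiM {..<l} (\<lambda>_. lborel).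
          exp (- (\<Sum>j<l. (s j - s ((j+1) mod l))^2 / (4 * (ys!j))
                         + (s j + s ((j+1) mod l)) * (ys!j) / 2))))"

definition ord_parts :: "nat \<Rightarrow> nat \<Rightarrow> nat set list set" where
  "ord_parts n l = {Is. length Is = l \<and> (\<forall>i<l. Is!i \<noteq> {}) \<and>
      (\<forall>i<l. \<forall>j<l. i \<noteq> j \<longrightarrow> Is!i \<inter> Is!j = {}) \<and> \<Union>(set Is) = {1..n}}"

definition cyc_rel :: "nat \<Rightarrow> nat \<Rightarrow> (nat set list \<times> nat set list) set" where
  "cyc_rel n l = {(p, q). p \<in> ord_parts n l \<and> q \<in> ord_parts n l \<and> (\<exists>k. q = rotate k p)}"

definition cyc_parts :: "nat \<Rightarrow> nat \<Rightarrow> nat set list set set" where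
  "cyc_parts n l = ord_parts n l // cyc_rel n l"

definition cyc_term :: "(nat \<Rightarrow> real) \<Rightarrow> nat set list \<Rightarrow> complex" where
  "cyc_term x Is =
    (let l = length Is; X = (\<lambda>j. xI x (Is!j)) in
     complex_of_real (exp ((\<Sum>j<l. (X j)^3) / 24) / (2 * pi) ^ l)
     * integral\<^sup>L (PiM {..<l} (\<lambda>_. lborel))
        (\<lambda>f. complex_of_real (\<Prod>j<l. exp (- ((f j) ^ 2) / (2 * X j)) / X j)
             / (\<Prod>j<l. \<i> * complex_of_real (f j / X j - f ((j+1) mod l) / X ((j+1) mod l))
                        - complex_of_real ((X j + X ((j+1) mod l)) / 2))))"

end

theory Submission
  imports Defs "HOL-Probability.Probability" "HOL-Complex_Analysis.Complex_Analysis"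
    "HOL-Combinatorics.Multiset_Permutations"
begin

text \<open>
  Put \<open>\<beta> j = \<i> a j / x j\<close>. Up to the factor \<open>1 / \<Prod> x j\<close>, \<open>P\<^sub>n\<close> is the sum over all words \<open>\<sigma>\<close> of
  \<open>exp (\<Sum>i<j. x (\<sigma> i) x (\<sigma> j) (\<beta> (\<sigma> i) - \<beta> (\<sigma> j)) / 2)\<close> divided by the product of consecutive
  differences of \<open>\<beta>\<close> along \<open>\<sigma>\<close> (a Kleiss-Kuijf type identity). With \<open>X = \<Sum> x j\<close> and
  \<open>G s = s (X - s) / 2\<close>, each summand is a product of factors \<open>exp (g D) / D\<close>, where \<open>D\<close> is such a
  difference and \<open>g\<close> the value of \<open>G\<close> at the accumulated weight. Moving the points \<open>\<beta> j\<close> apart by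
  small real shifts (harmless, since the whole sum is bounded by the maximum principle), each factor
  becomes the Laplace transform of a half-line indicator, and the Gaussian integral of a word becomes
  an integral of a product of heat kernels with constraints \<open>t \<ge> g\<close> (ascents) or \<open>t \<le> g\<close> (descents).
  Writing the latter indicator as \<open>1 - indicator\<close> and convolving heat kernels merges descending runs
  into blocks, so the sum over words becomes a signed sum over ordered set partitions. The cyclic
  integrals give the same terms: the \<open>l\<close> cyclic denominators add up to \<open>-X\<close>, so their inverse
  product is \<open>-1/X\<close> times a sum over rotations of products of only \<open>l - 1\<close> inverses. Part (2)
  is the Laplace transform applied to all \<open>l\<close> denominators.
\<close>

section \<open>Nested commutator sums as sums over words\<close>

text \<open>The parabola \<open>G\<close> comes from summation by parts: the gap at accumulated
  weight \<open>s\<close> carries every pair of letters on opposite sides of it, of total weight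
  \<open>s (X - s)\<close>. Merging needs no cancellation. Expanding the descents marks cuts in a
  word, namely all ascents and some of the descents. Between cuts the letters decrease, and a set
  has exactly one decreasing arrangement, so words with marked cuts are the same as ordered set
  partitions. The obstacle in the limit of vanishing shifts is that single words have poles where
  points collide. A bound on the whole word sum, uniform over a strip, is therefore needed for
  dominated convergence. The cyclic side meets the same \<open>G\<close> as follows. The real part
  \<open>-(X j + X k)/2\<close> of a cyclic denominator is the difference of the midpoints of two
  adjacent intervals. Shifting the points by midpoints thus gives a chain with threshold 0;
  completing squares then displaces the path by \<open>G\<close> and leaves
  \<open>T^3/24 - (sum of X j ^3)/24\<close>, which accounts for the cubic exponentials on both
  sides.\<close>

fun ptR :: "('a \<Rightarrow> complex) \<Rightarrow> complex \<Rightarrow> 'a list \<Rightarrow> complex" where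
  "ptR b p [] = 1"
| "ptR b p (r # R) = ptR b (b r) R / (p - b r)"

text \<open>The list is read outwards from the pinned point, so it is the left part of the word
  reversed; the differences are therefore taken as outer minus inner.\<close>

fun ptL :: "('a \<Rightarrow> complex) \<Rightarrow> complex \<Rightarrow> 'a list \<Rightarrow> complex" where
  "ptL b p [] = 1"
| "ptL b p (l # L) = ptL b (b l) L / (b l - p)"

text \<open>The open Parke-Taylor factor of a word.\<close>

fun PT :: "('a \<Rightarrow> complex) \<Rightarrow> 'a list \<Rightarrow> complex" where
  "PT b [] = 1"
| "PT b (k # ks) = ptR b (b k) ks"

fun pairsum :: "('a \<Rightarrow> 'a \<Rightarrow> complex) \<Rightarrow> 'a list \<Rightarrow> complex" where
  "pairsum w [] = 0"
| "pairsum w (k # ks) = (\<Sum>j\<leftarrow>ks. w k j) + pairsum w ks"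

text \<open>A pair stands for the word \<open>rev L @ k # R\<close> around a pinned letter
  \<open>k\<close> outside \<open>S\<close>. With \<open>L\<close> stored outwards, both neighbours
  of \<open>k\<close> are heads of lists.\<close>

definition splits :: "'a set \<Rightarrow> ('a list \<times> 'a list) set" where
  "splits S = {(L, R). distinct (L @ R) \<and> set L \<union> set R = S}"

text \<open>With \<open>W j\<close> the coupling of the pinned letter to \<open>j\<close>, this is
  half the pair sum of the full word; letters on the left precede the pinned one, whence the minus
  sign by antisymmetry. \<open>W\<close> is a parameter because in the recursion the pinned letter
  inherits the couplings of all letters absorbed so far.\<close>

definition pinned_exponent ::
    "('a \<Rightarrow> 'a \<Rightarrow> complex) \<Rightarrow> ('a \<Rightarrow> complex) \<Rightarrow> 'a list \<Rightarrow> 'a list \<Rightarrow> complex" where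
  "pinned_exponent w W L R =
     (pairsum w (rev L @ R) - (\<Sum>l\<leftarrow>L. W l) + (\<Sum>r\<leftarrow>R. W r)) / 2"

definition pinned_sum ::
    "('a \<Rightarrow> 'a \<Rightarrow> complex) \<Rightarrow> ('a \<Rightarrow> complex) \<Rightarrow> ('a \<Rightarrow> complex) \<Rightarrow> complex \<Rightarrow> 'a set \<Rightarrow> complex" where
  "pinned_sum w b W p S =
     (\<Sum>(L, R)\<in>splits S. exp (pinned_exponent w W L R) * ptL b p L * ptR b p R)"

definition word_sum :: "('a \<Rightarrow> 'a \<Rightarrow> complex) \<Rightarrow> ('a \<Rightarrow> complex) \<Rightarrow> 'a set \<Rightarrow> complex" where
  "word_sum w b S = (\<Sum>ks\<in>permutations_of_set S. exp (pairsum w ks / 2) * PT b ks)"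

text \<open>One summand of \<open>Pn\<close> as a process absorbing letters: couplings accumulate in
  \<open>W\<close>, but only the letter absorbed last enters the next denominator.\<close>

fun nested :: "('a \<Rightarrow> 'a \<Rightarrow> complex) \<Rightarrow> ('a \<Rightarrow> complex) \<Rightarrow> ('a \<Rightarrow> complex) \<Rightarrow> complex \<Rightarrow> 'a list \<Rightarrow> complex" where
  "nested w b W p [] = 1"
| "nested w b W p (m # ms) = zeta (W m) / (p - b m) * nested w b (\<lambda>j. W j + w m j) (b m) ms"

lemma pairsum_append:
  "pairsum w (xs @ ys) = pairsum w xs + pairsum w ys + (\<Sum>x\<leftarrow>xs. \<Sum>y\<leftarrow>ys. w x y)"
  by (induction xs) (auto simp: algebra_simps)

lemma finite_splits: "finite S \<Longrightarrow> finite (splits S)"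
proof -
  assume "finite S"
  have "splits S \<subseteq> {xs. set xs \<subseteq> S \<and> distinct xs} \<times> {xs. set xs \<subseteq> S \<and> distinct xs}"
    by (auto simp: splits_def)
  moreover have "finite {xs. set xs \<subseteq> S \<and> distinct xs}"
    using finite_subset_distinct[OF \<open>finite S\<close>] by simp
  ultimately show ?thesis
    by (meson finite_SigmaI finite_subset)
qed

lemma splits_empty [simp]: "splits {} = {([], [])}"
  by (auto simp: splits_def)

lemma bij_betw_splits_Cons_right:
  "bij_betw (\<lambda>(m, L, R). (L, m # R)) (SIGMA m:S. splits (S - {m})) {(L, R) \<in> splits S. R \<noteq> []}"
proof (rule bij_betw_byWitness[where f' = "\<lambda>(L, R). (hd R, L, tl R)"])
  show "(\<lambda>(m, L, R). (L, m # R)) ` (SIGMA m:S. splits (S - {m})) \<subseteq> {(L, R) \<in> splits S. R \<noteq> []}"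
    unfolding splits_def by fastforce
  show "(\<lambda>(L, R). (hd R, L, tl R)) ` {(L, R) \<in> splits S. R \<noteq> []} \<subseteq> (SIGMA m:S. splits (S - {m}))"
  proof (clarify, goal_cases)
    case (1 m L R a b)
    then show ?case by (cases b) (auto simp: splits_def)
  qed
qed auto

lemma bij_betw_splits_Cons_left:
  "bij_betw (\<lambda>(m, L, R). (m # L, R)) (SIGMA m:S. splits (S - {m})) {(L, R) \<in> splits S. L \<noteq> []}"
proof (rule bij_betw_byWitness[where f' = "\<lambda>(L, R). (hd L, tl L, R)"])
  show "(\<lambda>(m, L, R). (m # L, R)) ` (SIGMA m:S. splits (S - {m})) \<subseteq> {(L, R) \<in> splits S. L \<noteq> []}"
    unfolding splits_def by fastforce
  show "(\<lambda>(L, R). (hd L, tl L, R)) ` {(L, R) \<in> splits S. L \<noteq> []} \<subseteq> (SIGMA m:S. splits (S - {m}))"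
  proof (clarify, goal_cases)
    case (1 m L R a b)
    then show ?case by (cases a) (auto simp: splits_def)
  qed
qed auto

text \<open>Moving \<open>m\<close> from the word into \<open>W\<close> preserves all its
  interactions except the one with the pinned point itself. That one is \<open>W m / 2\<close> on
  the right and \<open>- W m / 2\<close> on the left, the two exponents of
  \<open>zeta (W m)\<close>.\<close>

lemma pinned_exponent_Cons_right:
  assumes "\<And>i j. w i j = - w j i"
  shows "pinned_exponent w W L (m # R) = W m / 2 + pinned_exponent w (\<lambda>j. W j + w m j) L R"
proof -
  have "(\<Sum>l\<leftarrow>rev L. w l m) = - (\<Sum>l\<leftarrow>L. w m l)"
    by (induction L) (auto simp: assms[of _ m])
  then show ?thesis
    by (simp add: pinned_exponent_def pairsum_append sum_list_addf field_simps)
qed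

lemma pinned_exponent_Cons_left:
  assumes "\<And>i j. w i j = - w j i"
  shows "pinned_exponent w W (m # L) R = - W m / 2 + pinned_exponent w (\<lambda>j. W j + w m j) L R"
proof -
  have "(\<Sum>l\<leftarrow>rev L. w l m) = - (\<Sum>l\<leftarrow>L. w m l)"
    by (induction L) (auto simp: assms[of _ m])
  then show ?thesis
    by (simp add: pinned_exponent_def pairsum_append sum_list_addf field_simps)
qed

lemma partial_fractions:
  fixes p l r :: complex
  assumes "p \<noteq> r" "p \<noteq> l" "l \<noteq> r"
  shows "1 / ((p - r) * (l - r)) - 1 / ((p - l) * (l - r)) = 1 / ((l - p) * (p - r))"
proof -
  have *: "1 / (a * c) - 1 / (d * c) = 1 / (- d * a)" if "a \<noteq> 0" "c \<noteq> 0" "d \<noteq> 0" "a = d + c"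
    for a c d :: complex
    using that(1-3) unfolding that(4) by (simp add: divide_simps)
  have "1 / ((p - r) * (l - r)) - 1 / ((p - l) * (l - r)) = 1 / (- (p - l) * (p - r))"
    by (rule *) (use assms in auto)
  then show ?thesis by (simp only: minus_diff_eq)
qed

text \<open>Each split word \<open>(L, R)\<close> arises on the right-hand side twice, with \<open>m\<close> the neighbour of
  the pinned point on either side; the two contributions combine by
  \<open>1/((p-r)(l-r)) - 1/((p-l)(l-r)) = 1/((l-p)(p-r))\<close>.\<close>
lemma pinned_sum_rec:
  assumes w: "\<And>i j. w i j = - w j i" and S: "finite S" "S \<noteq> {}"
    and b: "inj_on b S" "p \<notin> b ` S"
  shows "pinned_sum w b W p S =
    (\<Sum>m\<in>S. zeta (W m) / (p - b m) * pinned_sum w b (\<lambda>j. W j + w m j) (b m) (S - {m}))"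
proof -
  let ?W = "\<lambda>m j. W j + w m j"
  define E where "E = (\<lambda>(L, R). exp (pinned_exponent w W L R))"
  \<comment> \<open>\<open>cR\<close> and \<open>cL\<close> are the denominators obtained when the
    absorbed letter is the right or left neighbour of the pinned point; both sides of the word then
    hang off \<open>b m\<close> instead of \<open>p\<close>. The value 0 records that a word with
    that side empty does not arise in this way.\<close>
  define cR where "cR = (\<lambda>(L, R). case R of [] \<Rightarrow> 0 | m # R' \<Rightarrow> ptL b (b m) L * ptR b (b m) R' / (p - b m))"
  define cL where "cL = (\<lambda>(L, R). case L of [] \<Rightarrow> 0 | m # L' \<Rightarrow> ptL b (b m) L' * ptR b (b m) R / (p - b m))"
  have fin: "finite (splits T)" if "T \<subseteq> S" for T
    using S(1) that finite_splits finite_subset by metis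
  have "(\<Sum>m\<in>S. zeta (W m) / (p - b m) * pinned_sum w b (?W m) (b m) (S - {m}))
     = (\<Sum>m\<in>S. \<Sum>(L, R)\<in>splits (S - {m}). E (L, m # R) * cR (L, m # R) - E (m # L, R) * cL (m # L, R))"
    unfolding pinned_sum_def sum_distrib_left
  proof (intro sum.cong refl, clarify)
    fix m L R
    let ?e = "pinned_exponent w (?W m) L R"
    have "zeta (W m) * exp ?e = exp (W m / 2 + ?e) - exp (- W m / 2 + ?e)"
      unfolding zeta_def exp_add left_diff_distrib ..
    also have "\<dots> = E (L, m # R) - E (m # L, R)"
      unfolding E_def by (simp only: prod.case pinned_exponent_Cons_right[OF w] pinned_exponent_Cons_left[OF w])
    finally have e: "zeta (W m) * exp ?e = E (L, m # R) - E (m # L, R)" .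
    have "zeta (W m) / (p - b m) * (exp ?e * ptL b (b m) L * ptR b (b m) R)
      = (zeta (W m) * exp ?e) * (ptL b (b m) L * ptR b (b m) R / (p - b m))"
      by simp
    also note e
    finally have "zeta (W m) / (p - b m) * (exp ?e * ptL b (b m) L * ptR b (b m) R)
      = (E (L, m # R) - E (m # L, R)) * (ptL b (b m) L * ptR b (b m) R / (p - b m))" .
    then show "zeta (W m) / (p - b m) * (exp ?e * ptL b (b m) L * ptR b (b m) R)
      = E (L, m # R) * cR (L, m # R) - E (m # L, R) * cL (m # L, R)"
      by (simp only: cR_def cL_def left_diff_distrib prod.case list.case)
  qed
  also have "\<dots> = (\<Sum>(m, L, R)\<in>(SIGMA m:S. splits (S - {m})). E (L, m # R) * cR (L, m # R))
               - (\<Sum>(m, L, R)\<in>(SIGMA m:S. splits (S - {m})). E (m # L, R) * cL (m # L, R))"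
    using fin S(1) by (simp add: sum.Sigma sum_subtractf[symmetric] split_def)
  also have "(\<Sum>(m, L, R)\<in>(SIGMA m:S. splits (S - {m})). E (L, m # R) * cR (L, m # R))
      = (\<Sum>q\<in>{(L, R) \<in> splits S. R \<noteq> []}. E q * cR q)"
    by (subst sum.reindex_bij_betw[OF bij_betw_splits_Cons_right, symmetric]) (auto intro!: sum.cong)
  also have "\<dots> = (\<Sum>q\<in>splits S. E q * cR q)"
    using fin[of S] by (intro sum.mono_neutral_left) (auto simp: cR_def)
  also have "(\<Sum>(m, L, R)\<in>(SIGMA m:S. splits (S - {m})). E (m # L, R) * cL (m # L, R))
      = (\<Sum>q\<in>{(L, R) \<in> splits S. L \<noteq> []}. E q * cL q)"
    by (subst sum.reindex_bij_betw[OF bij_betw_splits_Cons_left, symmetric]) (auto intro!: sum.cong)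
  also have "\<dots> = (\<Sum>q\<in>splits S. E q * cL q)"
    using fin[of S] by (intro sum.mono_neutral_left) (auto simp: cL_def)
  also have "(\<Sum>q\<in>splits S. E q * cR q) - (\<Sum>q\<in>splits S. E q * cL q)
      = (\<Sum>q\<in>splits S. E q * (cR q - cL q))"
    by (simp add: sum_subtractf algebra_simps)
  also have "\<dots> = pinned_sum w b W p S"
    unfolding pinned_sum_def
  proof (intro sum.cong refl, safe)
    fix L R assume LR: "(L, R) \<in> splits S"
    have "cR (L, R) - cL (L, R) = ptL b p L * ptR b p R"
    \<comment> \<open>When one side is empty only one contribution survives and partial fractions
      are not involved; both sides cannot be empty because \<open>S\<close> is not.\<close>
    proof (cases L)
      case Nil
      then show ?thesis
        using LR S by (cases R) (auto simp: cR_def cL_def splits_def)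
    next
      case (Cons l L')
      have pl: "p \<noteq> b l" using Cons LR b by (auto simp: splits_def)
      show ?thesis
      proof (cases R)
        case Nil
        then show ?thesis using Cons pl by (auto simp: cR_def cL_def field_simps)
      next
        case (Cons r R')
        have pr: "p \<noteq> b r" and lr: "b l \<noteq> b r"
          using Cons \<open>L = l # L'\<close> LR b by (auto simp: splits_def inj_on_def)
        note partial_fractions[OF pr pl lr]
        then have "ptL b (b l) L' * ptR b (b r) R' * (1 / ((p - b r) * (b l - b r)))
             - ptL b (b l) L' * ptR b (b r) R' * (1 / ((p - b l) * (b l - b r)))
            = ptL b (b l) L' * ptR b (b r) R' * (1 / ((b l - p) * (p - b r)))"
          by (metis right_diff_distrib)
        then show ?thesis
          unfolding cR_def cL_def Cons \<open>L = l # L'\<close>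
          by (simp add: mult_ac)
      qed
    qed
    then show "E (L, R) * (cR (L, R) - cL (L, R)) = exp (pinned_exponent w W L R) * ptL b p L * ptR b p R"
      by (simp add: E_def)
  qed
  finally show ?thesis by simp
qed

lemma pinned_sum_empty [simp]: "pinned_sum w b W p {} = 1"
  by (simp add: pinned_sum_def pinned_exponent_def)

lemma sum_permutations_of_set_rec:
  assumes "finite S" "S \<noteq> {}"
  shows "(\<Sum>ks\<in>permutations_of_set S. f ks) = (\<Sum>m\<in>S. \<Sum>ks\<in>permutations_of_set (S - {m}). f (m # ks))"
proof -
  have "(\<Sum>ks\<in>permutations_of_set S. f ks) = (\<Sum>m\<in>S. \<Sum>ks\<in>(#) m ` permutations_of_set (S - {m}). f ks)"
    unfolding permutations_of_set_nonempty[OF assms(2)] using assms(1)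
    by (intro sum.UNION_disjoint) auto
  also have "\<dots> = (\<Sum>m\<in>S. \<Sum>ks\<in>permutations_of_set (S - {m}). f (m # ks))"
    by (simp add: sum.reindex)
  finally show ?thesis .
qed

text \<open>Iteration of \<open>pinned_sum_rec\<close> until nothing is left; \<open>ks\<close>
  records the order of absorption.\<close>

lemma pinned_sum_eq_nested:
  assumes w: "\<And>i j. w i j = - w j i" and "finite S" and b: "inj_on b S" "p \<notin> b ` S"
  shows "pinned_sum w b W p S = (\<Sum>ks\<in>permutations_of_set S. nested w b W p ks)"
  using assms(2-)
proof (induction "card S" arbitrary: S W p)
  case 0
  then show ?case by simp
next
  case (Suc n)
  then have ne: "S \<noteq> {}" by auto
  have "pinned_sum w b (\<lambda>j. W j + w m j) (b m) (S - {m})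
     = (\<Sum>ks\<in>permutations_of_set (S - {m}). nested w b (\<lambda>j. W j + w m j) (b m) ks)" if "m \<in> S" for m
    using Suc.prems Suc.hyps(2) that by (intro Suc.hyps(1)) (auto simp: inj_on_def)
  then show ?case
    using Suc.prems by (subst pinned_sum_rec[OF w]) 
      (simp_all add: ne sum_permutations_of_set_rec sum_distrib_left)
qed

lemma PT_rev_append: "PT b (rev L @ k # R) = ptL b (b k) L * ptR b (b k) R"
  by (induction L arbitrary: k R) auto

lemma bij_betw_splits_permutations:
  assumes "k \<notin> S"
  shows "bij_betw (\<lambda>(L, R). rev L @ k # R) (splits S) (permutations_of_set (insert k S))"
proof (rule bij_betwI', goal_cases)
  case (1 x y)
  obtain L R L' R' where xy: "x = (L, R)" "y = (L', R')" by (cases x, cases y)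
  have *: "k \<notin> set L" "k \<notin> set L'" "k \<notin> set R" "k \<notin> set R'" using 1 xy assms by (auto simp: splits_def)
  have "rev L = rev L' \<and> R = R'" if "rev L @ k # R = rev L' @ k # R'"
    using append_Cons_eq_iff[of k "rev L" R "rev L'" R'] that * by auto
  then show ?case using xy by auto
next
  case (2 x)
  then show ?case using assms by (auto simp: splits_def permutations_of_set_def)
next
  case (3 y)
  then have "k \<in> set y" by (auto simp: permutations_of_set_def)
  then obtain L R where y: "y = L @ k # R" by (meson split_list)
  then have "(rev L, R) \<in> splits S" using 3 assms by (auto simp: splits_def permutations_of_set_def)
  then show ?case using y by force
qed

text \<open>Any letter may be pinned. Letter 1 is chosen to recognise \<open>Pn\<close>, and the
  letter whose point moves is chosen to prove boundedness.\<close>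

lemma word_sum_eq_pinned_sum:
  assumes w: "\<And>i j. w i j = - w j i" and "k \<notin> S"
  shows "word_sum w b (insert k S) = pinned_sum w b (w k) (b k) S"
proof -
  have "(\<Sum>l\<leftarrow>rev L. w l k) = - (\<Sum>l\<leftarrow>L. w k l)" for L
    by (induction L) (auto simp: w[of _ k])
  then show ?thesis
    unfolding word_sum_def pinned_sum_def sum.reindex_bij_betw[OF bij_betw_splits_permutations[OF assms(2)], symmetric]
    by (intro sum.cong refl) (auto simp: PT_rev_append pairsum_append pinned_exponent_def sum_list_addf algebra_simps)
qed

section \<open>Boundedness of the word sum\<close>

definition coupling :: "('a \<Rightarrow> real) \<Rightarrow> ('a \<Rightarrow> complex) \<Rightarrow> 'a \<Rightarrow> 'a \<Rightarrow> complex" where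
  "coupling x \<beta> i j = complex_of_real (x i * x j) * (\<beta> i - \<beta> j)"

lemma coupling_antisym: "coupling x \<beta> i j = - coupling x \<beta> j i"
  by (simp add: coupling_def algebra_simps)

text \<open>The value at 0 fills the removable singularity, as \<open>zeta\<close> has a simple zero
  with derivative 1 there.\<close>

definition zeta_quot :: "real \<Rightarrow> complex \<Rightarrow> complex" where
  "zeta_quot c v = (if v = 0 then of_real c else zeta (of_real c * v) / v)"

lemma zeta_quot_holomorphic: "zeta_quot c holomorphic_on A"
proof -
  let ?F = "\<lambda>v. zeta (of_real c * v)"
  have "(?F has_field_derivative of_real c) (at 0)"
    unfolding zeta_def by (auto intro!: derivative_eq_intros)
  then have d: "deriv ?F 0 = of_real c" by (rule DERIV_imp_deriv)
  have "?F holomorphic_on UNIV" unfolding zeta_def by (intro holomorphic_intros) auto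
  then have "(\<lambda>v. if v = 0 then deriv ?F 0 else (?F v - ?F 0) / (v - 0)) holomorphic_on UNIV"
    by (rule pole_lemma) auto
  moreover have "(\<lambda>v. if v = 0 then deriv ?F 0 else (?F v - ?F 0) / (v - 0)) = zeta_quot c"
    unfolding d by (auto simp: zeta_quot_def zeta_def fun_eq_iff)
  ultimately show ?thesis by (metis holomorphic_on_subset subset_UNIV)
qed

lemma norm_zeta_le: "norm (zeta z) \<le> 2 * exp (\<bar>Re z\<bar> / 2)"
proof -
  have "norm (zeta z) \<le> exp (Re z / 2) + exp (- Re z / 2)"
    unfolding zeta_def by (rule order.trans[OF norm_triangle_ineq4]) simp
  also have "\<dots> \<le> exp (\<bar>Re z\<bar> / 2) + exp (\<bar>Re z\<bar> / 2)"
    by (intro add_mono) auto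
  finally show ?thesis by simp
qed

lemma Re_sum_list_bound:
  assumes "\<And>j. j \<in> set ks \<Longrightarrow> \<bar>Re (f j)\<bar> \<le> c"
  shows "\<bar>Re (\<Sum>j\<leftarrow>ks. f j)\<bar> \<le> c * length ks"
  using assms
proof (induction ks)
  case (Cons a ks)
  have "\<bar>Re (f a)\<bar> \<le> c" "\<bar>Re (\<Sum>j\<leftarrow>ks. f j)\<bar> \<le> c * length ks" using Cons by auto
  then show ?case by (simp add: algebra_simps)
qed simp

lemma Re_pairsum_bound:
  assumes "\<And>i j. i \<in> set ks \<Longrightarrow> j \<in> set ks \<Longrightarrow> \<bar>Re (w i j)\<bar> \<le> c" "0 \<le> c"
  shows "\<bar>Re (pairsum w ks)\<bar> \<le> c * (length ks)\<^sup>2"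
  using assms(1)
proof (induction ks)
  case (Cons a ks)
  have "\<bar>Re (\<Sum>j\<leftarrow>ks. w a j)\<bar> \<le> c * length ks" using Cons.prems by (intro Re_sum_list_bound) auto
  moreover have "\<bar>Re (pairsum w ks)\<bar> \<le> c * (length ks)\<^sup>2" using Cons by auto
  moreover have "c * length ks + c * (length ks)\<^sup>2 \<le> c * (length (a # ks))\<^sup>2"
    using assms(2) by (simp add: power2_eq_square algebra_simps)
  ultimately show ?case by simp
qed simp

lemma norm_ptR_le_1:
  assumes "distinct R" "\<And>r. r \<in> set R \<Longrightarrow> 1 \<le> norm (p - b r)"
    "\<And>r s. r \<in> set R \<Longrightarrow> s \<in> set R \<Longrightarrow> r \<noteq> s \<Longrightarrow> 1 \<le> norm (b r - b s)"
  shows "norm (ptR b p R) \<le> 1"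
  using assms
proof (induction R arbitrary: p)
  case (Cons r R)
  have "norm (ptR b (b r) R) \<le> 1" using Cons.prems by (intro Cons.IH) auto
  moreover have "1 \<le> norm (p - b r)" using Cons.prems by auto
  ultimately have "norm (ptR b (b r) R) / norm (p - b r) \<le> 1 / 1" by (intro frac_le) auto
  then show ?case by (simp add: norm_divide)
qed simp

lemma pairsum_cong:
  assumes "\<And>i j. i \<in> set ks \<Longrightarrow> j \<in> set ks \<Longrightarrow> w i j = w' i j"
  shows "pairsum w ks = pairsum w' ks"
  using assms
proof (induction ks)
  case (Cons k ks)
  then have "map (w k) ks = map (w' k) ks" by (intro map_cong) auto
  moreover have "pairsum w ks = pairsum w' ks" using Cons by auto
  ultimately show ?case by (simp only: pairsum.simps)
qed simp

lemma ptR_cong: "(\<And>r. r \<in> set R \<Longrightarrow> b r = b' r) \<Longrightarrow> ptR b p R = ptR b' p R"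
  by (induction R arbitrary: p) auto

lemma ptL_cong: "(\<And>r. r \<in> set R \<Longrightarrow> b r = b' r) \<Longrightarrow> ptL b p R = ptL b' p R"
  by (induction R arbitrary: p) auto

lemma pinned_sum_cong:
  assumes "\<And>i j. i \<in> S \<Longrightarrow> j \<in> S \<Longrightarrow> w i j = w' i j" "\<And>i. i \<in> S \<Longrightarrow> b i = b' i"
    "\<And>i. i \<in> S \<Longrightarrow> W i = W' i"
  shows "pinned_sum w b W p S = pinned_sum w' b' W' p S"
  unfolding pinned_sum_def
proof (intro sum.cong refl, clarify)
  fix L R assume LR: "(L, R) \<in> splits S"
  have "pairsum w (rev L @ R) = pairsum w' (rev L @ R)"
    using LR assms by (intro pairsum_cong) (auto simp: splits_def)
  moreover have "map W L = map W' L" "map W R = map W' R"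
    using LR assms by (auto simp: splits_def intro!: map_cong)
  moreover have "ptL b p L = ptL b' p L" "ptR b p R = ptR b' p R"
    using LR assms by (auto intro!: ptL_cong ptR_cong simp: splits_def)
  ultimately show "exp (pinned_exponent w W L R) * ptL b p L * ptR b p R =
      exp (pinned_exponent w' W' L R) * ptL b' p L * ptR b' p R"
    unfolding pinned_exponent_def by (simp del: map_eq_conv)
qed

text \<open>Uniformity in \<open>W\<close> is the point: \<open>W\<close> occurs only in the
  exponents, so its real parts alone matter. In the application \<open>W\<close> contains the moving
  variable, whose imaginary part is unbounded.\<close>

lemma pinned_sum_bounded:
  assumes "finite S"
  shows "\<exists>K\<ge>0. \<forall>W. (\<forall>j\<in>S. \<bar>Re (W j)\<bar> \<le> c) \<longrightarrow> norm (pinned_sum w b W p S) \<le> K"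
proof -
  define K where "K = (\<Sum>(L, R)\<in>splits S. exp ((\<bar>Re (pairsum w (rev L @ R))\<bar> + c * length L + c * length R) / 2)
      * norm (ptL b p L) * norm (ptR b p R))"
  have "norm (pinned_sum w b W p S) \<le> K" if W: "\<forall>j\<in>S. \<bar>Re (W j)\<bar> \<le> c" for W
    unfolding pinned_sum_def K_def
  proof (rule sum_norm_le, clarify)
    fix L R assume LR: "(L, R) \<in> splits S"
    have "\<bar>Re (\<Sum>l\<leftarrow>L. W l)\<bar> \<le> c * length L" "\<bar>Re (\<Sum>l\<leftarrow>R. W l)\<bar> \<le> c * length R"
      using LR W by (auto intro!: Re_sum_list_bound simp: splits_def)
    then have "Re (pinned_exponent w W L R) \<le> (\<bar>Re (pairsum w (rev L @ R))\<bar> + c * length L + c * length R) / 2"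
      unfolding pinned_exponent_def by simp
    then show "norm (exp (pinned_exponent w W L R) * ptL b p L * ptR b p R)
      \<le> exp ((\<bar>Re (pairsum w (rev L @ R))\<bar> + c * length L + c * length R) / 2)
      * norm (ptL b p L) * norm (ptR b p R)"
      unfolding norm_mult by (intro mult_right_mono) auto
  qed
  moreover have "K \<ge> 0" unfolding K_def by (intro sum_nonneg) auto
  ultimately show ?thesis by auto
qed

lemma pinned_sum_holomorphic:
  assumes "\<And>j. j \<in> S \<Longrightarrow> (\<lambda>z. W z j) holomorphic_on A"
  shows "(\<lambda>z. pinned_sum w b (W z) p S) holomorphic_on A"
proof -
  have *: "(\<lambda>z. \<Sum>l\<leftarrow>L. W z l) holomorphic_on A" if "set L \<subseteq> S" for L
    using that assms by (induction L) (auto intro!: holomorphic_intros)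
  show ?thesis
    unfolding pinned_sum_def split_def pinned_exponent_def
    by (intro holomorphic_intros *) (auto simp: splits_def)
qed

text \<open>Starting configuration for the maximum principle. The real parts lie on vertical lines
  at mutual distance at least 1, so every denominator has modulus at least 1, and they are bounded
  by \<open>n\<close>, which controls the exponents whatever the imaginary parts are.\<close>

lemma word_sum_bounded_far:
  assumes "finite S" "S \<subseteq> {1..n}"
    "\<forall>j\<in>S. \<bar>Re (\<beta> j)\<bar> = real j"
  shows "norm (word_sum (coupling x \<beta>) \<beta> S)
     \<le> (\<Sum>ks\<in>permutations_of_set S. exp ((\<Sum>i\<in>S. \<bar>x i\<bar>)\<^sup>2 * (2 * n) * (length ks)\<^sup>2 / 2))"
  unfolding word_sum_def
proof (rule sum_norm_le)
  fix ks assume "ks \<in> permutations_of_set S"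
  then have ks: "set ks = S" "distinct ks" by (auto simp: permutations_of_set_def)
  have gap: "1 \<le> norm (\<beta> i - \<beta> j)" if "i \<in> S" "j \<in> S" "i \<noteq> j" for i j
  proof -
    have "\<bar>Re (\<beta> i)\<bar> = real i" "\<bar>Re (\<beta> j)\<bar> = real j" "1 \<le> \<bar>real i - real j\<bar>"
      using assms that by auto
    then have "1 \<le> \<bar>Re (\<beta> i - \<beta> j)\<bar>" by simp
    then show ?thesis using abs_Re_le_cmod order.trans by blast
  qed
  have "norm (PT \<beta> ks) \<le> 1"
  proof (cases ks)
    case (Cons k R)
    then show ?thesis using ks gap by (auto intro!: norm_ptR_le_1)
  qed simp
  moreover have "\<bar>Re (coupling x \<beta> i j)\<bar> \<le> (\<Sum>i\<in>S. \<bar>x i\<bar>)\<^sup>2 * (2 * n)" if "i \<in> S" "j \<in> S" for i j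
  proof -
    have le: "\<bar>x i\<bar> \<le> (\<Sum>i\<in>S. \<bar>x i\<bar>)" if "i \<in> S" for i
      using that assms(1) by (intro member_le_sum) auto
    have "\<bar>x i\<bar> * \<bar>x j\<bar> \<le> (\<Sum>i\<in>S. \<bar>x i\<bar>) * (\<Sum>i\<in>S. \<bar>x i\<bar>)"
      using that le by (intro mult_mono sum_nonneg) auto
    moreover have "\<bar>Re (\<beta> i)\<bar> \<le> n" "\<bar>Re (\<beta> j)\<bar> \<le> n" using assms that by auto
    then have "\<bar>Re (\<beta> i - \<beta> j)\<bar> \<le> 2 * n" by simp
    ultimately have "(\<bar>x i\<bar> * \<bar>x j\<bar>) * \<bar>Re (\<beta> i - \<beta> j)\<bar> \<le> ((\<Sum>i\<in>S. \<bar>x i\<bar>) * (\<Sum>i\<in>S. \<bar>x i\<bar>)) * (2 * n)"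
      by (rule mult_mono) (auto intro!: mult_nonneg_nonneg sum_nonneg)
    then show ?thesis by (simp add: coupling_def abs_mult power2_eq_square)
  qed
  then have "\<bar>Re (pairsum (coupling x \<beta>) ks)\<bar> \<le> (\<Sum>i\<in>S. \<bar>x i\<bar>)\<^sup>2 * (2 * n) * (length ks)\<^sup>2"
    using ks by (intro Re_pairsum_bound) auto
  then have "Re (pairsum (coupling x \<beta>) ks) / 2 \<le> (\<Sum>i\<in>S. \<bar>x i\<bar>)\<^sup>2 * (2 * n) * (length ks)\<^sup>2 / 2"
    by linarith
  then have "norm (exp (pairsum (coupling x \<beta>) ks / 2)) \<le> exp ((\<Sum>i\<in>S. \<bar>x i\<bar>)\<^sup>2 * (2 * n) * (length ks)\<^sup>2 / 2)"
    by simp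
  ultimately show "norm (exp (pairsum (coupling x \<beta>) ks / 2) * PT \<beta> ks)
      \<le> exp ((\<Sum>i\<in>S. \<bar>x i\<bar>)\<^sup>2 * (2 * n) * (length ks)\<^sup>2 / 2)"
    unfolding norm_mult using mult_mono[of _ _ "norm (PT \<beta> ks)" 1] by fastforce
qed

text \<open>As a function of a single variable the word sum is entire: the poles at the other points are
  cancelled by the zeros of \<open>zeta\<close>.\<close>
lemma word_sum_entire_extension:
  assumes "finite S" "k \<notin> S" "S \<noteq> {}" "inj_on \<beta> S"
  obtains f where "f holomorphic_on UNIV"
    "\<And>z. z \<notin> \<beta> ` S \<Longrightarrow> f z = word_sum (coupling x (\<beta>(k := z))) (\<beta>(k := z)) (insert k S)"
    "\<And>c e. 0 < e \<Longrightarrow> \<exists>Y. \<forall>z. \<bar>Re z\<bar> \<le> c \<longrightarrow> Y \<le> \<bar>Im z\<bar> \<longrightarrow> norm (f z) \<le> e"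
proof
  define W where "W = (\<lambda>z m j. complex_of_real (x k * x j) * (z - \<beta> j) + coupling x \<beta> m j)"
  \<comment> \<open>This is the recursion pinned at \<open>k\<close>, whose point is the variable
    \<open>z\<close>. \<open>zeta_quot\<close> fills the poles at the other points; the remaining
    sums are pinned at \<beta> \<open>m\<close> and see \<open>z\<close> only through
    exponents.\<close>
  define f where "f = (\<lambda>z. \<Sum>m\<in>S. zeta_quot (x k * x m) (z - \<beta> m) *
     pinned_sum (coupling x \<beta>) \<beta> (W z m) (\<beta> m) (S - {m}))"
  show "f holomorphic_on UNIV"
  proof -
    have "(\<lambda>z. zeta_quot c (z - a)) holomorphic_on UNIV" for c a
    proof -
      have "zeta_quot c \<circ> (\<lambda>z. z - a) holomorphic_on UNIV"
        by (intro holomorphic_on_compose zeta_quot_holomorphic holomorphic_intros)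
      then show ?thesis by (simp add: o_def)
    qed
    then show ?thesis
      unfolding f_def W_def by (intro holomorphic_intros pinned_sum_holomorphic)
  qed
  show "f z = word_sum (coupling x (\<beta>(k := z))) (\<beta>(k := z)) (insert k S)" if "z \<notin> \<beta> ` S" for z
  proof -
    let ?b = "\<beta>(k := z)"
    have "inj_on ?b S" "?b k \<notin> ?b ` S"
      using assms that by (auto simp: inj_on_def)
    then have "word_sum (coupling x ?b) ?b (insert k S) =
      (\<Sum>m\<in>S. zeta (coupling x ?b k m) / (?b k - ?b m) *
        pinned_sum (coupling x ?b) ?b (\<lambda>j. coupling x ?b k j + coupling x ?b m j) (?b m) (S - {m}))"
      unfolding word_sum_eq_pinned_sum[where w = "coupling x ?b", OF coupling_antisym assms(2)]
      by (rule pinned_sum_rec[where w = "coupling x ?b", OF coupling_antisym assms(1,3)])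
    also have "\<dots> = f z"
      unfolding f_def
    proof (intro sum.cong refl arg_cong2[where f = "(*)"])
      fix m assume m: "m \<in> S"
      then have "m \<noteq> k" "z \<noteq> \<beta> m" using assms that by auto
      then show "zeta (coupling x ?b k m) / (?b k - ?b m) = zeta_quot (x k * x m) (z - \<beta> m)"
        by (simp add: zeta_quot_def coupling_def)
      show "pinned_sum (coupling x ?b) ?b (\<lambda>j. coupling x ?b k j + coupling x ?b m j) (?b m) (S - {m}) =
        pinned_sum (coupling x \<beta>) \<beta> (W z m) (\<beta> m) (S - {m})"
        using \<open>m \<noteq> k\<close> assms(2) by (simp, intro pinned_sum_cong) (auto simp: W_def coupling_def)
    qed
    finally show ?thesis by simp
  qed
  \<comment> \<open>Decay in vertical strips: the exponents have bounded real parts there, while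
    each \<open>zeta_quot\<close> contributes a denominator of modulus at least
    \<bar>\<open>Im z\<close>\<bar>\<open>- D\<close>.\<close>
  show "\<exists>Y. \<forall>z. \<bar>Re z\<bar> \<le> c \<longrightarrow> Y \<le> \<bar>Im z\<bar> \<longrightarrow> norm (f z) \<le> e" if e: "0 < e" for c e
  proof -
    define d where "d = (\<lambda>m j. \<bar>x k * x j\<bar> * (\<bar>c\<bar> + \<bar>Re (\<beta> j)\<bar>) + \<bar>Re (coupling x \<beta> m j)\<bar>)"
    have WB: "\<bar>Re (W z m j)\<bar> \<le> (\<Sum>j\<in>S. d m j)" if "\<bar>Re z\<bar> \<le> c" "j \<in> S" for z m j
    proof -
      have "\<bar>Re (W z m j)\<bar> \<le> d m j"
        unfolding W_def d_def using that
        by (auto simp: abs_mult intro!: order.trans[OF abs_triangle_ineq] mult_left_mono)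
      also have "\<dots> \<le> (\<Sum>j\<in>S. d m j)"
        using that assms(1) by (intro member_le_sum) (auto simp: d_def)
      finally show ?thesis .
    qed
    have "\<forall>m. \<exists>K\<ge>0. \<forall>V. (\<forall>j\<in>S - {m}. \<bar>Re (V j)\<bar> \<le> (\<Sum>j\<in>S. d m j)) \<longrightarrow>
         norm (pinned_sum (coupling x \<beta>) \<beta> V (\<beta> m) (S - {m})) \<le> K"
      using assms(1) by (intro allI pinned_sum_bounded) auto
    then obtain K where K: "\<And>m. 0 \<le> K m" "\<And>m V. (\<forall>j\<in>S - {m}. \<bar>Re (V j)\<bar> \<le> (\<Sum>j\<in>S. d m j)) \<Longrightarrow>
         norm (pinned_sum (coupling x \<beta>) \<beta> V (\<beta> m) (S - {m})) \<le> K m"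
      by metis
    define q where "q = (\<lambda>m. 2 * exp (\<bar>x k * x m\<bar> * (\<bar>c\<bar> + \<bar>Re (\<beta> m)\<bar>) / 2))"
    define A where "A = (\<Sum>m\<in>S. q m * K m)"
    define D where "D = (\<Sum>m\<in>S. \<bar>Im (\<beta> m)\<bar>)"
    have "norm (f z) \<le> e" if z: "\<bar>Re z\<bar> \<le> c" "D + 1 + A / e \<le> \<bar>Im z\<bar>" for z
    proof -
      have A0: "0 \<le> A" unfolding A_def q_def by (intro sum_nonneg) (auto simp: K)
      define y where "y = \<bar>Im z\<bar> - D"
      have y1: "1 + A / e \<le> y" using z by (simp add: y_def)
      moreover have "0 \<le> A / e" using A0 e by simp
      ultimately have y: "A / e \<le> y" "0 < y" by linarith+
      have "norm (f z) \<le> (\<Sum>m\<in>S. q m / y * K m)"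
        unfolding f_def
      proof (rule sum_norm_le)
        fix m assume m: "m \<in> S"
        have "\<bar>Im (\<beta> m)\<bar> \<le> D" unfolding D_def using m assms(1) by (intro member_le_sum) auto
        then have "y \<le> \<bar>Im (z - \<beta> m)\<bar>" by (simp add: y_def)
        then have ny: "y \<le> norm (z - \<beta> m)" using abs_Im_le_cmod order.trans by blast
        have "norm (zeta (of_real (x k * x m) * (z - \<beta> m))) \<le> q m"
          unfolding q_def using z
          by (intro order.trans[OF norm_zeta_le]) (auto simp: abs_mult intro!: mult_left_mono)
        then have "norm (zeta_quot (x k * x m) (z - \<beta> m)) \<le> q m / y"
          using ny y(2) by (auto simp: zeta_quot_def norm_divide q_def intro!: frac_le)
        moreover have "norm (pinned_sum (coupling x \<beta>) \<beta> (W z m) (\<beta> m) (S - {m})) \<le> K m"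
          by (intro K(2) ballI WB[OF z(1)]) auto
        ultimately show "norm (zeta_quot (x k * x m) (z - \<beta> m) *
           pinned_sum (coupling x \<beta>) \<beta> (W z m) (\<beta> m) (S - {m})) \<le> q m / y * K m"
          unfolding norm_mult using y by (intro mult_mono) (auto simp: q_def)
      qed
      also have "\<dots> = A / y" unfolding A_def by (simp add: sum_divide_distrib)
      also have "\<dots> \<le> e"
        using y e by (simp add: field_simps)
      finally show ?thesis .
    qed
    then show ?thesis by blast
  qed
qed

text \<open>Induction on the set \<open>T\<close> of points still inside the strip. For
  \<open>k\<close> in \<open>T\<close>, the maximum principle on a rectangle of half-width
  \<open>k\<close> moves the point of \<open>k\<close> to the lines of real part \<open>k\<close> or
  \<open>-k\<close>, which removes \<open>k\<close> from \<open>T\<close>. Nothing is lost at such a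
  step, so one constant \<open>C\<close> serves throughout.\<close>

lemma word_sum_bounded_aux:
  fixes x :: "nat \<Rightarrow> real" and C :: real
  assumes S: "S \<subseteq> {1..n::nat}" and "T \<subseteq> S"
    and C: "C = (\<Sum>ks\<in>permutations_of_set S. exp ((\<Sum>i\<in>S. \<bar>x i\<bar>)\<^sup>2 * (2 * n) * (length ks)\<^sup>2 / 2))"
    and \<beta>: "inj_on \<beta> S" "\<forall>j\<in>T. \<bar>Re (\<beta> j)\<bar> < 1" "\<forall>j\<in>S-T. \<bar>Re (\<beta> j)\<bar> = real j"
  shows "norm (word_sum (coupling x \<beta>) \<beta> S) \<le> C"
proof -
  have fS: "finite S" using S finite_subset by blast
  then have "finite T" using \<open>T \<subseteq> S\<close> finite_subset by blast
  then show ?thesis using \<open>T \<subseteq> S\<close> \<beta>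
  proof (induction T arbitrary: \<beta>)
    case empty
    then show ?case unfolding C using fS S by (intro word_sum_bounded_far) auto
  next
    case (insert k T)
    define S' where "S' = S - {k}"
    have kS: "S = insert k S'" "k \<notin> S'" "finite S'" "1 \<le> k" using insert.prems fS S by (auto simp: S'_def)
    \<comment> \<open>Positivity lets the decay property be applied with \<open>C\<close> as the
      threshold value; the bound 1 itself covers a single letter, whose word sum is 1.\<close>
    have C0: "1 \<le> C"
    proof -
      obtain ks where "ks \<in> permutations_of_set S" using fS permutations_of_set_empty_iff[of S] by blast
      then have "exp ((\<Sum>i\<in>S. \<bar>x i\<bar>)\<^sup>2 * (2 * n) * (length ks)\<^sup>2 / 2) \<le> C"
        unfolding C using fS by (intro member_le_sum) auto
      moreover have "1 \<le> exp ((\<Sum>i\<in>S. \<bar>x i\<bar>)\<^sup>2 * (2 * n) * (length ks)\<^sup>2 / 2)" by simp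
      ultimately show ?thesis by linarith
    qed
    show ?case
    proof (cases "S' = {}")
      case True
      then show ?thesis using kS C0 by (simp add: word_sum_def)
    next
      case False
      have inj: "inj_on \<beta> S'" using insert.prems kS by (auto simp: inj_on_def)
      obtain f where f: "f holomorphic_on UNIV"
        "\<And>z. z \<notin> \<beta> ` S' \<Longrightarrow> f z = word_sum (coupling x (\<beta>(k := z))) (\<beta>(k := z)) S"
        "\<And>c e. 0 < e \<Longrightarrow> \<exists>Y. \<forall>z. \<bar>Re z\<bar> \<le> c \<longrightarrow> Y \<le> \<bar>Im z\<bar> \<longrightarrow> norm (f z) \<le> e"
        using word_sum_entire_extension[OF kS(3,2) False inj, of x] unfolding kS(1)[symmetric] by blast
      obtain Y where Y: "\<And>z. \<bar>Re z\<bar> \<le> real k \<Longrightarrow> Y \<le> \<bar>Im z\<bar> \<Longrightarrow> norm (f z) \<le> C"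
        using f(3)[of C "real k"] C0 by auto
      \<comment> \<open>High enough for the decay on the horizontal sides and for the rectangle to
        contain the point of \<open>k\<close>.\<close>
      define Y' where "Y' = \<bar>Y\<bar> + \<bar>Im (\<beta> k)\<bar>"
      define Q where "Q = cbox (Complex (- real k) (- Y')) (Complex (real k) Y')"
      have "norm (f (\<beta> k)) \<le> C"
      proof (rule maximum_modulus_frontier[of f Q])
        show "f holomorphic_on interior Q" "continuous_on (closure Q) f"
          using f(1) holomorphic_on_subset holomorphic_on_imp_continuous_on by blast+
        show "bounded Q" by (simp add: Q_def)
        have "\<bar>Re (\<beta> k)\<bar> < 1" using insert.prems by auto
        then show "\<beta> k \<in> Q" using kS(4) by (auto simp: Q_def in_cbox_complex_iff Y'_def)
        fix z assume "z \<in> frontier Q"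
        then have z: "z \<in> Q" "z \<notin> box (Complex (- real k) (- Y')) (Complex (real k) Y')"
          by (auto simp: Q_def frontier_cbox)
        then have "\<bar>Re z\<bar> \<le> k" by (auto simp: Q_def in_cbox_complex_iff)
        have "\<bar>Re z\<bar> = k \<or> \<bar>Im z\<bar> = Y'"
          using z by (auto simp: Q_def in_cbox_complex_iff in_box_complex_iff)
        then show "norm (f z) \<le> C"
        proof
          assume "\<bar>Im z\<bar> = Y'"
          then show ?thesis using Y \<open>\<bar>Re z\<bar> \<le> k\<close> by (auto simp: Y'_def)
        next
          assume zk: "\<bar>Re z\<bar> = k"
          \<comment> \<open>On the vertical sides no collision can happen: the other real parts have
            modulus \<open>j\<close> different from \<open>k\<close>, or less than 1 and hence less
            than \<open>k\<close>. So the induction hypothesis applies to the moved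
            configuration.\<close>
          have zn: "z \<noteq> \<beta> j" if "j \<in> S'" for j
          proof
            assume "z = \<beta> j"
            then have "\<bar>Re (\<beta> j)\<bar> = k" using zk by simp
            moreover have "j \<in> S" "j \<noteq> k" using that by (auto simp: S'_def)
            ultimately show False
              using insert.prems(3,4) kS(4) by (cases "j \<in> T") auto
          qed
          have "norm (word_sum (coupling x (\<beta>(k := z))) (\<beta>(k := z)) S) \<le> C"
          proof (rule insert.IH)
            show "inj_on (\<beta>(k := z)) S" using zn inj kS by (auto simp: inj_on_def)
          qed (use insert.hyps insert.prems zk in auto)
          moreover have "z \<notin> \<beta> ` S'" using zn by blast
          ultimately show ?thesis using f(2)[of z] by simp
        qed
      qed
      moreover have "f (\<beta> k) = word_sum (coupling x \<beta>) \<beta> S"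
        using insert.prems(2) kS f(2)[of "\<beta> k"] by (auto simp: inj_on_def)
      ultimately show ?thesis by simp
    qed
  qed
qed

lemma word_sum_bounded:
  fixes S :: "nat set" and x :: "nat \<Rightarrow> real"
  assumes "S \<subseteq> {1..n}"
  obtains C where "\<And>\<beta>. inj_on \<beta> S \<Longrightarrow> (\<And>j. j \<in> S \<Longrightarrow> \<bar>Re (\<beta> j)\<bar> < 1) \<Longrightarrow>
     norm (word_sum (coupling x \<beta>) \<beta> S) \<le> C"
  using word_sum_bounded_aux[OF assms order.refl refl] by blast

section \<open>Gaussian and Laplace integrals\<close>

text \<open>The parameter is the variance, so that convolution adds parameters.\<close>

definition heat :: "real \<Rightarrow> real \<Rightarrow> real" where
  "heat X v = normal_density 0 (sqrt X) v"

lemma heat_eq: "X > 0 \<Longrightarrow> heat X v = exp (- v\<^sup>2 / (2 * X)) / sqrt (2 * pi * X)"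
  by (simp add: heat_def normal_density_def)

lemma heat_nonneg [simp]: "0 \<le> heat X v"
  by (simp add: heat_def)

lemma heat_measurable [measurable]: "heat X \<in> borel_measurable borel"
  unfolding heat_def[abs_def] by measurable

lemma heat_minus [simp]: "heat X (- v) = heat X v"
  by (simp add: heat_def normal_density_def)

lemma integrable_heat: "X > 0 \<Longrightarrow> integrable lborel (heat X)"
  unfolding heat_def[abs_def] by simp

lemma heat_exp:
  assumes "X > 0"
  shows "heat X (t - u) * exp (c * t) = exp (c * u + c\<^sup>2 * X / 2) * normal_density (u + c * X) (sqrt X) t"
proof -
  have "- (t - u)\<^sup>2 / (2 * X) + c * t = (c * u + c\<^sup>2 * X / 2) + - (t - (u + c * X))\<^sup>2 / (2 * X)"
    using assms by (simp add: field_simps power2_eq_square)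
  then show ?thesis
    using assms by (simp add: heat_eq normal_density_def exp_add[symmetric])
qed

lemma integrable_heat_exp:
  assumes "X > 0"
  shows "integrable lborel (\<lambda>t. heat X (t - u) * exp (c * t))"
  unfolding heat_exp[OF assms] using assms by (intro integrable_mult_right integrable_normal_density) simp

lemma heat_le:
  assumes "X > 0" shows "heat X v \<le> 1 / sqrt (2 * pi * X)"
  using assms by (simp add: heat_eq divide_right_mono)

lemma gaussian_integrable: "X > 0 \<Longrightarrow> integrable lborel (\<lambda>a::real. exp (- a\<^sup>2 / (2 * X)))"
proof -
  assume X: "X > 0"
  have "integrable lborel (\<lambda>a. sqrt (2 * pi * X) * heat X a)"
    using integrable_heat[OF X] by simp
  then show ?thesis using X by (simp add: heat_eq)
qed

text \<open>Substituting \<open>a = sqrt X * y\<close> gives the characteristic function of the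
  standard normal at \<open>v / sqrt X\<close>. The constant \<open>2 * pi * X\<close> is
  \<open>sqrt (2 * pi * X)\<close> twice: once from the Gaussian integral, once to undo the
  normalisation of \<open>heat\<close>.\<close>

lemma gaussian_fourier:
  assumes X: "X > 0"
  shows "(CLBINT a. of_real (exp (- a\<^sup>2 / (2 * X))) * exp (of_real v * (\<i> * of_real a / of_real X + of_real r)))
     = of_real (2 * pi * X * heat X v * exp (r * v))"
proof -
  have "(CLBINT y. std_normal_density y *\<^sub>R iexp (v / sqrt X * y)) = exp (- ((v / sqrt X)\<^sup>2) / 2)"
  proof -
    have "(CLBINT y. std_normal_density y *\<^sub>R iexp (v / sqrt X * y)) = char std_normal_distribution (v / sqrt X)"
      unfolding char_def by (subst integral_density) auto
    then show ?thesis by (simp only: char_std_normal_distribution)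
  qed
  also have "\<dots> = of_real (exp (- v\<^sup>2 / (2 * X)))"
    using X by (simp add: power_divide field_simps)
  finally have s: "(CLBINT y. std_normal_density y *\<^sub>R iexp (v / sqrt X * y)) = of_real (exp (- v\<^sup>2 / (2 * X)))" .
  have "(CLBINT a. of_real (exp (- a\<^sup>2 / (2 * X))) * exp (of_real v * (\<i> * of_real a / of_real X + of_real r)))
    = \<bar>sqrt X\<bar> *\<^sub>R (CLBINT y. of_real (exp (- (0 + sqrt X * y)\<^sup>2 / (2 * X))) *
        exp (of_real v * (\<i> * of_real (0 + sqrt X * y) / of_real X + of_real r)))"
    using X by (intro lborel_integral_real_affine) auto
  also have "(\<lambda>y. of_real (exp (- (0 + sqrt X * y)\<^sup>2 / (2 * X))) *
        exp (of_real v * (\<i> * of_real (0 + sqrt X * y) / of_real X + of_real r)))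
     = (\<lambda>y. of_real (sqrt (2 * pi) * exp (r * v)) * (std_normal_density y *\<^sub>R iexp (v / sqrt X * y)))"
  proof
    fix y
    have "(0 + sqrt X * y)\<^sup>2 / (2 * X) = y\<^sup>2 / 2" using X by (simp add: power_mult_distrib)
    moreover have "complex_of_real v * (\<i> * of_real (0 + sqrt X * y) / of_real X + of_real r)
       = of_real (r * v) + \<i> * of_real (v / sqrt X * y)"
    proof -
      have "sqrt X / X = 1 / sqrt X" using X by (simp add: real_div_sqrt field_simps)
      then have "v * (sqrt X * y) / X = v / sqrt X * y" by (metis (no_types, lifting) mult.commute mult.left_neutral times_divide_eq_right times_divide_eq_left)
      moreover have "complex_of_real v * (\<i> * of_real (0 + sqrt X * y) / of_real X + of_real r)
        = of_real (r * v) + \<i> * of_real (v * (sqrt X * y) / X)"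
        by (simp add: algebra_simps)
      ultimately show ?thesis by simp
    qed
    ultimately show "of_real (exp (- (0 + sqrt X * y)\<^sup>2 / (2 * X))) *
        exp (of_real v * (\<i> * of_real (0 + sqrt X * y) / of_real X + of_real r))
      = of_real (sqrt (2 * pi) * exp (r * v)) * (std_normal_density y *\<^sub>R iexp (v / sqrt X * y))"
      by (simp only: exp_add minus_divide_left[symmetric]) (simp add: std_normal_density_def scaleR_conv_of_real exp_of_real[symmetric])
  qed
  also have "\<bar>sqrt X\<bar> *\<^sub>R (CLBINT y. of_real (sqrt (2 * pi) * exp (r * v)) * (std_normal_density y *\<^sub>R iexp (v / sqrt X * y)))
    = of_real (sqrt X * sqrt (2 * pi) * exp (r * v) * exp (- v\<^sup>2 / (2 * X)))"
    using X unfolding integral_mult_right_zero s by (simp add: scaleR_conv_of_real)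
  also have "sqrt X * sqrt (2 * pi) * exp (r * v) * exp (- v\<^sup>2 / (2 * X)) = 2 * pi * X * heat X v * exp (r * v)"
  proof -
    have "2 * pi * X / sqrt (2 * pi * X) = sqrt (2 * pi * X)"
      using X by (intro real_div_sqrt) simp
    also have "\<dots> = sqrt X * sqrt (2 * pi)" by (simp add: real_sqrt_mult)
    finally have "2 * pi * X / sqrt (2 * pi * X) = sqrt X * sqrt (2 * pi)" .
    then show ?thesis using X by (simp add: heat_eq field_simps)
  qed
  finally show ?thesis .
qed

lemma complex_exp_tail:
  fixes D :: complex
  assumes "Re D < 0"
  shows "integrable lborel (\<lambda>t. indicator {g<..} t *\<^sub>R exp (of_real t * D))"
    and "(CLBINT t. indicator {g<..} t *\<^sub>R exp (of_real t * D)) = - exp (of_real g * D) / D"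
proof -
  have D0: "D \<noteq> 0" using assms by auto
  have lim: "((\<lambda>t. exp (Re D * t)) \<longlongrightarrow> 0) at_top"
    using assms by (intro filterlim_compose[OF exp_at_bot] filterlim_tendsto_neg_mult_at_bot[OF tendsto_const]) (auto intro: filterlim_ident)
  have "set_integrable lborel (einterval (ereal g) \<infinity>) (\<lambda>t. exp (Re D * t))"
  proof (rule interval_integral_FTC_nonneg(1))
    show "((\<lambda>t. exp (Re D * t) / Re D) has_real_derivative exp (Re D * t)) (at t)" for t
      using assms by (auto intro!: derivative_eq_intros)
    show "(((\<lambda>t. exp (Re D * t) / Re D) \<circ> real_of_ereal) \<longlongrightarrow> exp (Re D * g) / Re D) (at_right (ereal g))"
      unfolding o_def by (subst ereal_tendsto_simps(2)[unfolded o_def]) (auto intro!: tendsto_eq_intros assms simp: assms less_imp_neq)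
    show "(((\<lambda>t. exp (Re D * t) / Re D) \<circ> real_of_ereal) \<longlongrightarrow> 0 / Re D) (at_left \<infinity>)"
      unfolding ereal_tendsto_simps using assms by (intro tendsto_divide lim) auto
  qed (auto)
  then have "integrable lborel (\<lambda>t. indicator {g<..} t *\<^sub>R exp (Re D * t))"
    by (simp add: set_integrable_def einterval_eq)
  then show int: "integrable lborel (\<lambda>t. indicator {g<..} t *\<^sub>R exp (of_real t * D))"
    by (rule Bochner_Integration.integrable_bound) (auto simp: indicator_def mult.commute)
  have "(LBINT t=ereal g..\<infinity>. exp (of_real t * D)) = 0 - exp (of_real g * D) / D"
  proof (rule interval_integral_FTC_integrable)
    show "((\<lambda>t. exp (of_real t * D) / D) has_vector_derivative exp (of_real t * D)) (at t)" for t
      using D0 by (auto intro!: derivative_eq_intros has_vector_derivative_real_field)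
    show "set_integrable lborel (einterval (ereal g) \<infinity>) (\<lambda>t. exp (of_real t * D))"
      using int by (simp add: set_integrable_def einterval_eq)
    show "(((\<lambda>t. exp (of_real t * D) / D) \<circ> real_of_ereal) \<longlongrightarrow> exp (of_real g * D) / D) (at_right (ereal g))"
      unfolding ereal_tendsto_simps by (auto intro!: tendsto_intros D0)
    have "((\<lambda>t. exp (of_real t * D) / D) \<longlongrightarrow> 0) at_top"
    proof (rule Lim_null_comparison)
      show "((\<lambda>t. exp (Re D * t) / norm D) \<longlongrightarrow> 0) at_top"
        using tendsto_divide[OF lim tendsto_const[of "norm D"]] D0 by simp
    qed (auto simp: norm_divide mult.commute)
    then show "(((\<lambda>t. exp (of_real t * D) / D) \<circ> real_of_ereal) \<longlongrightarrow> 0) (at_left \<infinity>)"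
      unfolding ereal_tendsto_simps .
  qed (auto intro!: continuous_intros)
  then show "(CLBINT t. indicator {g<..} t *\<^sub>R exp (of_real t * D)) = - exp (of_real g * D) / D"
    by (simp add: interval_lebesgue_integral_def set_lebesgue_integral_def einterval_eq)
qed

text \<open>For an ascent this is minus the indicator of \<open>t > g\<close>, for a descent the
  indicator of \<open>t\<close> \<le> \<open>g\<close>. With these signs both have the Laplace
  transform \<open>exp (g D) / D\<close> on their half-plane of convergence, and they differ by the
  constant 1.\<close>

definition kappa :: "bool \<Rightarrow> real \<Rightarrow> real \<Rightarrow> real" where
  "kappa asc g t = (if asc then 0 else 1) - indicator {g<..} t"

lemma kappa_measurable [measurable]: "kappa asc g \<in> borel_measurable borel"
  unfolding kappa_def[abs_def] by measurable

lemma abs_kappa_le: "\<bar>kappa asc g t\<bar> \<le> 1"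
  by (auto simp: kappa_def indicator_def)

lemma kappa_laplace:
  fixes D :: complex
  assumes "Re D \<noteq> 0"
  shows "integrable lborel (\<lambda>t. kappa (Re D < 0) g t *\<^sub>R exp (of_real t * D))"
    and "(CLBINT t. kappa (Re D < 0) g t *\<^sub>R exp (of_real t * D)) = exp (of_real g * D) / D"
proof -
  have "integrable lborel (\<lambda>t. kappa (Re D < 0) g t *\<^sub>R exp (of_real t * D)) \<and>
    (CLBINT t. kappa (Re D < 0) g t *\<^sub>R exp (of_real t * D)) = exp (of_real g * D) / D"
  proof (cases "Re D < 0")
    case True
    then show ?thesis using complex_exp_tail[OF True, of g] by (simp add: kappa_def)
  next
    case False
    then have D: "Re (- D) < 0" using assms by simp
    \<comment> \<open>Reflecting \<open>t\<close> reduces the descent to a tail integral for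
      \<open>- D\<close>; the closed and open half-lines differ only at \<open>g\<close>.\<close>
    have *: "AE t in lborel. kappa (Re D < 0) g t *\<^sub>R exp (of_real t * D)
        = indicator {- g<..} (0 + (-1) * t) *\<^sub>R exp (of_real (0 + (-1) * t) * (- D))"
      using AE_lborel_singleton[of g] by eventually_elim (use False in \<open>auto simp: kappa_def indicator_def\<close>)
    have "integrable lborel (\<lambda>t. indicator {- g<..} (0 + (-1) * t) *\<^sub>R exp (of_real (0 + (-1) * t) * (- D)))"
      using complex_exp_tail(1)[OF D, of "- g"]
      by (subst lborel_integrable_real_affine_iff[where f = "\<lambda>t. indicator {- g<..} t *\<^sub>R exp (of_real t * (- D))"]) auto
    moreover have "(CLBINT t. indicator {- g<..} (0 + (-1) * t) *\<^sub>R exp (of_real (0 + (-1) * t) * (- D))) = exp (of_real g * D) / D"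
      using complex_exp_tail(2)[OF D, of "- g"]
        lborel_integral_real_affine[of "-1" "\<lambda>t. indicator {- g<..} t *\<^sub>R exp (of_real t * (- D))" 0] by simp
    ultimately show ?thesis
      using integral_cong_AE[OF _ _ *] integrable_cong_AE[OF _ _ *] by (simp add: measurable_If)
  qed
  then show "integrable lborel (\<lambda>t. kappa (Re D < 0) g t *\<^sub>R exp (of_real t * D))"
    "(CLBINT t. kappa (Re D < 0) g t *\<^sub>R exp (of_real t * D)) = exp (of_real g * D) / D" by auto
qed

lemma (in pair_sigma_finite) integrable_tensor_bound:
  fixes f :: "'a \<times> 'b \<Rightarrow> 'c::{banach, second_countable_topology}" and p :: "'a \<Rightarrow> real" and q :: "'b \<Rightarrow> real"
  assumes f: "f \<in> borel_measurable (M1 \<Otimes>\<^sub>M M2)" and p: "integrable M1 p" and q: "integrable M2 q"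
    and le: "\<And>x y. x \<in> space M1 \<Longrightarrow> y \<in> space M2 \<Longrightarrow> norm (f (x, y)) \<le> p x * q y"
  shows "integrable (M1 \<Otimes>\<^sub>M M2) f"
proof (rule Bochner_Integration.integrable_bound[OF _ f])
  have [measurable]: "p \<in> borel_measurable M1" "q \<in> borel_measurable M2" using p q by auto
  show "integrable (M1 \<Otimes>\<^sub>M M2) (\<lambda>(x, y). p x * q y)"
  proof (rule Fubini_integrable)
    have "(\<lambda>x. \<integral>y. norm (case (x, y) of (x, y) \<Rightarrow> p x * q y) \<partial>M2) = (\<lambda>x. \<bar>p x\<bar> * (\<integral>y. \<bar>q y\<bar> \<partial>M2))"
      by (simp add: abs_mult)
    then show "integrable M1 (\<lambda>x. \<integral>y. norm (case (x, y) of (x, y) \<Rightarrow> p x * q y) \<partial>M2)"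
      using p by simp
  qed (use q in auto)
  show "AE xy in M1 \<Otimes>\<^sub>M M2. norm (f xy) \<le> norm (case xy of (x, y) \<Rightarrow> p x * q y)"
    using le by (intro AE_I2) (fastforce simp: space_pair_measure intro: order.trans[OF _ abs_ge_self])
qed

section \<open>Gaussian integrals of chains\<close>

fun chain :: "('a \<Rightarrow> complex) \<Rightarrow> (real \<Rightarrow> real) \<Rightarrow> ('a \<Rightarrow> real) \<Rightarrow> real \<Rightarrow> 'a \<Rightarrow> 'a list \<Rightarrow> complex" where
  "chain \<beta> G X S j [] = 1"
| "chain \<beta> G X S j (k # ks) =
     exp (of_real (G (S + X j)) * (\<beta> j - \<beta> k)) / (\<beta> j - \<beta> k) * chain \<beta> G X (S + X j) k ks"

text \<open>A path from \<open>u\<close> to 0 with step densities \<open>h\<close>, weighted by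
  \<open>kappa\<close> at each intermediate position. The endpoint 0 in the base case reflects that
  the last point of a chain occurs only in the link before it.\<close>

fun bridge :: "('a \<Rightarrow> real \<Rightarrow> real) \<Rightarrow> ('a \<Rightarrow> 'a \<Rightarrow> bool) \<Rightarrow> (real \<Rightarrow> real) \<Rightarrow> ('a \<Rightarrow> real) \<Rightarrow>
    real \<Rightarrow> 'a \<Rightarrow> 'a list \<Rightarrow> real \<Rightarrow> real" where
  "bridge h asc G X S j [] u = h j (- u)"
| "bridge h asc G X S j (k # ks) u =
     (\<integral>t. kappa (asc j k) (G (S + X j)) t * h j (t - u) * bridge h asc G X (S + X j) k ks t \<partial>lborel)"

definition node :: "('a \<Rightarrow> real) \<Rightarrow> ('a \<Rightarrow> real) \<Rightarrow> ('a \<Rightarrow> real) \<Rightarrow> 'a \<Rightarrow> complex" where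
  "node X r f i = \<i> * of_real (f i) / of_real (X i) + of_real (r i)"

definition gauss_prod :: "('a \<Rightarrow> real) \<Rightarrow> 'a set \<Rightarrow> ('a \<Rightarrow> real) \<Rightarrow> complex" where
  "gauss_prod X I f = (\<Prod>i\<in>I. complex_of_real (exp (- (f i)\<^sup>2 / (2 * X i))))"

abbreviation lborel_PiM :: "'a set \<Rightarrow> ('a \<Rightarrow> real) measure" where
  "lborel_PiM I \<equiv> PiM I (\<lambda>_. lborel)"

abbreviation tilted :: "('a \<Rightarrow> real) \<Rightarrow> ('a \<Rightarrow> real) \<Rightarrow> 'a \<Rightarrow> real \<Rightarrow> real" where
  "tilted X r \<equiv> \<lambda>i v. 2 * pi * X i * heat (X i) v * exp (r i * v)"

lemma Re_node [simp]: "Re (node X r f i) = r i"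
  by (simp add: node_def)

lemma node_measurable [measurable]: "i \<in> I \<Longrightarrow> (\<lambda>f. node X r f i) \<in> borel_measurable (lborel_PiM I)"
  unfolding node_def by measurable

lemma chain_measurable:
  "set (j # ks) \<subseteq> I \<Longrightarrow> (\<lambda>f. chain (node X r f) G Y S j ks) \<in> borel_measurable (lborel_PiM I)"
proof (induction ks arbitrary: j S)
  case (Cons k ks)
  have [measurable]: "(\<lambda>f. chain (node X r f) G Y (S + Y j) k ks) \<in> borel_measurable (lborel_PiM I)"
    using Cons by auto
  have "j \<in> I" "k \<in> I" using Cons.prems by auto
  then show ?case by simp
qed simp

lemma chain_cong:
  "(\<And>i. i \<in> set (j # ks) \<Longrightarrow> \<beta> i = \<beta>' i) \<Longrightarrow> chain \<beta> G X S j ks = chain \<beta>' G X S j ks"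
  by (induction ks arbitrary: j S) auto

text \<open>The real parts of the links are the differences of \<open>r\<close>, independent of
  \<open>f\<close>. They keep the denominators away from 0 and fix the modulus of the
  exponentials.\<close>

lemma chain_bounded:
  assumes "distinct (j # ks)" "inj_on r (set (j # ks))"
  shows "\<exists>B\<ge>0. \<forall>f. norm (chain (node X r f) G Y S j ks) \<le> B"
  using assms
proof (induction ks arbitrary: j S)
  case Nil
  show ?case by (intro exI[of _ 1]) auto
next
  case (Cons k ks)
  then obtain B where B: "B \<ge> 0" "\<And>f. norm (chain (node X r f) G Y (S + Y j) k ks) \<le> B"
    by (metis distinct_length_2_or_more inj_on_subset set_subset_Cons distinct.simps(2))
  have ne: "r j \<noteq> r k" using Cons.prems by (auto simp: inj_on_def)
  let ?c = "exp (G (S + Y j) * (r j - r k)) / \<bar>r j - r k\<bar>"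
  have "norm (chain (node X r f) G Y S j (k # ks)) \<le> ?c * B" for f
  proof -
    let ?D = "node X r f j - node X r f k"
    have "\<bar>r j - r k\<bar> \<le> norm ?D" using abs_Re_le_cmod[of ?D] by simp
    then have "norm (exp (of_real (G (S + Y j)) * ?D) / ?D) \<le> ?c"
      using ne by (auto simp: norm_divide intro!: divide_left_mono mult_pos_pos)
    then show ?thesis unfolding chain.simps norm_mult using B by (intro mult_mono) auto
  qed
  then show ?case using B by (intro exI[of _ "?c * B"]) auto
qed

interpretation lebesgue_product: product_sigma_finite "\<lambda>_ :: 'a. lborel :: real measure"
  by standard

lemma gauss_prod_integrable:
  assumes "finite I" "\<And>i. i \<in> I \<Longrightarrow> X i > 0"
  shows "integrable (lborel_PiM I) (gauss_prod X I)"
  unfolding gauss_prod_def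
  using assms by (intro lebesgue_product.product_integrable_prod integrable_of_real gaussian_integrable) auto

lemma chain_integrable:
  assumes "distinct (j # ks)" "inj_on r (set (j # ks))" "\<And>i. i \<in> set (j # ks) \<Longrightarrow> X i > 0"
  shows "integrable (lborel_PiM (set (j # ks)))
    (\<lambda>f. gauss_prod X (set (j # ks)) f * exp (- of_real u * node X r f j) * chain (node X r f) G Y S j ks)"
proof -
  obtain B where B: "B \<ge> 0" "\<And>f. norm (chain (node X r f) G Y S j ks) \<le> B"
    using chain_bounded[OF assms(1,2)] by blast
  have int: "integrable (lborel_PiM (set (j # ks))) (gauss_prod X (set (j # ks)))"
    using assms(3) by (intro gauss_prod_integrable) auto
  note [measurable] = chain_measurable[OF order.refl, of X r G Y S j ks] borel_measurable_integrable[OF int]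
  show ?thesis
  proof (rule Bochner_Integration.integrable_bound)
    show "integrable (lborel_PiM (set (j # ks))) (\<lambda>f. of_real (exp (- u * r j) * B) * gauss_prod X (set (j # ks)) f)"
      using int by simp
    show "AE f in lborel_PiM (set (j # ks)). norm (gauss_prod X (set (j # ks)) f * exp (- of_real u * node X r f j) * chain (node X r f) G Y S j ks)
        \<le> norm (of_real (exp (- u * r j) * B) * gauss_prod X (set (j # ks)) f)"
    proof (intro AE_I2)
      fix f
      have "norm (gauss_prod X (set (j # ks)) f) * exp (- u * r j) * norm (chain (node X r f) G Y S j ks)
         \<le> norm (gauss_prod X (set (j # ks)) f) * exp (- u * r j) * B"
        by (intro mult_left_mono B) auto
      then show "norm (gauss_prod X (set (j # ks)) f * exp (- of_real u * node X r f j) * chain (node X r f) G Y S j ks)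
        \<le> norm (of_real (exp (- u * r j) * B) * gauss_prod X (set (j # ks)) f)"
        using B(1) by (simp add: norm_mult mult_ac)
    qed
  qed measurable
qed

lemma kappa_heat_integrable:
  assumes "X > 0"
  shows "integrable lborel (\<lambda>t. kappa b g t * (heat X (t - u) * exp (c * t)))"
  using integrable_heat_exp[OF assms, of u c]
proof (rule Bochner_Integration.integrable_bound)
  show "AE t in lborel. norm (kappa b g t * (heat X (t - u) * exp (c * t))) \<le> norm (heat X (t - u) * exp (c * t))"
    using abs_kappa_le by (intro AE_I2) (auto simp: abs_mult intro!: mult_left_le_one_le)
qed measurable

text \<open>Each factor \<open>exp (g D) / D\<close> is a Laplace integral over a half-line, after which the variables
  of the Gaussian decouple and can be integrated out one at a time.\<close>
lemma chain_integral:
  assumes "distinct (j # ks)" "inj_on r (set (j # ks))" "\<And>i. i \<in> set (j # ks) \<Longrightarrow> X i > 0"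
  shows "(\<integral>f. gauss_prod X (set (j # ks)) f * exp (- of_real u * node X r f j) * chain (node X r f) G Y S j ks
       \<partial>lborel_PiM (set (j # ks)))
     = of_real (bridge (tilted X r) (\<lambda>i k. r i < r k) G Y S j ks u)"
  using assms
proof (induction ks arbitrary: j S u)
  case Nil
  have "(\<integral>f. gauss_prod X {j} f * exp (- of_real u * node X r f j) \<partial>lborel_PiM {j})
     = (\<integral>f. (\<lambda>a. of_real (exp (- a\<^sup>2 / (2 * X j))) * exp (of_real (- u) * (\<i> * of_real a / of_real (X j) + of_real (r j)))) (f j)
          \<partial>lborel_PiM {j})"
    by (simp add: gauss_prod_def node_def)
  also have "\<dots> = (CLBINT a. of_real (exp (- a\<^sup>2 / (2 * X j))) * exp (of_real (- u) * (\<i> * of_real a / of_real (X j) + of_real (r j))))"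
    by (rule lebesgue_product.product_integral_singleton) measurable
  also have "\<dots> = of_real (2 * pi * X j * heat (X j) (- u) * exp (r j * (- u)))"
    using Nil by (intro gaussian_fourier) auto
  finally show ?case by simp
next
  case (Cons k ks)
  define I where "I = set (k # ks)"
  have I: "finite I" "j \<notin> I" "set (j # k # ks) = insert j I" "k \<in> I" using Cons.prems by (auto simp: I_def)
  have XI: "X i > 0" if "i \<in> I" for i using Cons.prems that by (auto simp: I_def)
  have Xj: "X j > 0" using Cons.prems by auto
  have rI: "distinct (k # ks)" "inj_on r (set (k # ks))" using Cons.prems by (auto simp: inj_on_def)
  have rjk: "r j \<noteq> r k" using Cons.prems by (auto simp: inj_on_def)
  let ?M = "lborel_PiM I"
  define g where "g = G (S + Y j)"
  define h where "h = (tilted X r)"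
  define \<kappa> where "\<kappa> = kappa (r j < r k) g"
  define P where "P = (\<lambda>y. gauss_prod X I y * chain (node X r y) G Y (S + Y j) k ks)"
  define E where "E = (\<lambda>a. complex_of_real (exp (- a\<^sup>2 / (2 * X j))))"
  define nj where "nj = (\<lambda>a. \<i> * of_real a / of_real (X j) + complex_of_real (r j))"
  have [measurable]: "nj \<in> borel_measurable borel" "E \<in> borel_measurable borel" "\<kappa> \<in> borel_measurable borel"
    unfolding nj_def E_def \<kappa>_def by measurable
  have int_gauss: "integrable ?M (gauss_prod X I)" using I XI by (intro gauss_prod_integrable) auto
  have [measurable]: "P \<in> borel_measurable ?M" unfolding P_def
    using chain_measurable[of k ks I X r G Y] int_gauss by (auto simp: I_def)
  have Pint: "integrable ?M P"
    using chain_integrable[OF rI, of X 0 G Y "S + Y j"] XI by (simp add: P_def I_def)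
  have hm [measurable]: "h j \<in> borel_measurable borel" unfolding h_def by measurable
  have IH: "(\<integral>y. P y * exp (- of_real t * node X r y k) \<partial>?M) = of_real (bridge h (\<lambda>i k. r i < r k) G Y (S + Y j) k ks t)" for t
    using Cons.IH[OF rI, of t "S + Y j"] XI by (simp add: P_def I_def h_def mult_ac)
  \<comment> \<open>One link integrated over its own variable: the Laplace integral separates
    \<open>nj a\<close> from \<open>z\<close>, and the Gaussian turns
    \<open>exp ((t - u) * nj a)\<close> into a kernel. What is left of the neighbour is
    \<open>exp (- t * z)\<close>, exactly the extra factor in the statement, so the induction
    hypothesis applies with \<open>t\<close> in place of \<open>u\<close>.\<close>
  have inner: "(\<integral>a. E a * exp (- of_real u * nj a) * (exp (of_real g * (nj a - z)) / (nj a - z)) \<partial>lborel)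
      = (\<integral>t. of_real (\<kappa> t * h j (t - u)) * exp (- of_real t * z) \<partial>lborel)" if z: "Re z = r k" for z
  proof -
    define F where "F = (\<lambda>a t. E a * exp (- of_real u * nj a) * (\<kappa> t *\<^sub>R exp (of_real t * (nj a - z))))"
    have "(\<integral>a. E a * exp (- of_real u * nj a) * (exp (of_real g * (nj a - z)) / (nj a - z)) \<partial>lborel)
       = (\<integral>a. \<integral>t. F a t \<partial>lborel \<partial>lborel)"
    proof (intro Bochner_Integration.integral_cong refl)
      fix a
      have "Re (nj a - z) = r j - r k" using z by (simp add: nj_def)
      then have "exp (of_real g * (nj a - z)) / (nj a - z) = (\<integral>t. \<kappa> t *\<^sub>R exp (of_real t * (nj a - z)) \<partial>lborel)"
        using kappa_laplace(2)[of "nj a - z" g] rjk by (simp add: \<kappa>_def)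
      then show "E a * exp (- of_real u * nj a) * (exp (of_real g * (nj a - z)) / (nj a - z)) = (\<integral>t. F a t \<partial>lborel)"
        by (simp only: F_def integral_mult_right_zero)
    qed
    also have "\<dots> = (\<integral>t. \<integral>a. F a t \<partial>lborel \<partial>lborel)"
    proof (rule lborel_pair.Fubini_integral[symmetric], rule lborel_pair.integrable_tensor_bound)
      show "(\<lambda>(a, t). F a t) \<in> borel_measurable (lborel \<Otimes>\<^sub>M lborel)" unfolding F_def by measurable
      show "integrable lborel (\<lambda>a. exp (- a\<^sup>2 / (2 * X j)) * exp (- u * r j))"
        using gaussian_integrable[OF Xj] by simp
      have "integrable lborel (\<lambda>t. norm (kappa (Re (of_real (r j - r k)) < 0) g t *\<^sub>R exp (of_real t * complex_of_real (r j - r k))))"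
        using rjk by (intro integrable_norm kappa_laplace(1)) auto
      then show "integrable lborel (\<lambda>t. \<bar>\<kappa> t\<bar> * exp (t * (r j - r k)))"
        by (simp add: \<kappa>_def)
      show "norm (case (a, t) of (a, t) \<Rightarrow> F a t) \<le> exp (- a\<^sup>2 / (2 * X j)) * exp (- u * r j) * (\<bar>\<kappa> t\<bar> * exp (t * (r j - r k)))" for a t
        using z by (simp add: F_def E_def norm_mult nj_def)
    qed
    also have "\<dots> = (\<integral>t. of_real (\<kappa> t * h j (t - u)) * exp (- of_real t * z) \<partial>lborel)"
    proof (intro Bochner_Integration.integral_cong refl)
      fix t
      have "F a t = of_real (\<kappa> t) * exp (- of_real t * z) * (E a * exp (of_real (t - u) * nj a))" for a
        unfolding F_def scaleR_conv_of_real by (simp add: exp_add[symmetric] algebra_simps)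
      then have "(\<integral>a. F a t \<partial>lborel) = of_real (\<kappa> t) * exp (- of_real t * z) * (\<integral>a. E a * exp (of_real (t - u) * nj a) \<partial>lborel)"
        by simp
      also have "(\<integral>a. E a * exp (of_real (t - u) * nj a) \<partial>lborel) = of_real (h j (t - u))"
        unfolding E_def nj_def h_def by (rule gaussian_fourier[OF Xj])
      finally show "(\<integral>a. F a t \<partial>lborel) = of_real (\<kappa> t * h j (t - u)) * exp (- of_real t * z)" by simp
    qed
    finally show ?thesis .
  qed
  let ?F = "\<lambda>f. gauss_prod X (insert j I) f * exp (- of_real u * node X r f j) * chain (node X r f) G Y S j (k # ks)"
  have "(\<integral>f. ?F f \<partial>lborel_PiM (insert j I)) = (\<integral>y. \<integral>a. ?F (y(j := a)) \<partial>lborel \<partial>?M)"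
    using chain_integrable[OF Cons.prems(1,2), of X u G Y S] Cons.prems(3) I
    by (intro lebesgue_product.product_integral_insert) auto
  also have "\<dots> = (\<integral>y. \<integral>t. P y * (of_real (\<kappa> t * h j (t - u)) * exp (- of_real t * node X r y k)) \<partial>lborel \<partial>?M)"
  proof (rule Bochner_Integration.integral_cong[OF refl])
    fix y
    have "?F (y(j := a)) = P y * (E a * exp (- of_real u * nj a) * (exp (of_real g * (nj a - node X r y k)) / (nj a - node X r y k)))" for a
    proof -
      have "gauss_prod X (insert j I) (y(j := a)) = E a * gauss_prod X I y"
        unfolding gauss_prod_def E_def using I by (simp, intro prod.cong) auto
      moreover have "node X r (y(j := a)) j = nj a" by (simp add: node_def nj_def)
      moreover have "node X r (y(j := a)) i = node X r y i" if "i \<in> I" for i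
        using that I by (auto simp: node_def)
      moreover from this have "chain (node X r (y(j := a))) G Y (S + Y j) k ks = chain (node X r y) G Y (S + Y j) k ks"
        by (intro chain_cong) (auto simp: I_def)
      ultimately show ?thesis using I by (simp add: P_def g_def)
    qed
    then have "(\<integral>a. ?F (y(j := a)) \<partial>lborel) = P y * (\<integral>a. E a * exp (- of_real u * nj a) * (exp (of_real g * (nj a - node X r y k)) / (nj a - node X r y k)) \<partial>lborel)"
      by (simp only: integral_mult_right_zero)
    then show "(\<integral>a. ?F (y(j := a)) \<partial>lborel) = (\<integral>t. P y * (of_real (\<kappa> t * h j (t - u)) * exp (- of_real t * node X r y k)) \<partial>lborel)"
      by (simp only: inner[OF Re_node[of X r y k]] integral_mult_right_zero)
  qed
  also have "\<dots> = (\<integral>t. \<integral>y. P y * (of_real (\<kappa> t * h j (t - u)) * exp (- of_real t * node X r y k)) \<partial>?M \<partial>lborel)"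
  proof -
    interpret fp: finite_product_sigma_finite "\<lambda>_. lborel :: real measure" I by standard fact
    interpret pq: pair_sigma_finite ?M lborel by standard
    show ?thesis
    proof (rule pq.Fubini_integral[symmetric], rule pq.integrable_tensor_bound)
      have [measurable]: "(\<lambda>y. node X r y k) \<in> borel_measurable ?M" using I(4) by measurable
      show "(\<lambda>(y, t). P y * (of_real (\<kappa> t * h j (t - u)) * exp (- of_real t * node X r y k))) \<in> borel_measurable (?M \<Otimes>\<^sub>M lborel)"
        by measurable
      show "integrable ?M (\<lambda>y. norm (P y))" using Pint by simp
      have "(\<lambda>t. \<bar>\<kappa> t * h j (t - u)\<bar> * exp (- t * r k)) = (\<lambda>t. 2 * pi * X j * exp (- r j * u) *
           \<bar>kappa (r j < r k) g t * (heat (X j) (t - u) * exp ((r j - r k) * t))\<bar>)"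
        using Xj by (auto simp: fun_eq_iff h_def \<kappa>_def abs_mult exp_add[symmetric] exp_diff exp_minus field_simps)
      then show "integrable lborel (\<lambda>t. \<bar>\<kappa> t * h j (t - u)\<bar> * exp (- t * r k))"
        using kappa_heat_integrable[OF Xj] by simp
      show "norm (case (y, t) of (y, t) \<Rightarrow> P y * (of_real (\<kappa> t * h j (t - u)) * exp (- of_real t * node X r y k)))
         \<le> norm (P y) * (\<bar>\<kappa> t * h j (t - u)\<bar> * exp (- t * r k))" for y t
        by (simp add: norm_mult abs_mult)
    qed
  qed
  also have "\<dots> = (\<integral>t. of_real (\<kappa> t * h j (t - u) * bridge h (\<lambda>i k. r i < r k) G Y (S + Y j) k ks t) \<partial>lborel)"
  proof (intro Bochner_Integration.integral_cong refl)
    fix t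
    have "(\<integral>y. P y * (of_real (\<kappa> t * h j (t - u)) * exp (- of_real t * node X r y k)) \<partial>?M)
      = (\<integral>y. of_real (\<kappa> t * h j (t - u)) * (P y * exp (- of_real t * node X r y k)) \<partial>?M)"
      by (simp only: mult_ac)
    then show "(\<integral>y. P y * (of_real (\<kappa> t * h j (t - u)) * exp (- of_real t * node X r y k)) \<partial>?M)
       = of_real (\<kappa> t * h j (t - u) * bridge h (\<lambda>i k. r i < r k) G Y (S + Y j) k ks t)"
      by (simp only: integral_mult_right_zero IH of_real_mult)
  qed
  also have "\<dots> = of_real (bridge h (\<lambda>i k. r i < r k) G Y S j (k # ks) u)"
    unfolding integral_complex_of_real by (simp add: \<kappa>_def g_def)
  finally show ?case unfolding I(3) h_def .
qed

section \<open>Bounds, limits and composition of bridges\<close>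

lemma bridge_measurable [measurable]:
  assumes "\<And>i. h i \<in> borel_measurable borel"
  shows "bridge h asc G X S j ks \<in> borel_measurable borel"
proof (induction ks arbitrary: j S)
  case Nil
  note [measurable] = assms
  have "bridge h asc G X S j [] = (\<lambda>u. h j (- u))" by (simp add: fun_eq_iff)
  then show ?case by simp
next
  case (Cons k ks)
  note [measurable] = assms Cons
  have "bridge h asc G X S j (k # ks) =
     (\<lambda>u. \<integral>t. kappa (asc j k) (G (S + X j)) t * h j (t - u) * bridge h asc G X (S + X j) k ks t \<partial>lborel)"
    by (simp add: fun_eq_iff)
  then show ?case by simp
qed

lemma bridge_map:
  "bridge h asc G X S (f j) (map f ks) u =
     bridge (\<lambda>i. h (f i)) (\<lambda>i k. asc (f i) (f k)) G (\<lambda>i. X (f i)) S j ks u"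
  by (induction ks arbitrary: j S u) auto

lemma shifted_integral:
  fixes H :: "real \<Rightarrow> real"
  assumes "integrable lborel H"
  shows "integrable lborel (\<lambda>t. H (t - u))" "(\<integral>t. H (t - u) \<partial>lborel) = (\<integral>t. H t \<partial>lborel)"
  using lborel_integrable_real_affine[OF assms, of 1 "- u"] lborel_integral_real_affine[of 1 H "- u"] by auto

lemma kernel_integrable:
  fixes w :: "real \<Rightarrow> real"
  assumes [measurable]: "h \<in> borel_measurable borel" "w \<in> borel_measurable borel"
    and H: "integrable lborel H" "\<And>v. \<bar>h v\<bar> \<le> H v" and w: "\<And>t. \<bar>w t\<bar> \<le> B"
  shows "integrable lborel (\<lambda>t. kappa b g t * h (t - u) * w t)"
    and "\<bar>\<integral>t. kappa b g t * h (t - u) * w t \<partial>lborel\<bar> \<le> B * (\<integral>t. H t \<partial>lborel)"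
    and "\<bar>kappa b g t * h (t - u) * w t\<bar> \<le> B * H (t - u)"
proof -
  have le: "\<bar>kappa b g t * h (t - u) * w t\<bar> \<le> B * H (t - u)" for t
  proof -
    have "\<bar>kappa b g t\<bar> * \<bar>h (t - u)\<bar> * \<bar>w t\<bar> \<le> 1 * H (t - u) * B"
      using H(2)[of "t - u"] w[of t] abs_kappa_le[of b g t]
      by (intro mult_mono) (auto intro: order.trans[OF abs_ge_zero])
    then show ?thesis by (simp add: abs_mult mult.commute)
  qed
  then show "\<bar>kappa b g t * h (t - u) * w t\<bar> \<le> B * H (t - u)" .
  have int: "integrable lborel (\<lambda>t. B * H (t - u))"
    using shifted_integral[OF H(1)] by simp
  then show *: "integrable lborel (\<lambda>t. kappa b g t * h (t - u) * w t)"
    proof (rule Bochner_Integration.integrable_bound)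
    show "AE t in lborel. norm (kappa b g t * h (t - u) * w t) \<le> norm (B * H (t - u))"
      using order.trans[OF le abs_ge_self] by (intro AE_I2) simp
  qed measurable
  have "norm (\<integral>t. kappa b g t * h (t - u) * w t \<partial>lborel) \<le> (\<integral>t. B * H (t - u) \<partial>lborel)"
    by (rule Bochner_Integration.integral_norm_bound_integral[OF * int]) (simp add: le)
  then show "\<bar>\<integral>t. kappa b g t * h (t - u) * w t \<partial>lborel\<bar> \<le> B * (\<integral>t. H t \<partial>lborel)"
    using shifted_integral(2)[OF H(1)] by simp
qed

text \<open>The bound depends on the envelopes \<open>H\<close> only, so it serves a whole sequence
  of kernels and yields the majorant in \<open>bridge_tendsto\<close>.\<close>

lemma bridge_bounded:
  assumes "\<And>i. i \<in> set (j # ks) \<Longrightarrow> integrable lborel (H i)" "\<And>i v. i \<in> set (j # ks) \<Longrightarrow> H i v \<le> C i"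
  shows "\<exists>B. \<forall>h u. (\<forall>i. h i \<in> borel_measurable borel) \<longrightarrow> (\<forall>i\<in>set (j # ks). \<forall>v. \<bar>h i v\<bar> \<le> H i v) \<longrightarrow>
    \<bar>bridge h asc G X S j ks u\<bar> \<le> B"
  using assms
proof (induction ks arbitrary: j S)
  case Nil
  then show ?case by (intro exI[of _ "C j"]) (auto intro: order.trans)
next
  case (Cons k ks)
  have "\<exists>B. \<forall>h u. (\<forall>i. h i \<in> borel_measurable borel) \<longrightarrow> (\<forall>i\<in>set (k # ks). \<forall>v. \<bar>h i v\<bar> \<le> H i v) \<longrightarrow>
    \<bar>bridge h asc G X (S + X j) k ks u\<bar> \<le> B"
    using Cons.prems by (intro Cons.IH) auto
  then obtain B where B: "\<And>h u. (\<forall>i. h i \<in> borel_measurable borel) \<Longrightarrow> (\<forall>i\<in>set (k # ks). \<forall>v. \<bar>h i v\<bar> \<le> H i v) \<Longrightarrow>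
    \<bar>bridge h asc G X (S + X j) k ks u\<bar> \<le> B" by blast
  show ?case
  proof (intro exI[of _ "B * (\<integral>t. H j t \<partial>lborel)"] allI impI)
    fix h u assume h: "\<forall>i. h i \<in> borel_measurable borel" "\<forall>i\<in>set (j # k # ks). \<forall>v. \<bar>h i v\<bar> \<le> H i v"
    show "\<bar>bridge h asc G X S j (k # ks) u\<bar> \<le> B * (\<integral>t. H j t \<partial>lborel)"
      using h Cons.prems(1)[of j] B[of h] unfolding bridge.simps
      by (intro kernel_integrable(2) bridge_measurable) auto
  qed
qed

lemma bridge_tendsto:
  assumes h: "\<And>n i. h n i \<in> borel_measurable borel" "\<And>i. h' i \<in> borel_measurable borel"
    and H: "\<And>i. i \<in> set (j # ks) \<Longrightarrow> integrable lborel (H i)" "\<And>i v. i \<in> set (j # ks) \<Longrightarrow> H i v \<le> C i"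
    and le: "\<And>n i v. i \<in> set (j # ks) \<Longrightarrow> \<bar>h n i v\<bar> \<le> H i v"
    and lim: "\<And>i v. i \<in> set (j # ks) \<Longrightarrow> (\<lambda>n. h n i v) \<longlonglongrightarrow> h' i v"
  shows "(\<lambda>n. bridge (h n) asc G X S j ks u) \<longlonglongrightarrow> bridge h' asc G X S j ks u"
  using H le lim
proof (induction ks arbitrary: j S u)
  case Nil
  then show ?case by simp
next
  case (Cons k ks)
  obtain B where B: "\<And>h u. (\<forall>i. h i \<in> borel_measurable borel) \<Longrightarrow> (\<forall>i\<in>set (k # ks). \<forall>v. \<bar>h i v\<bar> \<le> H i v) \<Longrightarrow>
    \<bar>bridge h asc G X (S + X j) k ks u\<bar> \<le> B"
    using bridge_bounded[of k ks H C asc G X "S + X j"] Cons.prems by (metis list.set_intros(2))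
  have IH: "(\<lambda>n. bridge (h n) asc G X (S + X j) k ks t) \<longlonglongrightarrow> bridge h' asc G X (S + X j) k ks t" for t
    using Cons.prems by (intro Cons.IH) auto
  note [measurable] = bridge_measurable[OF h(2)] bridge_measurable[OF h(1)] h
  show ?case
    unfolding bridge.simps
  proof (rule integral_dominated_convergence)
    show "integrable lborel (\<lambda>t. B * H j (t - u))"
      using shifted_integral[of "H j"] Cons.prems(1)[of j] by simp
    show "AE t in lborel. (\<lambda>n. kappa (asc j k) (G (S + X j)) t * h n j (t - u) * bridge (h n) asc G X (S + X j) k ks t)
       \<longlonglongrightarrow> kappa (asc j k) (G (S + X j)) t * h' j (t - u) * bridge h' asc G X (S + X j) k ks t"
      using Cons.prems(4)[of j] by (intro AE_I2 tendsto_mult tendsto_const IH) auto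
    show "AE t in lborel. norm (kappa (asc j k) (G (S + X j)) t * h n j (t - u) * bridge (h n) asc G X (S + X j) k ks t) \<le> B * H j (t - u)" for n
      unfolding real_norm_def using Cons.prems h(1)
      by (intro AE_I2 kernel_integrable(3) B) auto
  qed measurable
qed

lemma integral_heat [simp]: "X > 0 \<Longrightarrow> (\<integral>v. heat X v \<partial>lborel) = 1"
  unfolding heat_def by simp

lemma heat_bridge_bounded:
  assumes "\<And>i. i \<in> set (j # ks) \<Longrightarrow> W i > 0"
  shows "\<exists>B. \<forall>u. \<bar>bridge (\<lambda>i. heat (W i)) asc G X S j ks u\<bar> \<le> B"
proof -
  have "\<exists>B. \<forall>h u. (\<forall>i. h i \<in> borel_measurable borel) \<longrightarrow> (\<forall>i\<in>set (j # ks). \<forall>v. \<bar>h i v\<bar> \<le> heat (W i) v) \<longrightarrow>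
    \<bar>bridge h asc G X S j ks u\<bar> \<le> B"
    by (rule bridge_bounded[where C = "\<lambda>i. 1 / sqrt (2 * pi * W i)"]) (auto intro!: integrable_heat heat_le assms)
  then show ?thesis
    using heat_measurable by (metis abs_of_nonneg heat_nonneg order.refl)
qed

lemma heat_convolution:
  assumes "X > 0" "Y > 0"
  shows "(\<integral>t. heat X (t - u) * heat Y (s - t) \<partial>lborel) = heat (X + Y) (s - u)"
    and "integrable lborel (\<lambda>t. heat X (t - u) * heat Y (s - t))"
proof -
  have "(\<integral>\<^sup>+t. ennreal (normal_density 0 (sqrt Y) (s - u - t) * normal_density 0 (sqrt X) t) \<partial>lborel)
     = ennreal (normal_density 0 (sqrt ((sqrt Y)\<^sup>2 + (sqrt X)\<^sup>2)) (s - u))"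
    using conv_normal_density_zero_mean[of "sqrt Y" "sqrt X"] assms by (simp add: fun_eq_iff)
  then have nn: "(\<integral>\<^sup>+t. ennreal (heat Y (s - u - t) * heat X t) \<partial>lborel) = ennreal (heat (X + Y) (s - u))"
    using assms by (simp add: heat_def add.commute)
  have int: "integrable lborel (\<lambda>t. heat Y (s - u - t) * heat X t)"
    by (rule integrableI_nn_integral_finite[OF _ _ nn]) auto
  have eq: "(\<integral>t. heat Y (s - u - t) * heat X t \<partial>lborel) = heat (X + Y) (s - u)"
    by (rule integral_eq_nn_integral[THEN trans]) (auto simp: nn)
  show "(\<integral>t. heat X (t - u) * heat Y (s - t) \<partial>lborel) = heat (X + Y) (s - u)"
    using shifted_integral(2)[OF int, of u] eq by (simp add: mult.commute)
  show "integrable lborel (\<lambda>t. heat X (t - u) * heat Y (s - t))"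
    using shifted_integral(1)[OF int, of u] by (simp add: mult.commute)
qed

text \<open>\<open>w\<close> stands for the next constraint together with the rest of the path.
  Being bounded, it does not disturb the exchange of integrals, so the two heat kernels can be
  convolved first.\<close>

lemma heat_convolution_bounded:
  fixes w :: "real \<Rightarrow> real"
  assumes X: "X > 0" "Y > 0" and [measurable]: "w \<in> borel_measurable borel" and w: "\<And>s. \<bar>w s\<bar> \<le> B"
  shows "(\<integral>t. heat X (t - u) * (\<integral>s. w s * heat Y (s - t) \<partial>lborel) \<partial>lborel) = (\<integral>s. w s * heat (X + Y) (s - u) \<partial>lborel)"
proof -
  have B: "B \<ge> 0" using w[of 0] by linarith
  have wi: "integrable lborel (\<lambda>s. w s * heat Y (s - t))" for t
  proof (rule Bochner_Integration.integrable_bound)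
    show "integrable lborel (\<lambda>s. B * heat Y (s - t))" using shifted_integral(1)[OF integrable_heat[OF X(2)]] by simp
    show "AE s in lborel. norm (w s * heat Y (s - t)) \<le> norm (B * heat Y (s - t))"
      using w B by (intro AE_I2) (auto simp: abs_mult intro!: mult_right_mono)
  qed measurable
  have "integrable (lborel \<Otimes>\<^sub>M lborel) (\<lambda>(t, s). B * (heat X (t - u) * heat Y (s - t)))"
  proof (rule lborel_pair.Fubini_integrable)
    have "(\<lambda>t. \<integral>s. norm (case (t, s) of (t, s) \<Rightarrow> B * (heat X (t - u) * heat Y (s - t))) \<partial>lborel) = (\<lambda>t. B * heat X (t - u))"
      using B shifted_integral(2)[OF integrable_heat[OF X(2)]] X by (simp add: abs_mult)
    then show "integrable lborel (\<lambda>t. \<integral>s. norm (case (t, s) of (t, s) \<Rightarrow> B * (heat X (t - u) * heat Y (s - t))) \<partial>lborel)"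
      using shifted_integral(1)[OF integrable_heat[OF X(1)]] by simp
    show "AE t in lborel. integrable lborel (\<lambda>s. case (t, s) of (t, s) \<Rightarrow> B * (heat X (t - u) * heat Y (s - t)))"
      using shifted_integral(1)[OF integrable_heat[OF X(2)]] by simp
  qed measurable
  then have int: "integrable (lborel \<Otimes>\<^sub>M lborel) (\<lambda>(t, s). heat X (t - u) * (w s * heat Y (s - t)))"
  proof (rule Bochner_Integration.integrable_bound)
    have "\<bar>heat X (t - u) * (w s * heat Y (s - t))\<bar> \<le> \<bar>B * (heat X (t - u) * heat Y (s - t))\<bar>" for t s
    proof -
      have "\<bar>w s\<bar> * (heat X (t - u) * heat Y (s - t)) \<le> B * (heat X (t - u) * heat Y (s - t))"
        by (intro mult_right_mono w) auto
      then show ?thesis using B by (simp add: abs_mult mult_ac)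
    qed
    then show "AE p in lborel \<Otimes>\<^sub>M lborel. norm (case p of (t, s) \<Rightarrow> heat X (t - u) * (w s * heat Y (s - t)))
        \<le> norm (case p of (t, s) \<Rightarrow> B * (heat X (t - u) * heat Y (s - t)))"
      by (auto simp: split_def)
  qed measurable
  have "(\<integral>t. heat X (t - u) * (\<integral>s. w s * heat Y (s - t) \<partial>lborel) \<partial>lborel)
     = (\<integral>t. \<integral>s. heat X (t - u) * (w s * heat Y (s - t)) \<partial>lborel \<partial>lborel)"
    by simp
  also have "\<dots> = (\<integral>s. \<integral>t. heat X (t - u) * (w s * heat Y (s - t)) \<partial>lborel \<partial>lborel)"
    by (rule lborel_pair.Fubini_integral[OF int, symmetric])
  also have "\<dots> = (\<integral>s. w s * heat (X + Y) (s - u) \<partial>lborel)"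
  proof (intro Bochner_Integration.integral_cong refl)
    fix s
    have "(\<integral>t. heat X (t - u) * (w s * heat Y (s - t)) \<partial>lborel) = (\<integral>t. w s * (heat X (t - u) * heat Y (s - t)) \<partial>lborel)"
      by (simp only: mult_ac)
    then show "(\<integral>t. heat X (t - u) * (w s * heat Y (s - t)) \<partial>lborel) = w s * heat (X + Y) (s - u)"
      using heat_convolution[OF X] by simp
  qed
  finally show ?thesis .
qed

section \<open>From words to ordered set partitions\<close>

text \<open>Nodes are pairs of weight and label because the first node may be a block of merged
  letters: \<open>y\<close> is the weight of the whole block, whereas the next comparison involves
  its last letter \<open>k\<close>.\<close>

definition word_bridge :: "(real \<Rightarrow> real) \<Rightarrow> ('a::linorder \<Rightarrow> real) \<Rightarrow> real \<Rightarrow> real \<Rightarrow> 'a \<Rightarrow> 'a list \<Rightarrow> real \<Rightarrow> real" where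
  "word_bridge G x S y k ks u =
     bridge (\<lambda>p. heat (fst p)) (\<lambda>p q. snd p < snd q) G fst S (y, k) (map (\<lambda>k. (x k, k)) ks) u"

lemma word_bridge_Nil: "word_bridge G x S y k [] u = heat y u"
  by (simp add: word_bridge_def)

lemma word_bridge_Cons:
  "word_bridge G x S y k (k' # ks) u =
     (\<integral>t. kappa (k < k') (G (S + y)) t * heat y (t - u) * word_bridge G x (S + y) (x k') k' ks t \<partial>lborel)"
  by (simp add: word_bridge_def)

lemma word_bridge_measurable [measurable]: "word_bridge G x S y k ks \<in> borel_measurable borel"
  unfolding word_bridge_def[abs_def] by (intro bridge_measurable) simp

lemma word_bridge_bounded:
  assumes "y > 0" "\<And>i. i \<in> set ks \<Longrightarrow> x i > 0"
  shows "\<exists>B. \<forall>u. \<bar>word_bridge G x S y k ks u\<bar> \<le> B"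
  unfolding word_bridge_def using assms by (intro heat_bridge_bounded) auto

text \<open>At a descent the kernel is \<open>1 - indicator\<close>; the constant \<open>1\<close> removes the constraint, so the two
  neighbouring heat kernels convolve into one.\<close>
lemma word_bridge_expand:
  assumes y: "y > 0" and x: "\<And>i. i \<in> set (k' # ks) \<Longrightarrow> x i > 0"
  shows "word_bridge G x S y k (k' # ks) u =
     (\<integral>t. kappa True (G (S + y)) t * heat y (t - u) * word_bridge G x (S + y) (x k') k' ks t \<partial>lborel)
     + (if k < k' then 0 else word_bridge G x S (y + x k') k' ks u)"
proof (cases "k < k'")
  case True
  then show ?thesis by (simp add: word_bridge_Cons)
next
  case False
  let ?w = "word_bridge G x (S + y) (x k') k' ks"
  have xk: "x k' > 0" using x by simp
  have "\<exists>B. \<forall>u. \<bar>?w u\<bar> \<le> B" using xk x by (intro word_bridge_bounded) auto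
  then obtain B where B: "\<And>u. \<bar>?w u\<bar> \<le> B" by blast
  note int = kernel_integrable(1)[OF heat_measurable word_bridge_measurable integrable_heat[OF y], where B = B]
  have "word_bridge G x S y k (k' # ks) u
     = (\<integral>t. kappa True (G (S + y)) t * heat y (t - u) * ?w t + heat y (t - u) * ?w t \<partial>lborel)"
    using False by (simp add: word_bridge_Cons kappa_def left_diff_distrib)
  also have "\<dots> = (\<integral>t. kappa True (G (S + y)) t * heat y (t - u) * ?w t \<partial>lborel) + (\<integral>t. heat y (t - u) * ?w t \<partial>lborel)"
  proof (rule Bochner_Integration.integral_add)
    show i1: "integrable lborel (\<lambda>t. kappa b (G (S + y)) t * heat y (t - u) * ?w t)" for b
      by (rule int) (use B in auto)
    have "integrable lborel (\<lambda>t. kappa False (G (S + y)) t * heat y (t - u) * ?w t - kappa True (G (S + y)) t * heat y (t - u) * ?w t)"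
      by (intro Bochner_Integration.integrable_diff i1)
    then show "integrable lborel (\<lambda>t. heat y (t - u) * ?w t)"
      by (simp add: kappa_def left_diff_distrib)
  qed
  also have "(\<integral>t. heat y (t - u) * ?w t \<partial>lborel) = word_bridge G x S (y + x k') k' ks u"
  proof (cases ks)
    case Nil
    then show ?thesis
      using heat_convolution(1)[OF y xk, of u 0] by (simp add: word_bridge_Nil)
  next
    case (Cons k'' ks')
    let ?v = "word_bridge G x (S + y + x k') (x k'') k'' ks'"
    have xk': "x k'' > 0" using x Cons by simp
    have "\<exists>C. \<forall>u. \<bar>?v u\<bar> \<le> C" using xk' x Cons by (intro word_bridge_bounded) auto
    then obtain C where C: "\<And>u. \<bar>?v u\<bar> \<le> C" by blast
    have C': "\<bar>kappa (k' < k'') (G (S + y + x k')) s * ?v s\<bar> \<le> C" for s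
    proof -
      have "\<bar>kappa (k' < k'') (G (S + y + x k')) s\<bar> * \<bar>?v s\<bar> \<le> 1 * C"
        by (intro mult_mono abs_kappa_le C) auto
      then show ?thesis by (simp add: abs_mult)
    qed
    have "(\<integral>t. heat y (t - u) * ?w t \<partial>lborel)
       = (\<integral>t. heat y (t - u) * (\<integral>s. (kappa (k' < k'') (G (S + y + x k')) s * ?v s) * heat (x k') (s - t) \<partial>lborel) \<partial>lborel)"
      unfolding Cons word_bridge_Cons by (simp only: mult_ac)
    also have "\<dots> = (\<integral>s. (kappa (k' < k'') (G (S + y + x k')) s * ?v s) * heat (y + x k') (s - u) \<partial>lborel)"
      by (rule heat_convolution_bounded[OF y xk _ C']) measurable
    finally show ?thesis unfolding Cons word_bridge_Cons by (simp only: mult_ac add.assoc)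
  qed
  finally show ?thesis using False by simp
qed

text \<open>Blocks are read in decreasing order, so the maximum is the first letter of the block;
  the sum is sorted by it.\<close>

lemma sum_subsets_by_Max:
  fixes R :: "'a::linorder set" and f :: "'a set \<Rightarrow> real"
  assumes "finite R"
  shows "(\<Sum>J\<in>{J. J \<subseteq> R \<and> J \<noteq> {}}. f J) =
    (\<Sum>k\<in>R. \<Sum>J\<in>{J. J \<subseteq> R - {k} \<and> (\<forall>j\<in>J. j < k)}. f (insert k J))"
proof -
  let ?A = "SIGMA k:R. {J. J \<subseteq> R - {k} \<and> (\<forall>j\<in>J. j < k)}"
  have M: "Max (insert k J) = k" "insert k J - {k} = J" if "J \<subseteq> R - {k}" "\<forall>j\<in>J. j < k" for k J
  proof -
    have "finite J" using that assms finite_subset by blast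
    then show "Max (insert k J) = k" using that by (intro Max_eqI) (auto intro: less_imp_le)
    show "insert k J - {k} = J" using that by auto
  qed
  have "bij_betw (\<lambda>(k, J). insert k J) ?A {J. J \<subseteq> R \<and> J \<noteq> {}}"
  proof (rule bij_betw_byWitness[where f' = "\<lambda>J. (Max J, J - {Max J})"])
    show "\<forall>a\<in>?A. (\<lambda>J. (Max J, J - {Max J})) (case a of (k, J) \<Rightarrow> insert k J) = a"
      using M by auto
    have Max: "Max J \<in> J" "\<forall>j\<in>J - {Max J}. j < Max J" if "J \<subseteq> R" "J \<noteq> {}" for J
    proof -
      have "finite J" using that assms finite_subset by blast
      then show "Max J \<in> J" "\<forall>j\<in>J - {Max J}. j < Max J" using that
        by (auto simp: less_le)
    qed
    show "\<forall>a'\<in>{J. J \<subseteq> R \<and> J \<noteq> {}}. (case (Max a', a' - {Max a'}) of (k, J) \<Rightarrow> insert k J) = a'"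
      using Max by auto
    show "(\<lambda>(k, J). insert k J) ` ?A \<subseteq> {J. J \<subseteq> R \<and> J \<noteq> {}}" by auto
    show "(\<lambda>J. (Max J, J - {Max J})) ` {J. J \<subseteq> R \<and> J \<noteq> {}} \<subseteq> ?A"
      using Max by blast
  qed
  then have "(\<Sum>J\<in>{J. J \<subseteq> R \<and> J \<noteq> {}}. f J) = (\<Sum>(k, J)\<in>?A. f (insert k J))"
    by (subst sum.reindex_bij_betw[symmetric]) (auto intro!: sum.cong)
  also have "\<dots> = (\<Sum>k\<in>R. \<Sum>J\<in>{J. J \<subseteq> R - {k} \<and> (\<forall>j\<in>J. j < k)}. f (insert k J))"
    using assms by (subst sum.Sigma) auto
  finally show ?thesis .
qed

text \<open>\<open>y\<close> and \<open>k\<close> are the weight and the last letter of the block in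
  progress, \<open>S\<close> the weight before that block, \<open>R\<close> the letters still to be
  read.\<close>

definition words_from :: "(real \<Rightarrow> real) \<Rightarrow> ('a::linorder \<Rightarrow> real) \<Rightarrow> real \<Rightarrow> real \<Rightarrow> 'a \<Rightarrow> 'a set \<Rightarrow> real \<Rightarrow> real" where
  "words_from G x S y k R u = (\<Sum>ks\<in>permutations_of_set R. word_bridge G x S y k ks u)"

definition all_words :: "(real \<Rightarrow> real) \<Rightarrow> ('a::linorder \<Rightarrow> real) \<Rightarrow> real \<Rightarrow> 'a set \<Rightarrow> real \<Rightarrow> real" where
  "all_words G x S R u = (\<Sum>k\<in>R. words_from G x S (x k) k (R - {k}) u)"

text \<open>The contribution of a completed block of total weight \<open>Y\<close> after accumulated weight \<open>S\<close>;
  \<open>T\<close> is the total over all continuations on \<open>R\<close>.\<close>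
definition close_block ::
    "(real \<Rightarrow> real) \<Rightarrow> real \<Rightarrow> real \<Rightarrow> 'a set \<Rightarrow> (real \<Rightarrow> real) \<Rightarrow> real \<Rightarrow> real" where
  "close_block G S Y R T u =
     (if R = {} then heat Y u else (\<integral>t. kappa True (G (S + Y)) t * heat Y (t - u) * T t \<partial>lborel))"

text \<open>\<open>J\<close> is the remainder of the block in progress. It must be read in
  decreasing order starting below \<open>k\<close>, so the set alone determines the run.\<close>

lemma words_from_eq:
  assumes "finite R" "y > 0" "\<And>i. i \<in> R \<Longrightarrow> x i > 0" "k \<notin> R"
  shows "words_from G x S y k R u =
    (\<Sum>J\<in>{J. J \<subseteq> R \<and> (\<forall>j\<in>J. j < k)}.
       close_block G S (y + sum x J) (R - J) (all_words G x (S + (y + sum x J)) (R - J)) u)"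
  using assms
proof (induction "card R" arbitrary: R y k u rule: less_induct)
  case less
  let ?f = "\<lambda>y J. close_block G S (y + sum x J) (R - J) (all_words G x (S + (y + sum x J)) (R - J)) u"
  show ?case
  proof (cases "R = {}")
    case True
    moreover have "{J. J \<subseteq> {} \<and> (\<forall>j\<in>J. j < k)} = {{}}" by auto
    ultimately show ?thesis by (simp add: words_from_def word_bridge_Nil close_block_def del: subset_empty)
  next
    case False
    define Rk where "Rk = {j\<in>R. j < k}"
    have Rk: "finite Rk" "Rk \<subseteq> R" using less.prems by (auto simp: Rk_def)
    let ?c = "\<lambda>m ks t. kappa True (G (S + y)) t * heat y (t - u) * word_bridge G x (S + y) (x m) m ks t"
    have int: "integrable lborel (?c m ks)" if "m \<in> R" "ks \<in> permutations_of_set (R - {m})" for m ks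
    proof -
      have "set ks = R - {m}" using that by (simp add: permutations_of_set_def)
      then have "\<exists>B. \<forall>u. \<bar>word_bridge G x (S + y) (x m) m ks u\<bar> \<le> B"
        using that less.prems by (intro word_bridge_bounded) auto
      then obtain B where "\<And>u. \<bar>word_bridge G x (S + y) (x m) m ks u\<bar> \<le> B" by blast
      then show ?thesis
        by (intro kernel_integrable(1)[OF heat_measurable word_bridge_measurable integrable_heat[OF less.prems(2)]]) auto
    qed
    \<comment> \<open>The next letter \<open>m\<close> either opens a new block, with the ascent
      kernel whatever the order, or joins the current one, which needs \<open>m < k\<close>. The
      first alternatives together form the term with \<open>J\<close> empty.\<close>
    have "words_from G x S y k R u = (\<Sum>m\<in>R. \<Sum>ks\<in>permutations_of_set (R - {m}).
        (\<integral>t. ?c m ks t \<partial>lborel) + (if k < m then 0 else word_bridge G x S (y + x m) m ks u))"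
      unfolding words_from_def sum_permutations_of_set_rec[OF less.prems(1) False]
      using less.prems by (intro sum.cong refl word_bridge_expand) (auto simp: permutations_of_set_def)
    also have "\<dots> = (\<Sum>m\<in>R. \<Sum>ks\<in>permutations_of_set (R - {m}). \<integral>t. ?c m ks t \<partial>lborel)
        + (\<Sum>m\<in>R. if k < m then 0 else words_from G x S (y + x m) m (R - {m}) u)"
      by (simp add: sum.distrib words_from_def) (rule sum.cong, auto simp: words_from_def)
    also have "(\<Sum>m\<in>R. \<Sum>ks\<in>permutations_of_set (R - {m}). \<integral>t. ?c m ks t \<partial>lborel) = ?f y {}"
    proof -
      have "?f y {} = (\<integral>t. (\<Sum>m\<in>R. \<Sum>ks\<in>permutations_of_set (R - {m}). ?c m ks t) \<partial>lborel)"
        using False unfolding close_block_def all_words_def words_from_def sum_distrib_left by simp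
      also have "\<dots> = (\<Sum>m\<in>R. \<integral>t. (\<Sum>ks\<in>permutations_of_set (R - {m}). ?c m ks t) \<partial>lborel)"
        by (rule Bochner_Integration.integral_sum) (intro Bochner_Integration.integrable_sum int)
      also have "\<dots> = (\<Sum>m\<in>R. \<Sum>ks\<in>permutations_of_set (R - {m}). \<integral>t. ?c m ks t \<partial>lborel)"
        by (intro sum.cong refl Bochner_Integration.integral_sum int)
      finally show ?thesis ..
    qed
    also have "(\<Sum>m\<in>R. if k < m then 0 else words_from G x S (y + x m) m (R - {m}) u)
       = (\<Sum>m\<in>Rk. words_from G x S (y + x m) m (R - {m}) u)"
      using less.prems(1,4) by (intro sum.mono_neutral_cong_right) (auto simp: Rk_def not_less le_less)
    \<comment> \<open>A joining letter \<open>m\<close> is the largest of those added; the induction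
      hypothesis supplies the added letters below it.\<close>
    also have "\<dots> = (\<Sum>m\<in>Rk. \<Sum>J\<in>{J. J \<subseteq> Rk - {m} \<and> (\<forall>j\<in>J. j < m)}. ?f y (insert m J))"
    proof (intro sum.cong refl)
      fix m assume m: "m \<in> Rk"
      have "words_from G x S (y + x m) m (R - {m}) u = (\<Sum>J\<in>{J. J \<subseteq> R - {m} \<and> (\<forall>j\<in>J. j < m)}.
         close_block G S (y + x m + sum x J) (R - {m} - J) (all_words G x (S + (y + x m + sum x J)) (R - {m} - J)) u)"
        using m Rk less.prems by (intro less.hyps card_Diff1_less) (auto intro!: add_pos_pos)
      also have "\<dots> = (\<Sum>J\<in>{J. J \<subseteq> Rk - {m} \<and> (\<forall>j\<in>J. j < m)}. ?f y (insert m J))"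
      proof (intro sum.cong)
        show "{J. J \<subseteq> R - {m} \<and> (\<forall>j\<in>J. j < m)} = {J. J \<subseteq> Rk - {m} \<and> (\<forall>j\<in>J. j < m)}"
          using m by (auto simp: Rk_def dest: less_trans)
        fix J assume "J \<in> {J. J \<subseteq> Rk - {m} \<and> (\<forall>j\<in>J. j < m)}"
        then have "finite J" "m \<notin> J" using Rk finite_subset[of J Rk] by auto
        then have "y + x m + sum x J = y + sum x (insert m J)" by simp
        moreover have "R - {m} - J = R - insert m J" by auto
        ultimately show "close_block G S (y + x m + sum x J) (R - {m} - J) (all_words G x (S + (y + x m + sum x J)) (R - {m} - J)) u
          = ?f y (insert m J)" by (simp only:)
      qed
      finally show "words_from G x S (y + x m) m (R - {m}) u = (\<Sum>J\<in>{J. J \<subseteq> Rk - {m} \<and> (\<forall>j\<in>J. j < m)}. ?f y (insert m J))" .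
    qed
    also have "\<dots> = (\<Sum>J\<in>{J. J \<subseteq> Rk \<and> J \<noteq> {}}. ?f y J)"
      by (rule sum_subsets_by_Max[OF Rk(1), symmetric])
    also have "?f y {} + (\<Sum>J\<in>{J. J \<subseteq> Rk \<and> J \<noteq> {}}. ?f y J) = (\<Sum>J\<in>insert {} {J. J \<subseteq> Rk \<and> J \<noteq> {}}. ?f y J)"
      using Rk by (subst sum.insert) auto
    also have "insert {} {J. J \<subseteq> Rk \<and> J \<noteq> {}} = {J. J \<subseteq> R \<and> (\<forall>j\<in>J. j < k)}"
      by (auto simp: Rk_def)
    finally show ?thesis .
  qed
qed

lemma all_words_eq:
  assumes "finite R" "\<And>i. i \<in> R \<Longrightarrow> x i > 0"
  shows "all_words G x S R u =
    (\<Sum>J\<in>{J. J \<subseteq> R \<and> J \<noteq> {}}. close_block G S (sum x J) (R - J) (all_words G x (S + sum x J) (R - J)) u)"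
  unfolding sum_subsets_by_Max[OF assms(1)] all_words_def[of G x S R]
proof (intro sum.cong refl)
  fix k assume k: "k \<in> R"
  have "words_from G x S (x k) k (R - {k}) u = (\<Sum>J\<in>{J. J \<subseteq> R - {k} \<and> (\<forall>j\<in>J. j < k)}.
       close_block G S (x k + sum x J) (R - {k} - J) (all_words G x (S + (x k + sum x J)) (R - {k} - J)) u)"
    using assms k by (intro words_from_eq) auto
  also have "\<dots> = (\<Sum>J\<in>{J. J \<subseteq> R - {k} \<and> (\<forall>j\<in>J. j < k)}.
     close_block G S (sum x (insert k J)) (R - insert k J) (all_words G x (S + sum x (insert k J)) (R - insert k J)) u)"
  proof (intro sum.cong refl)
    fix J assume "J \<in> {J. J \<subseteq> R - {k} \<and> (\<forall>j\<in>J. j < k)}"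
    then have "finite J" "k \<notin> J" using assms(1) finite_subset[of J R] by auto
    then have "x k + sum x J = sum x (insert k J)" by simp
    moreover have "R - {k} - J = R - insert k J" by auto
    ultimately show "close_block G S (x k + sum x J) (R - {k} - J) (all_words G x (S + (x k + sum x J)) (R - {k} - J)) u
       = close_block G S (sum x (insert k J)) (R - insert k J) (all_words G x (S + sum x (insert k J)) (R - insert k J)) u"
      by (simp only:)
  qed
  finally show "words_from G x S (x k) k (R - {k}) u = \<dots>" .
qed

definition ordered_partitions :: "'a set \<Rightarrow> 'a set list set" where
  "ordered_partitions R = {Is. {} \<notin> set Is \<and> \<Union>(set Is) = R \<and> sorted_wrt disjnt Is}"

lemma ordered_partitions_empty: "ordered_partitions {} = {[]}"
proof -
  have "Is = []" if "{} \<notin> set Is" "\<Union>(set Is) = {}" for Is :: "'a set list"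
    using that by (cases Is) auto
  then show ?thesis by (auto simp: ordered_partitions_def)
qed

lemma ordered_partitions_rec:
  assumes "R \<noteq> {}"
  shows "ordered_partitions R = (\<Union>I\<in>{I. I \<subseteq> R \<and> I \<noteq> {}}. (#) I ` ordered_partitions (R - I))"
proof (intro equalityI subsetI)
  fix Is assume Is: "Is \<in> ordered_partitions R"
  then obtain I Js where c: "Is = I # Js" using assms by (cases Is) (auto simp: ordered_partitions_def)
  then have "Js \<in> ordered_partitions (R - I)"
    using Is by (auto simp: ordered_partitions_def disjnt_def)
  then show "Is \<in> (\<Union>I\<in>{I. I \<subseteq> R \<and> I \<noteq> {}}. (#) I ` ordered_partitions (R - I))"
    using Is c by (auto simp: ordered_partitions_def)
next
  fix Is assume "Is \<in> (\<Union>I\<in>{I. I \<subseteq> R \<and> I \<noteq> {}}. (#) I ` ordered_partitions (R - I))"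
  then obtain I Js where "Is = I # Js" "I \<subseteq> R" "I \<noteq> {}" "Js \<in> ordered_partitions (R - I)" by auto
  then show "Is \<in> ordered_partitions R"
    by (auto simp: ordered_partitions_def disjnt_def)
qed

lemma finite_ordered_partitions: "finite R \<Longrightarrow> finite (ordered_partitions R)"
proof (induction "card R" arbitrary: R rule: less_induct)
  case less
  show ?case
  proof (cases "R = {}")
    case True
    then show ?thesis by (simp add: ordered_partitions_empty)
  next
    case False
    have "finite (ordered_partitions (R - I))" if "I \<subseteq> R" "I \<noteq> {}" for I
    proof -
      have "card (R - I) < card R" using that less.prems by (intro psubset_card_mono) auto
      then show ?thesis using less by auto
    qed
    then show ?thesis
      unfolding ordered_partitions_rec[OF False] using less.prems by auto
  qed
qed

text \<open>Every kernel is the ascent kernel, so the sign of a partition, one minus for each cut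
  between blocks, is contained in the bridge.\<close>

definition block_bridge :: "(real \<Rightarrow> real) \<Rightarrow> ('a \<Rightarrow> real) \<Rightarrow> real \<Rightarrow> 'a set list \<Rightarrow> real \<Rightarrow> real" where
  "block_bridge G x S Is u = bridge (\<lambda>I. heat (sum x I)) (\<lambda>_ _. True) G (sum x) S (hd Is) (tl Is) u"

text \<open>\<open>all_words_eq\<close> peels off the first block, which is also the recursion
  satisfied by ordered partitions.\<close>

lemma all_words_eq_partitions:
  assumes "finite R" "R \<noteq> {}" "\<And>i. i \<in> R \<Longrightarrow> x i > 0"
  shows "all_words G x S R u = (\<Sum>Is\<in>ordered_partitions R. block_bridge G x S Is u)"
  using assms
proof (induction "card R" arbitrary: R S u rule: less_induct)
  case less
  have "(\<Sum>Is\<in>ordered_partitions R. block_bridge G x S Is u)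
     = (\<Sum>I\<in>{I. I \<subseteq> R \<and> I \<noteq> {}}. \<Sum>Is\<in>(#) I ` ordered_partitions (R - I). block_bridge G x S Is u)"
    unfolding ordered_partitions_rec[OF less.prems(2)] using less.prems(1)
    by (intro sum.UNION_disjoint) (auto intro!: finite_imageI finite_ordered_partitions)
  also have "\<dots> = (\<Sum>I\<in>{I. I \<subseteq> R \<and> I \<noteq> {}}.
       close_block G S (sum x I) (R - I) (all_words G x (S + sum x I) (R - I)) u)"
  proof (intro sum.cong refl)
    fix I assume I: "I \<in> {I. I \<subseteq> R \<and> I \<noteq> {}}"
    then have xI: "sum x I > 0" using less.prems finite_subset[of I R] by (intro sum_pos) auto
    have "(\<Sum>Is\<in>(#) I ` ordered_partitions (R - I). block_bridge G x S Is u)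
       = (\<Sum>Is\<in>ordered_partitions (R - I). block_bridge G x S (I # Is) u)"
      by (simp add: sum.reindex)
    also have "\<dots> = close_block G S (sum x I) (R - I) (all_words G x (S + sum x I) (R - I)) u"
    proof (cases "R - I = {}")
      case True
      then show ?thesis unfolding True by (simp add: ordered_partitions_empty block_bridge_def close_block_def)
    next
      case False
      have c: "card (R - I) < card R" using I less.prems by (intro psubset_card_mono) auto
      have nn: "Is \<noteq> []" if "Is \<in> ordered_partitions (R - I)" for Is
        using that False by (auto simp: ordered_partitions_def)
      have int: "integrable lborel (\<lambda>t. kappa True (G (S + sum x I)) t * heat (sum x I) (t - u) * block_bridge G x (S + sum x I) Is t)"
        if "Is \<in> ordered_partitions (R - I)" for Is
      proof -
        have "sum x J > 0" if "J \<in> set (hd Is # tl Is)" for J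
        proof -
          have "J \<in> set Is" using that nn[OF \<open>Is \<in> _\<close>] by (cases Is) auto
          then have "J \<noteq> {}" "J \<subseteq> R" using \<open>Is \<in> _\<close> by (auto simp: ordered_partitions_def)
          then show ?thesis using less.prems finite_subset[of J R] by (intro sum_pos) auto
        qed
        then obtain B where "\<And>u. \<bar>block_bridge G x (S + sum x I) Is u\<bar> \<le> B"
          unfolding block_bridge_def using heat_bridge_bounded[of "hd Is" "tl Is" "sum x"] by blast
        then show ?thesis unfolding block_bridge_def
          by (intro kernel_integrable(1)[OF heat_measurable bridge_measurable integrable_heat[OF xI]]) auto
      qed
      have "(\<Sum>Is\<in>ordered_partitions (R - I). block_bridge G x S (I # Is) u)
        = (\<Sum>Is\<in>ordered_partitions (R - I). \<integral>t. kappa True (G (S + sum x I)) t * heat (sum x I) (t - u) * block_bridge G x (S + sum x I) Is t \<partial>lborel)"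
      proof (intro sum.cong refl)
        fix Is assume "Is \<in> ordered_partitions (R - I)"
        from nn[OF this] obtain J Js where "Is = J # Js" by (cases Is) auto
        then show "block_bridge G x S (I # Is) u = (\<integral>t. kappa True (G (S + sum x I)) t * heat (sum x I) (t - u) * block_bridge G x (S + sum x I) Is t \<partial>lborel)"
          by (simp add: block_bridge_def)
      qed
      also have "\<dots> = (\<integral>t. kappa True (G (S + sum x I)) t * heat (sum x I) (t - u) *
          (\<Sum>Is\<in>ordered_partitions (R - I). block_bridge G x (S + sum x I) Is t) \<partial>lborel)"
        unfolding sum_distrib_left using int by (intro Bochner_Integration.integral_sum[symmetric])
      also have "(\<lambda>t. \<Sum>Is\<in>ordered_partitions (R - I). block_bridge G x (S + sum x I) Is t) = all_words G x (S + sum x I) (R - I)"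
        using less.hyps[OF c] False less.prems by (auto simp: fun_eq_iff)
      finally show ?thesis using False by (simp add: close_block_def)
    qed
    finally show "(\<Sum>Is\<in>(#) I ` ordered_partitions (R - I). block_bridge G x S Is u)
      = close_block G S (sum x I) (R - I) (all_words G x (S + sum x I) (R - I)) u" .
  qed
  also have "\<dots> = all_words G x S R u"
    using less.prems by (intro all_words_eq[symmetric]) auto
  finally show ?case ..
qed

section \<open>The integral of \<open>P\<^sub>n\<close>\<close>

text \<open>Summation by parts: each difference of two points is the sum of the consecutive
  differences between them, so the link at accumulated weight \<open>s\<close> collects the pairs
  across it. For the induction the letters already read act as a mass \<open>S\<close> sitting at
  the current point, which gives the additional term.\<close>

lemma chain_eq_word_term:
  assumes "X = S + (\<Sum>j\<leftarrow>k # ks. x j)"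
  shows "chain \<beta> (\<lambda>s. s * (X - s) / 2) x S k ks =
     exp (pairsum (coupling x \<beta>) (k # ks) / 2 + of_real S * (\<Sum>j\<leftarrow>ks. of_real (x j) * (\<beta> k - \<beta> j)) / 2) * ptR \<beta> (\<beta> k) ks"
  using assms
proof (induction ks arbitrary: k S)
  case Nil
  then show ?case by simp
next
  case (Cons k' ks)
  let ?s = "\<lambda>k ks. \<Sum>j\<leftarrow>ks. of_real (x j) * (\<beta> k - \<beta> j)"
  have X: "X = S + x k + (\<Sum>j\<leftarrow>k' # ks. x j)" using Cons.prems by simp
  have s1: "(\<Sum>j\<leftarrow>ks. complex_of_real (x j)) * (\<beta> k - \<beta> k') + ?s k' ks = ?s k ks" for ks
    by (induction ks) (auto simp: algebra_simps)
  have s0: "complex_of_real (\<Sum>j\<leftarrow>ks. x j) = (\<Sum>j\<leftarrow>ks. complex_of_real (x j))" for ks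
    by (induction ks) auto
  have s2: "(\<Sum>j\<leftarrow>ks. coupling x \<beta> k j) = of_real (x k) * ?s k ks" for ks
    by (induction ks) (auto simp: coupling_def algebra_simps)
  have "of_real ((S + x k) * (X - (S + x k)) / 2) * (\<beta> k - \<beta> k') + of_real (S + x k) * ?s k' ks / 2
     = of_real (S + x k) * ((\<Sum>j\<leftarrow>k' # ks. complex_of_real (x j)) * (\<beta> k - \<beta> k') + ?s k' (k' # ks)) / 2"
  proof -
    have "(S + x k) * (X - (S + x k)) / 2 = (S + x k) * (\<Sum>j\<leftarrow>k' # ks. x j) / 2" unfolding X by simp
    then have "complex_of_real ((S + x k) * (X - (S + x k)) / 2) = of_real (S + x k) * (\<Sum>j\<leftarrow>k' # ks. complex_of_real (x j)) / 2"
      by (simp only: s0 of_real_mult of_real_divide of_real_numeral)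
    moreover have "?s k' (k' # ks) = ?s k' ks" by simp
    ultimately show ?thesis by (simp only: distrib_left add_divide_distrib times_divide_eq_left mult.assoc)
  qed
  also have "\<dots> = (of_real S * ?s k (k' # ks) + (\<Sum>j\<leftarrow>k' # ks. coupling x \<beta> k j)) / 2"
    unfolding s1 s2 by (simp add: algebra_simps)
  finally have e: "of_real ((S + x k) * (X - (S + x k)) / 2) * (\<beta> k - \<beta> k') + of_real (S + x k) * ?s k' ks / 2
     = (of_real S * ?s k (k' # ks) + (\<Sum>j\<leftarrow>k' # ks. coupling x \<beta> k j)) / 2" .
  have "chain \<beta> (\<lambda>s. s * (X - s) / 2) x S k (k' # ks)
     = exp (of_real ((S + x k) * (X - (S + x k)) / 2) * (\<beta> k - \<beta> k') +
         (pairsum (coupling x \<beta>) (k' # ks) / 2 + of_real (S + x k) * ?s k' ks / 2)) * ptR \<beta> (\<beta> k) (k' # ks)"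
    unfolding chain.simps Cons.IH[OF X] by (simp add: exp_add)
  also have "of_real ((S + x k) * (X - (S + x k)) / 2) * (\<beta> k - \<beta> k') +
         (pairsum (coupling x \<beta>) (k' # ks) / 2 + of_real (S + x k) * ?s k' ks / 2)
     = pairsum (coupling x \<beta>) (k' # ks) / 2 + (of_real S * ?s k (k' # ks) + (\<Sum>j\<leftarrow>k' # ks. coupling x \<beta> k j)) / 2"
    unfolding e[symmetric] by (simp only: ac_simps)
  also have "\<dots> = pairsum (coupling x \<beta>) (k # k' # ks) / 2 + of_real S * ?s k (k' # ks) / 2"
    by (simp only: pairsum.simps add_divide_distrib ac_simps)
  finally show ?case .
qed

lemma word_sum_eq_chain:
  assumes "finite S" "S \<noteq> {}"
  shows "word_sum (coupling x \<beta>) \<beta> S =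
    (\<Sum>k\<in>S. \<Sum>ks\<in>permutations_of_set (S - {k}). chain \<beta> (\<lambda>s. s * (sum x S - s) / 2) x 0 k ks)"
  unfolding word_sum_def sum_permutations_of_set_rec[OF assms]
proof (intro sum.cong refl)
  fix k ks assume k: "k \<in> S" and "ks \<in> permutations_of_set (S - {k})"
  then have "set ks = S - {k}" "distinct ks" by (auto simp: permutations_of_set_def)
  then have "sum x S = 0 + (\<Sum>j\<leftarrow>k # ks. x j)"
    using k assms(1) by (simp add: sum.remove sum_list_distinct_conv_sum_set)
  from chain_eq_word_term[OF this, of \<beta>]
  show "exp (pairsum (coupling x \<beta>) (k # ks) / 2) * PT \<beta> (k # ks) = chain \<beta> (\<lambda>s. s * (sum x S - s) / 2) x 0 k ks"
    by simp
qed

text \<open>\<open>q\<close> counts the letters absorbed so far, which makes the accumulated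
  \<open>W\<close> explicit for a downward induction from \<open>n\<close>; the case
  \<open>q = 1\<close> is the product in \<open>Pn\<close>.\<close>

lemma nested_eq_prod:
  assumes "1 \<le> q" "q \<le> n"
  shows "nested w b (\<lambda>j. \<Sum>k=1..q. w (\<tau> k) j) (b (\<tau> q)) (map \<tau> [q+1..<n+1]) =
    (\<Prod>j=q..<n. zeta (\<Sum>k=1..j. w (\<tau> k) (\<tau> (j+1))) / (b (\<tau> j) - b (\<tau> (j+1))))"
  using assms(2,1)
proof (induction q rule: inc_induct)
  case base
  then show ?case by simp
next
  case (step q)
  have "[q+1..<n+1] = (q + 1) # [Suc q+1..<n+1]" using step by (simp add: upt_conv_Cons)
  moreover have "(\<lambda>j. (\<Sum>k=1..q. w (\<tau> k) j) + w (\<tau> (q + 1)) j) = (\<lambda>j. \<Sum>k=1..Suc q. w (\<tau> k) j)"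
    by (simp add: fun_eq_iff)
  ultimately show ?case
    using step by (simp add: prod.atLeast_Suc_lessThan del: upt_Suc)
qed

lemma bij_betw_permutations_fixing:
  assumes "n \<ge> 1"
  shows "bij_betw (\<lambda>\<tau>. map \<tau> [2..<n+1]) {\<tau>. \<tau> permutes {1..n} \<and> \<tau> 1 = 1} (permutations_of_set {2..n})"
proof -
  have eq: "{\<tau>. \<tau> permutes {1..n} \<and> \<tau> 1 = 1} = {\<tau>. \<tau> permutes {2..n}}"
  proof (intro equalityI subsetI; clarify)
    fix \<tau> assume "\<tau> permutes {1..n}" "\<tau> 1 = 1"
    moreover have "i = 1" if "i \<in> {1..n} - {2..n}" for i using that by auto
    ultimately show "\<tau> permutes {2..n}"
      by (metis permutes_superset)
  next
    fix \<tau> assume t: "\<tau> permutes {2..n}"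
    then show "\<tau> permutes {1..n} \<and> \<tau> 1 = 1"
      using permutes_subset[OF t, of "{1..n}"] permutes_not_in[OF t, of 1] by auto
  qed
  have s: "set [2..<n+1] = {2..n}" by auto
  have "bij_betw (\<lambda>\<tau>. map \<tau> [2..<n+1]) {\<tau>. \<tau> permutes {2..n}} (permutations_of_set {2..n})"
    unfolding bij_betw_def
  proof
    show "inj_on (\<lambda>\<tau>. map \<tau> [2..<n+1]) {\<tau>. \<tau> permutes {2..n}}"
    proof (rule inj_onI, clarify)
      fix \<sigma> \<tau> assume p: "\<sigma> permutes {2..n}" "\<tau> permutes {2..n}" and "map \<sigma> [2..<n+1] = map \<tau> [2..<n+1]"
      then have "\<forall>i\<in>{2..n}. \<sigma> i = \<tau> i" unfolding map_eq_conv s by simp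
      then show "\<sigma> = \<tau>" using p by (metis ext permutes_not_in)
    qed
    show "(\<lambda>\<tau>. map \<tau> [2..<n+1]) ` {\<tau>. \<tau> permutes {2..n}} = permutations_of_set {2..n}"
    proof (intro equalityI subsetI)
      fix ks assume "ks \<in> (\<lambda>\<tau>. map \<tau> [2..<n+1]) ` {\<tau>. \<tau> permutes {2..n}}"
      then obtain \<tau> where t: "\<tau> permutes {2..n}" "ks = map \<tau> [2..<n+1]" by auto
      have "set ks = {2..n}" unfolding t(2) set_map s by (rule permutes_image[OF t(1)])
      moreover have "distinct ks" unfolding t(2) distinct_map s
        using permutes_inj_on[OF t(1)] by simp
      ultimately show "ks \<in> permutations_of_set {2..n}" by (rule permutations_of_setI)
    next
      fix ks assume "ks \<in> permutations_of_set {2..n}"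
      then have d: "distinct ks" "set ks = {2..n}" by (auto simp: permutations_of_set_def)
      define \<tau> where "\<tau> = (\<lambda>i. if i \<in> {2..n} then ks ! (i - 2) else i)"
      have len: "length ks = n - 1" using distinct_card[OF d(1)] d(2) by simp
      have m: "map \<tau> [2..<n+1] = ks"
        by (rule nth_equalityI) (auto simp: len \<tau>_def simp del: upt_Suc)
      have "bij_betw \<tau> {2..n} {2..n}"
        using d m unfolding bij_betw_def by (metis distinct_map s set_map)
      then have "\<tau> permutes {2..n}"
        by (rule bij_imp_permutes) (auto simp: \<tau>_def)
      then show "ks \<in> (\<lambda>\<tau>. map \<tau> [2..<n+1]) ` {\<tau>. \<tau> permutes {2..n}}" using m by force
    qed
  qed
  then show ?thesis unfolding eq .
qed

text \<open>The condition that \<tau> fixes 1 amounts to pinning letter 1. Since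
  \<open>coupling\<close> of \<open>i\<close> and \<open>j\<close> equals
  \<open>a i * x j - a j * x i\<close>, the arguments of \<open>zeta\<close> in \<open>Pn\<close>
  are accumulated couplings.\<close>

lemma Pn_eq_word_sum:
  assumes n: "n \<ge> 1" and x: "\<And>j. j \<in> {1..n} \<Longrightarrow> x j > 0"
    and \<beta>: "\<And>j. j \<in> {1..n} \<Longrightarrow> \<beta> j = a j / of_real (x j)" "inj_on \<beta> {1..n}"
  shows "Pn n a x = word_sum (coupling x \<beta>) \<beta> {1..n} / of_real (\<Prod>j=1..n. x j)"
proof (cases "n = 1")
  case True
  then show ?thesis by (simp add: Pn_def word_sum_def permutations_of_set_singleton)
next
  case False
  then have n2: "n \<ge> 2" using n by simp
  let ?w = "coupling x \<beta>"
  have ins: "{1..n} = insert 1 {2..n}" using n by auto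
  have "word_sum ?w \<beta> {1..n} = pinned_sum ?w \<beta> (?w 1) (\<beta> 1) {2..n}"
    unfolding ins by (rule word_sum_eq_pinned_sum[where w = ?w, OF coupling_antisym]) simp
  also have "\<dots> = (\<Sum>ks\<in>permutations_of_set {2..n}. nested ?w \<beta> (?w 1) (\<beta> 1) ks)"
    using \<beta>(2) unfolding ins
    by (intro pinned_sum_eq_nested[where w = ?w, OF coupling_antisym]) (auto simp: inj_on_def)
  also have "\<dots> = (\<Sum>\<tau>\<in>{\<tau>. \<tau> permutes {1..n} \<and> \<tau> 1 = 1}. nested ?w \<beta> (?w 1) (\<beta> 1) (map \<tau> [2..<n+1]))"
    by (rule sum.reindex_bij_betw[OF bij_betw_permutations_fixing[OF n], symmetric])
  finally have W: "word_sum ?w \<beta> {1..n} = \<dots>" .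
  show ?thesis
    unfolding W sum_divide_distrib Pn_def if_not_P[OF False]
  proof (intro sum.cong refl)
    fix \<tau> assume "\<tau> \<in> {\<tau>. \<tau> permutes {1..n} \<and> \<tau> 1 = 1}"
    then have t: "\<tau> permutes {1..n}" "\<tau> 1 = 1" by auto
    have tx: "x (\<tau> j) > 0" if "j \<in> {1..n}" for j using that x t(1) permutes_in_image by metis
    have tb: "\<beta> (\<tau> j) = a (\<tau> j) / of_real (x (\<tau> j))" if "j \<in> {1..n}" for j
      using that \<beta>(1) t(1) permutes_in_image by metis
    define A where "A = (\<Prod>j=1..n-1. zeta ((\<Sum>k=1..j. a (\<tau> k)) * of_real (x (\<tau> (j+1))) - a (\<tau> (j+1)) * of_real (\<Sum>k=1..j. x (\<tau> k))))"
    define B where "B = (\<Prod>j=1..n-1. \<beta> (\<tau> j) - \<beta> (\<tau> (j+1)))"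
    define C where "C = (\<Prod>j=2..n-1. complex_of_real (x (\<tau> j)))"
    have "complex_of_real (x (\<tau> j)) \<noteq> 0" if "j \<in> {2..n-1}" for j
    proof -
      have "j \<in> {1..n}" using that by auto
      then show ?thesis using tx[of j] by simp
    qed
    then have C0: "C \<noteq> 0" unfolding C_def by simp
    have iv: "{1..<n} = {1..n-1}" using n by auto
    have "nested ?w \<beta> (?w 1) (\<beta> 1) (map \<tau> [2..<n+1])
      = (\<Prod>j=1..<n. zeta (\<Sum>k=1..j. ?w (\<tau> k) (\<tau> (j+1))) / (\<beta> (\<tau> j) - \<beta> (\<tau> (j+1))))"
      using nested_eq_prod[where q = 1 and n = n and w = ?w and \<tau> = \<tau> and b = \<beta>] n t(2) by (simp add: numeral_2_eq_2 del: upt_Suc)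
    also have "\<dots> = A / B"
      unfolding prod_dividef iv A_def B_def
    proof (intro arg_cong2[where f = "(/)"] prod.cong refl arg_cong[where f = zeta])
      fix j assume j: "j \<in> {1..n-1}"
      have "?w (\<tau> k) (\<tau> (j+1)) = a (\<tau> k) * of_real (x (\<tau> (j+1))) - a (\<tau> (j+1)) * of_real (x (\<tau> k))" if "k \<in> {1..j}" for k
      proof -
        have "k \<in> {1..n}" "j + 1 \<in> {1..n}" using that j by auto
        then show ?thesis
          using tb[of k] tb[of "j+1"] tx[of k] tx[of "j+1"] by (simp add: coupling_def field_simps)
      qed
      then show "(\<Sum>k=1..j. ?w (\<tau> k) (\<tau> (j+1))) = (\<Sum>k=1..j. a (\<tau> k)) * of_real (x (\<tau> (j+1))) - a (\<tau> (j+1)) * of_real (\<Sum>k=1..j. x (\<tau> k))"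
        by (simp add: sum_subtractf sum_distrib_left sum_distrib_right)
    qed
    finally have N: "nested ?w \<beta> (?w 1) (\<beta> 1) (map \<tau> [2..<n+1]) = A / B" .
    \<comment> \<open>Interior letters lie in two consecutive pairs and the two end letters in one.
      The surplus \<open>C\<close> over the full product cancels against the numerator of
      \<open>Pn\<close>.\<close>
    have px: "(\<Prod>j=1..n-1. complex_of_real (x (\<tau> j)) * of_real (x (\<tau> (j+1)))) = C * of_real (\<Prod>j=1..n. x j)"
    proof -
      have "(\<Prod>j=1..n-1. complex_of_real (x (\<tau> j))) = of_real (x (\<tau> 1)) * C"
        unfolding C_def using n2 by (subst prod.atLeast_Suc_atMost) (auto simp: numeral_2_eq_2)
      moreover have "(\<Prod>j=1..n-1. complex_of_real (x (\<tau> (j+1)))) = (\<Prod>j=2..n. complex_of_real (x (\<tau> j)))"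
        using prod.shift_bounds_cl_nat_ivl[of "\<lambda>j. complex_of_real (x (\<tau> j))" 1 1 "n-1"] n by (simp add: numeral_2_eq_2)
      moreover have "of_real (x (\<tau> 1)) * (\<Prod>j=2..n. complex_of_real (x (\<tau> j))) = (\<Prod>j=1..n. complex_of_real (x (\<tau> j)))"
        using n by (subst prod.atLeast_Suc_atMost[of 1 n]) (auto simp: numeral_2_eq_2)
      moreover have "(\<Prod>j=1..n. complex_of_real (x (\<tau> j))) = (\<Prod>j=1..n. complex_of_real (x j))"
        by (rule prod.permute[OF t(1), of "\<lambda>j. complex_of_real (x j)", symmetric, unfolded o_def])
      ultimately show ?thesis by (simp add: prod.distrib mult_ac)
    qed
    have "(\<Prod>j=1..n-1. a (\<tau> j) * of_real (x (\<tau> (j+1))) - a (\<tau> (j+1)) * of_real (x (\<tau> j)))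
      = (\<Prod>j=1..n-1. complex_of_real (x (\<tau> j)) * of_real (x (\<tau> (j+1))) * (\<beta> (\<tau> j) - \<beta> (\<tau> (j+1))))"
    proof (intro prod.cong refl)
      fix j assume j: "j \<in> {1..n-1}"
      show "a (\<tau> j) * of_real (x (\<tau> (j+1))) - a (\<tau> (j+1)) * of_real (x (\<tau> j)) = complex_of_real (x (\<tau> j)) * of_real (x (\<tau> (j+1))) * (\<beta> (\<tau> j) - \<beta> (\<tau> (j+1)))"
      proof -
        have "j \<in> {1..n}" "j + 1 \<in> {1..n}" using j by auto
        then show ?thesis
          using tb[of j] tb[of "j+1"] tx[of j] tx[of "j+1"] by (simp add: field_simps)
      qed
    qed
    also have "\<dots> = C * of_real (\<Prod>j=1..n. x j) * B"
      unfolding prod.distrib B_def px[unfolded prod.distrib, symmetric] ..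
    finally show "(C * A) / (\<Prod>j=1..n-1. a (\<tau> j) * of_real (x (\<tau> (j+1))) - a (\<tau> (j+1)) * of_real (x (\<tau> j)))
      = nested ?w \<beta> (?w 1) (\<beta> 1) (map \<tau> [2..<n+1]) / of_real (\<Prod>j=1..n. x j)"
      unfolding N using C0 by simp
  qed
qed

section \<open>Integrating the word sum and removing the real shifts\<close>

lemma bridge_scale:
  "bridge (\<lambda>i v. c i * h i v) asc G X S j ks u = (\<Prod>i\<leftarrow>j # ks. c i) * bridge h asc G X S j ks u"
proof (induction ks arbitrary: j S u)
  case (Cons k ks)
  have "bridge (\<lambda>i v. c i * h i v) asc G X S j (k # ks) u
     = (\<integral>t. (c j * (\<Prod>i\<leftarrow>k # ks. c i)) * (kappa (asc j k) (G (S + X j)) t * h j (t - u) * bridge h asc G X (S + X j) k ks t) \<partial>lborel)"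
    unfolding bridge.simps Cons.IH by (simp only: mult_ac)
  then show ?case by simp
qed simp

lemma bridge_asc_cong:
  assumes "\<And>i k. i \<in> set (j # ks) \<Longrightarrow> k \<in> set (j # ks) \<Longrightarrow> asc i k = asc' i k"
  shows "bridge h asc G X S j ks u = bridge h asc' G X S j ks u"
  using assms by (induction ks arbitrary: j S u) auto

lemma word_bridge_eq_bridge:
  "bridge (\<lambda>i. heat (x i)) (<) G x S k ks u = word_bridge G x S (x k) k ks u"
  unfolding word_bridge_def
  using bridge_map[of "\<lambda>p. heat (fst p)" "\<lambda>p q. snd p < snd q" G fst S "\<lambda>k. (x k, k)" k ks u] by simp

lemma tendsto_ptR:
  assumes "\<And>i. i \<in> set R \<Longrightarrow> (\<lambda>n. b n i) \<longlonglongrightarrow> b' i" "p \<longlonglongrightarrow> p'"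
    "distinct R" "inj_on b' (set R)" "p' \<notin> b' ` set R"
  shows "(\<lambda>n. ptR (b n) (p n) R) \<longlonglongrightarrow> ptR b' p' R"
  using assms
proof (induction R arbitrary: p p')
  case (Cons r R)
  have "(\<lambda>n. ptR (b n) (b n r) R) \<longlonglongrightarrow> ptR b' (b' r) R"
    using Cons.prems by (intro Cons.IH) auto
  then show ?case using Cons.prems by (auto intro!: tendsto_intros)
qed simp

lemma tendsto_pairsum:
  assumes "\<And>i j. i \<in> set ks \<Longrightarrow> j \<in> set ks \<Longrightarrow> (\<lambda>n. w n i j) \<longlonglongrightarrow> w' i j"
  shows "(\<lambda>n. pairsum (w n) ks) \<longlonglongrightarrow> pairsum w' ks"
  using assms
proof (induction ks)
  case (Cons k ks)
  have "(\<lambda>n. \<Sum>j\<leftarrow>js. w n k j) \<longlonglongrightarrow> (\<Sum>j\<leftarrow>js. w' k j)" if "set js \<subseteq> set (k # ks)" for js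
    using that Cons.prems by (induction js) (auto intro!: tendsto_intros)
  moreover have "(\<lambda>n. pairsum (w n) ks) \<longlonglongrightarrow> pairsum w' ks" using Cons by auto
  ultimately show ?case by (auto intro!: tendsto_intros)
qed simp

lemma tendsto_word_sum:
  assumes "finite S" "\<And>i. i \<in> S \<Longrightarrow> (\<lambda>n. b n i) \<longlonglongrightarrow> b' i" "inj_on b' S"
  shows "(\<lambda>n. word_sum (coupling x (b n)) (b n) S) \<longlonglongrightarrow> word_sum (coupling x b') b' S"
  unfolding word_sum_def
proof (rule tendsto_sum)
  fix ks assume "ks \<in> permutations_of_set S"
  then have ks: "set ks = S" "distinct ks" by (auto simp: permutations_of_set_def)
  have "(\<lambda>n. PT (b n) ks) \<longlonglongrightarrow> PT b' ks"
  proof (cases ks)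
    case (Cons k R)
    then show ?thesis using ks assms by (auto intro!: tendsto_ptR simp: inj_on_def)
  qed simp
  moreover have "(\<lambda>n. pairsum (coupling x (b n)) ks) \<longlonglongrightarrow> pairsum (coupling x b') ks"
    using assms ks unfolding coupling_def by (intro tendsto_pairsum tendsto_intros) auto
  ultimately show "(\<lambda>n. exp (pairsum (coupling x (b n)) ks / 2) * PT (b n) ks)
     \<longlonglongrightarrow> exp (pairsum (coupling x b') ks / 2) * PT b' ks"
    by (intro tendsto_intros) auto
qed

text \<open>With all other coordinates fixed, the equation leaves a single value for
  \<open>f i\<close>.\<close>

lemma AE_product_graph:
  fixes I :: "'a set"
  assumes "finite I" "i \<in> I" "j \<in> I" "i \<noteq> j" "c \<noteq> 0"
  shows "AE f in lborel_PiM I. f i / c \<noteq> f j / d"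
proof -
  let ?J = "I - {i}"
  let ?P = "\<lambda>f. f i / c = f j / d"
  have I: "I = insert i ?J" "finite ?J" "i \<notin> ?J" "j \<in> ?J" using assms by auto
  have m [measurable]: "{f \<in> space (lborel_PiM I). ?P f} \<in> sets (lborel_PiM I)"
    using assms(2,3) by measurable
  have "emeasure (lborel_PiM I) {f \<in> space (lborel_PiM I). ?P f}
     = (\<integral>\<^sup>+f. indicator {f \<in> space (lborel_PiM I). ?P f} f \<partial>lborel_PiM (insert i ?J))"
    using m I(1) by simp
  also have "\<dots> = (\<integral>\<^sup>+y. \<integral>\<^sup>+a. indicator {f \<in> space (lborel_PiM I). ?P f} (y(i := a)) \<partial>lborel \<partial>lborel_PiM ?J)"
    using m I by (intro lebesgue_product.product_nn_integral_insert) auto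
  also have "\<dots> \<le> (\<integral>\<^sup>+y. \<integral>\<^sup>+a. indicator {c * (y j / d)} a \<partial>lborel \<partial>lborel_PiM ?J)"
    using assms by (intro nn_integral_mono) (auto simp: indicator_def field_simps)
  also have "\<dots> = 0" by simp
  finally have "emeasure (lborel_PiM I) {f \<in> space (lborel_PiM I). ?P f} = 0" by simp
  then show ?thesis using m by (intro AE_I[where N = "{f \<in> space (lborel_PiM I). ?P f}"]) auto
qed

lemma AE_inj_on_node:
  assumes "finite I" "\<And>i. i \<in> I \<Longrightarrow> X i > 0"
  shows "AE f in lborel_PiM I. inj_on (node X (\<lambda>_. 0) f) I"
proof -
  have "AE f in lborel_PiM I. \<forall>i\<in>I. \<forall>j\<in>I. i \<noteq> j \<longrightarrow> f i / X i \<noteq> f j / X j"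
  proof (intro AE_finite_allI assms(1))
    fix i j assume "i \<in> I" "j \<in> I"
    then show "AE f in lborel_PiM I. i \<noteq> j \<longrightarrow> f i / X i \<noteq> f j / X j"
      using AE_product_graph[OF assms(1), of i j "X i" "X j"] assms(2)[of i] by (cases "i = j") auto
  qed
  then show ?thesis
  proof eventually_elim
    case (elim f)
    show ?case
    proof (rule inj_onI, rule ccontr)
      fix i j assume ij: "i \<in> I" "j \<in> I" "node X (\<lambda>_. 0) f i = node X (\<lambda>_. 0) f j" "i \<noteq> j"
      then have "Im (node X (\<lambda>_. 0) f i) = Im (node X (\<lambda>_. 0) f j)" by simp
      then have "f i / X i = f j / X j" by (simp add: node_def)
      then show False using elim ij by auto
    qed
  qed
qed

text \<open>The shifts \<open>d * j\<close> increase with the letter, so comparing real parts is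
  comparing letters: the kernels see the ascents and descents of the word.\<close>

lemma word_sum_integral_shifted:
  fixes S :: "nat set"
  assumes S: "finite S" "S \<noteq> {}" and x: "\<And>i. i \<in> S \<Longrightarrow> x i > 0" and d: "d > 0"
  defines "N \<equiv> (\<lambda>f. node x (\<lambda>j. d * real j) f)"
  defines "G \<equiv> (\<lambda>s. s * (sum x S - s) / 2)"
  shows "integrable (lborel_PiM S) (\<lambda>f. gauss_prod x S f * word_sum (coupling x (N f)) (N f) S)"
    and "(\<integral>f. gauss_prod x S f * word_sum (coupling x (N f)) (N f) S \<partial>lborel_PiM S)
     = of_real (\<Sum>k\<in>S. \<Sum>ks\<in>permutations_of_set (S - {k}).
         bridge (tilted x (\<lambda>i. d * real i)) (<) G x 0 k ks 0)"
proof -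
  have *: "gauss_prod x S f * word_sum (coupling x (N f)) (N f) S =
     (\<Sum>k\<in>S. \<Sum>ks\<in>permutations_of_set (S - {k}). gauss_prod x S f * exp (- of_real 0 * N f k) * chain (N f) G x 0 k ks)" for f
    unfolding word_sum_eq_chain[OF S] G_def by (simp add: sum_distrib_left)
  have ks: "distinct (k # ks)" "set (k # ks) = S" "inj_on (\<lambda>j. d * real j) (set (k # ks))"
    "\<And>i. i \<in> set (k # ks) \<Longrightarrow> x i > 0"
    if "k \<in> S" "ks \<in> permutations_of_set (S - {k})" for k ks
    using that d x by (auto simp: permutations_of_set_def inj_on_def)
  have int: "integrable (lborel_PiM S) (\<lambda>f. gauss_prod x S f * exp (- of_real 0 * N f k) * chain (N f) G x 0 k ks)"
    and eq: "(\<integral>f. gauss_prod x S f * exp (- of_real 0 * N f k) * chain (N f) G x 0 k ks \<partial>lborel_PiM S)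
      = of_real (bridge (tilted x (\<lambda>i. d * real i)) (<) G x 0 k ks 0)"
    if k: "k \<in> S" "ks \<in> permutations_of_set (S - {k})" for k ks
  proof -
    note K = ks[OF k]
    show "integrable (lborel_PiM S) (\<lambda>f. gauss_prod x S f * exp (- of_real 0 * N f k) * chain (N f) G x 0 k ks)"
      using chain_integrable[OF K(1,3,4), where u = 0 and G = G and Y = x and S = 0] unfolding K(2) N_def .
    have a: "bridge h (\<lambda>i k. d * real i < d * real k) G x 0 k ks 0 = bridge h (<) G x 0 k ks 0" for h
      using d by (intro bridge_asc_cong) simp
    show "(\<integral>f. gauss_prod x S f * exp (- of_real 0 * N f k) * chain (N f) G x 0 k ks \<partial>lborel_PiM S)
      = of_real (bridge (tilted x (\<lambda>i. d * real i)) (<) G x 0 k ks 0)"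
      using chain_integral[OF K(1,3,4), where u = 0 and G = G and Y = x and S = 0] unfolding K(2) N_def a .
  qed
  show "integrable (lborel_PiM S) (\<lambda>f. gauss_prod x S f * word_sum (coupling x (N f)) (N f) S)"
    unfolding * by (intro Bochner_Integration.integrable_sum int)
  have "(\<integral>f. gauss_prod x S f * word_sum (coupling x (N f)) (N f) S \<partial>lborel_PiM S)
    = (\<Sum>k\<in>S. \<integral>f. (\<Sum>ks\<in>permutations_of_set (S - {k}). gauss_prod x S f * exp (- of_real 0 * N f k) * chain (N f) G x 0 k ks) \<partial>lborel_PiM S)"
    unfolding * by (rule Bochner_Integration.integral_sum) (intro Bochner_Integration.integrable_sum int)
  also have "\<dots> = (\<Sum>k\<in>S. \<Sum>ks\<in>permutations_of_set (S - {k}). \<integral>f. gauss_prod x S f * exp (- of_real 0 * N f k) * chain (N f) G x 0 k ks \<partial>lborel_PiM S)"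
    by (intro sum.cong refl Bochner_Integration.integral_sum int)
  also have "\<dots> = (\<Sum>k\<in>S. \<Sum>ks\<in>permutations_of_set (S - {k}).
      complex_of_real (bridge (tilted x (\<lambda>i. d * real i)) (<) G x 0 k ks 0))"
    by (intro sum.cong refl eq)
  finally show "(\<integral>f. gauss_prod x S f * word_sum (coupling x (N f)) (N f) S \<partial>lborel_PiM S)
     = of_real (\<Sum>k\<in>S. \<Sum>ks\<in>permutations_of_set (S - {k}).
         bridge (tilted x (\<lambda>i. d * real i)) (<) G x 0 k ks 0)"
    by simp
qed

lemma heat_exp_le:
  assumes "X > 0"
  shows "heat X v * exp (c * v) \<le> exp (c\<^sup>2 * X / 2) / sqrt (2 * pi * X)"
proof -
  have "normal_density (c * X) (sqrt X) v \<le> 1 / sqrt (2 * pi * X)"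
    using assms by (simp add: normal_density_def divide_right_mono)
  then have "exp (c\<^sup>2 * X / 2) * normal_density (c * X) (sqrt X) v \<le> exp (c\<^sup>2 * X / 2) * (1 / sqrt (2 * pi * X))"
    by (intro mult_left_mono) auto
  then show ?thesis using heat_exp[OF assms, of v 0 c] by simp
qed

lemma tilted_bridge_tendsto:
  fixes ks :: "nat list"
  assumes x: "\<And>i. i \<in> set (k # ks) \<Longrightarrow> x i > 0" and d: "\<And>m. \<bar>d m\<bar> \<le> 1" "d \<longlonglongrightarrow> 0"
  shows "(\<lambda>m. bridge (tilted x (\<lambda>i. d m * real i)) asc G x S k ks u)
    \<longlonglongrightarrow> bridge (\<lambda>i v. 2 * pi * x i * heat (x i) v) asc G x S k ks u"
proof (rule bridge_tendsto)
  \<comment> \<open>An envelope independent of \<open>m\<close>: as \<open>d m\<close> has modulus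
    at most 1, the tilt is at most \<open>exp (i v) + exp (- i v)\<close>.\<close>
  let ?H = "\<lambda>i v. 2 * pi * x i * (heat (x i) v * exp (real i * v) + heat (x i) v * exp (- real i * v))"
  let ?C = "\<lambda>i. 2 * pi * x i * (exp ((real i)\<^sup>2 * x i / 2) / sqrt (2 * pi * x i) + exp ((- real i)\<^sup>2 * x i / 2) / sqrt (2 * pi * x i))"
  fix i assume i: "i \<in> set (k # ks)"
  show "integrable lborel (?H i)"
    using integrable_heat_exp[OF x[OF i], of 0 "real i"] integrable_heat_exp[OF x[OF i], of 0 "- real i"]
    by (intro integrable_mult_right Bochner_Integration.integrable_add) auto
  show "?H i v \<le> ?C i" for v
    using x[OF i] by (intro mult_left_mono add_mono heat_exp_le) auto
  show "\<bar>2 * pi * x i * heat (x i) v * exp (d m * real i * v)\<bar> \<le> ?H i v" for m v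
  proof -
    have "\<bar>d m * (real i * v)\<bar> \<le> 1 * \<bar>real i * v\<bar>" unfolding abs_mult[of "d m"] by (intro mult_right_mono d) auto
    then have "d m * real i * v \<le> \<bar>real i * v\<bar>" by (simp add: mult.assoc)
    then have "exp (d m * real i * v) \<le> exp (real i * v) + exp (- real i * v)"
    proof (cases "real i * v \<ge> 0")
      case True
      then have "exp (d m * real i * v) \<le> exp (real i * v)" using \<open>d m * real i * v \<le> \<bar>real i * v\<bar>\<close> by simp
      then show ?thesis by (simp add: add_increasing2)
    next
      case False
      then have "exp (d m * real i * v) \<le> exp (- real i * v)" using \<open>d m * real i * v \<le> \<bar>real i * v\<bar>\<close> by simp
      then show ?thesis by (simp add: add_increasing)
    qed
    then have "2 * pi * x i * heat (x i) v * exp (d m * real i * v) \<le> 2 * pi * x i * heat (x i) v * (exp (real i * v) + exp (- real i * v))"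
      using x[OF i] by (intro mult_left_mono) auto
    then show ?thesis using x[OF i] by (simp add: abs_mult distrib_left mult.assoc)
  qed
  have "(\<lambda>m. 2 * pi * x i * heat (x i) v * exp (d m * real i * v)) \<longlonglongrightarrow> 2 * pi * x i * heat (x i) v * exp (0 * real i * v)" for v
    by (intro tendsto_intros d(2))
  then show "(\<lambda>m. 2 * pi * x i * heat (x i) v * exp (d m * real i * v)) \<longlonglongrightarrow> 2 * pi * x i * heat (x i) v" for v by simp
qed measurable

text \<open>The individual words are not integrable, but their sum is bounded; shifting the points \<open>\<beta> j\<close> by
  \<open>\<delta> j\<close> into distinct half-planes makes each word integrable without changing the limit.\<close>
lemma word_sum_integral:
  fixes S :: "nat set"
  assumes S: "S \<subseteq> {1..n}" "S \<noteq> {}" and x: "\<And>i. i \<in> S \<Longrightarrow> x i > 0"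
  defines "N \<equiv> (\<lambda>f. node x (\<lambda>_. 0) f)"
  defines "G \<equiv> (\<lambda>s. s * (sum x S - s) / 2)"
  shows "(\<integral>f. gauss_prod x S f * word_sum (coupling x (N f)) (N f) S \<partial>lborel_PiM S)
     = of_real ((\<Prod>j\<in>S. 2 * pi * x j) * all_words G x 0 S 0)"
proof -
  have fS: "finite S" using S finite_subset by blast
  \<comment> \<open>Small enough that all shifts \<open>d m * j\<close> with \<open>j\<close> \<le>
    \<open>n\<close> stay in the open strip where the uniform bound \<open>C\<close> holds.\<close>
  define d where "d = (\<lambda>m. 1 / real (m + n + 1))"
  have d: "d m > 0" "\<bar>d m\<bar> \<le> 1" "j \<in> S \<Longrightarrow> \<bar>d m * real j\<bar> < 1" for m j
    using S by (auto simp: d_def)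
  have dlim: "d \<longlonglongrightarrow> 0" unfolding d_def
    using LIMSEQ_ignore_initial_segment[OF LIMSEQ_inverse_real_of_nat, of n] by (simp add: inverse_eq_divide add.commute)
  define D where "D = (\<lambda>m f. node x (\<lambda>j. d m * real j) f)"
  obtain C where C: "\<And>\<beta>. inj_on \<beta> S \<Longrightarrow> (\<And>j. j \<in> S \<Longrightarrow> \<bar>Re (\<beta> j)\<bar> < 1) \<Longrightarrow>
     norm (word_sum (coupling x \<beta>) \<beta> S) \<le> C"
    using word_sum_bounded[OF S(1)] by blast
  have inj: "inj_on (D m f) S" for m f
  proof (rule inj_onI)
    fix i j assume "D m f i = D m f j"
    then have "Re (D m f i) = Re (D m f j)" by simp
    then show "i = j" using d(1)[of m] by (simp add: D_def)
  qed
  let ?F = "\<lambda>m f. gauss_prod x S f * word_sum (coupling x (D m f)) (D m f) S"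
  have lim: "AE f in lborel_PiM S. (\<lambda>m. ?F m f) \<longlonglongrightarrow> gauss_prod x S f * word_sum (coupling x (N f)) (N f) S"
  proof -
    have "AE f in lborel_PiM S. inj_on (node x (\<lambda>_. 0) f) S"
      by (rule AE_inj_on_node[OF fS x])
    then show ?thesis
    proof eventually_elim
    case (elim f)
    have "(\<lambda>m. D m f i) \<longlonglongrightarrow> \<i> * of_real (f i) / of_real (x i) + of_real (0 * real i)" for i
      unfolding D_def node_def by (intro tendsto_intros dlim)
    then have "(\<lambda>m. D m f i) \<longlonglongrightarrow> N f i" for i by (simp add: N_def node_def)
    then show ?case
      using elim by (intro tendsto_mult tendsto_const tendsto_word_sum fS) (auto simp: N_def)
    qed
  qed
  have int: "integrable (lborel_PiM S) (?F m)" for m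
    unfolding D_def by (rule word_sum_integral_shifted(1)[OF fS S(2) x d(1)])
  have gi: "integrable (lborel_PiM S) (gauss_prod x S)" using fS x by (rule gauss_prod_integrable)
  have meas: "(\<lambda>f. gauss_prod x S f * word_sum (coupling x (N f)) (N f) S) \<in> borel_measurable (lborel_PiM S)"
  proof -
    have "(\<lambda>f. chain (N f) G' x 0 k ks) \<in> borel_measurable (lborel_PiM S)"
      if "k \<in> S" "ks \<in> permutations_of_set (S - {k})" for k ks G'
      unfolding N_def using that by (intro chain_measurable) (auto simp: permutations_of_set_def)
    then show ?thesis
      unfolding word_sum_eq_chain[OF fS S(2)]
      by (intro borel_measurable_times borel_measurable_integrable[OF gi] borel_measurable_sum)
  qed
  have "(\<lambda>m. \<integral>f. ?F m f \<partial>lborel_PiM S) \<longlonglongrightarrow>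
      (\<integral>f. gauss_prod x S f * word_sum (coupling x (N f)) (N f) S \<partial>lborel_PiM S)"
  proof (rule integral_dominated_convergence[OF meas _ _ lim])
    show "?F m \<in> borel_measurable (lborel_PiM S)" for m using int by auto
    show "integrable (lborel_PiM S) (\<lambda>f. norm (gauss_prod x S f) * C)" using gi by simp
    show "AE f in lborel_PiM S. norm (?F m f) \<le> norm (gauss_prod x S f) * C" for m
    proof (intro AE_I2)
      fix f
      have "norm (word_sum (coupling x (D m f)) (D m f) S) \<le> C"
        using inj d(3) by (intro C) (auto simp: D_def)
      then show "norm (?F m f) \<le> norm (gauss_prod x S f) * C"
        unfolding norm_mult by (intro mult_left_mono) auto
    qed
  qed
  moreover have "(\<lambda>m. \<integral>f. ?F m f \<partial>lborel_PiM S) \<longlonglongrightarrow>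
     of_real (\<Sum>k\<in>S. \<Sum>ks\<in>permutations_of_set (S - {k}). bridge (\<lambda>i v. 2 * pi * x i * heat (x i) v) (<) G x 0 k ks 0)"
  proof -
    have "(\<integral>f. ?F m f \<partial>lborel_PiM S) = of_real (\<Sum>k\<in>S. \<Sum>ks\<in>permutations_of_set (S - {k}).
         bridge (tilted x (\<lambda>i. d m * real i)) (<) G x 0 k ks 0)" for m
      unfolding D_def G_def by (rule word_sum_integral_shifted(2)[OF fS S(2) x d(1)])
    then show ?thesis
      by (simp only:) (intro tendsto_of_real tendsto_sum tilted_bridge_tendsto d(2) dlim,
         use x in \<open>auto simp: permutations_of_set_def\<close>)
  qed
  ultimately have "(\<integral>f. gauss_prod x S f * word_sum (coupling x (N f)) (N f) S \<partial>lborel_PiM S)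
    = of_real (\<Sum>k\<in>S. \<Sum>ks\<in>permutations_of_set (S - {k}). bridge (\<lambda>i v. 2 * pi * x i * heat (x i) v) (<) G x 0 k ks 0)"
    by (rule LIMSEQ_unique)
  also have "(\<Sum>k\<in>S. \<Sum>ks\<in>permutations_of_set (S - {k}). bridge (\<lambda>i v. 2 * pi * x i * heat (x i) v) (<) G x 0 k ks 0)
    = (\<Sum>k\<in>S. \<Sum>ks\<in>permutations_of_set (S - {k}). (\<Prod>j\<in>S. 2 * pi * x j) * word_bridge G x 0 (x k) k ks 0)"
  proof (intro sum.cong refl)
    fix k ks assume k: "k \<in> S" "ks \<in> permutations_of_set (S - {k})"
    have "(\<Prod>i\<leftarrow>k # ks. 2 * pi * x i) = (\<Prod>j\<in>set (k # ks). 2 * pi * x j)"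
      using k by (intro prod.distinct_set_conv_list[symmetric]) (auto simp: permutations_of_set_def)
    also have "set (k # ks) = S" using k by (auto simp: permutations_of_set_def)
    finally show "bridge (\<lambda>i v. 2 * pi * x i * heat (x i) v) (<) G x 0 k ks 0 = (\<Prod>j\<in>S. 2 * pi * x j) * word_bridge G x 0 (x k) k ks 0"
      unfolding bridge_scale word_bridge_eq_bridge by simp
  qed
  also have "\<dots> = (\<Prod>j\<in>S. 2 * pi * x j) * all_words G x 0 S 0"
    unfolding all_words_def words_from_def by (simp only: sum_distrib_left)
  finally show ?thesis .
qed

lemma Pn_measurable:
  "(\<lambda>a. Pn n (\<lambda>j. \<i> * complex_of_real (a j)) x) \<in> borel_measurable (lborel_PiM {1..n})"
proof (cases "n = 1")
  case True
  then show ?thesis by (simp add: Pn_def)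
next
  case False
  have z: "zeta \<in> borel_measurable borel" unfolding zeta_def[abs_def] by measurable
  have m: "(\<lambda>a. \<i> * complex_of_real (a (\<tau> j))) \<in> borel_measurable (lborel_PiM {1..n})"
    if "\<tau> \<in> {\<tau>. \<tau> permutes {1..n} \<and> \<tau> 1 = 1}" "j \<in> {1..n}" for \<tau> j
  proof -
    have "\<tau> permutes {1..n}" using that(1) by simp
    from permutes_in_image[OF this, of j] have "\<tau> j \<in> {1..n}" using that(2) by simp
    then show ?thesis by measurable
  qed
  show ?thesis
    unfolding Pn_def if_not_P[OF False]
  proof (rule borel_measurable_sum)
    fix \<tau> assume t: "\<tau> \<in> {\<tau>. \<tau> permutes {1..n} \<and> \<tau> 1 = 1}"
    have m1: "(\<lambda>a. \<i> * complex_of_real (a (\<tau> j)) * c) \<in> borel_measurable (lborel_PiM {1..n})"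
      if "j \<in> {1..n}" for j c
      by (intro borel_measurable_times borel_measurable_const m[OF t that])
    have m2: "(\<lambda>a. (\<Sum>k=1..j. \<i> * complex_of_real (a (\<tau> k))) * c) \<in> borel_measurable (lborel_PiM {1..n})"
      if "j \<in> {1..n}" for j c
      using that by (intro borel_measurable_times borel_measurable_const borel_measurable_sum m[OF t]) auto
    show "(\<lambda>a. (\<Prod>j=2..n-1. complex_of_real (x (\<tau> j))) *
         (\<Prod>j=1..n-1. zeta ((\<Sum>k=1..j. \<i> * complex_of_real (a (\<tau> k))) * complex_of_real (x (\<tau> (j+1)))
                             - \<i> * complex_of_real (a (\<tau> (j+1))) * complex_of_real (\<Sum>k=1..j. x (\<tau> k))))
        / (\<Prod>j=1..n-1. \<i> * complex_of_real (a (\<tau> j)) * complex_of_real (x (\<tau> (j+1)))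
                        - \<i> * complex_of_real (a (\<tau> (j+1))) * complex_of_real (x (\<tau> j))))
        \<in> borel_measurable (lborel_PiM {1..n})"
    proof (rule borel_measurable_divide[OF borel_measurable_times[OF borel_measurable_const]])
      show "(\<lambda>a. \<Prod>j=1..n-1. zeta ((\<Sum>k=1..j. \<i> * complex_of_real (a (\<tau> k))) * complex_of_real (x (\<tau> (j+1)))
                             - \<i> * complex_of_real (a (\<tau> (j+1))) * complex_of_real (\<Sum>k=1..j. x (\<tau> k))))
        \<in> borel_measurable (lborel_PiM {1..n})"
        by (rule borel_measurable_prod, rule measurable_compose[OF _ z], rule borel_measurable_diff[OF m2 m1]) auto
      show "(\<lambda>a. \<Prod>j=1..n-1. \<i> * complex_of_real (a (\<tau> j)) * complex_of_real (x (\<tau> (j+1)))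
                        - \<i> * complex_of_real (a (\<tau> (j+1))) * complex_of_real (x (\<tau> j)))
        \<in> borel_measurable (lborel_PiM {1..n})"
        by (rule borel_measurable_prod, rule borel_measurable_diff[OF m1 m1]) auto
    qed
  qed
qed

lemma F_Bur_eq_partition_sum:
  assumes n: "n \<ge> 1" and x: "\<And>j. j \<in> {1..n} \<Longrightarrow> x j > 0"
  defines "X \<equiv> \<Sum>j=1..n. x j"
  shows "F_Bur n x = of_real ((2 * pi) powr (real n / 2) / (\<Prod>j=1..n. sqrt (x j)) * (exp (X ^ 3 / 24) / X)
     * (\<Sum>Is\<in>ordered_partitions {1..n}. block_bridge (\<lambda>s. s * (X - s) / 2) x 0 Is 0))"
proof -
  let ?S = "{1..n}" and ?G = "\<lambda>s. s * (X - s) / 2"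
  have S: "finite ?S" "?S \<noteq> {}" using n by auto
  let ?N = "\<lambda>f. node x (\<lambda>_. 0) f"
  have "(\<integral>a. complex_of_real (\<Prod>j=1..n. exp (- ((a j) ^ 2) / (2 * x j))) * Pn n (\<lambda>j. \<i> * complex_of_real (a j)) x \<partial>lborel_PiM ?S)
     = (\<integral>a. gauss_prod x ?S a * word_sum (coupling x (?N a)) (?N a) ?S / of_real (\<Prod>j=1..n. x j) \<partial>lborel_PiM ?S)"
  proof -
    \<comment> \<open>The identity for \<open>Pn\<close> needs distinct points, which fails only on
      a null set.\<close>
    have "AE a in lborel_PiM ?S. complex_of_real (\<Prod>j=1..n. exp (- ((a j) ^ 2) / (2 * x j))) * Pn n (\<lambda>j. \<i> * complex_of_real (a j)) x
      = gauss_prod x ?S a * word_sum (coupling x (?N a)) (?N a) ?S / of_real (\<Prod>j=1..n. x j)"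
    proof -
      have "AE a in lborel_PiM ?S. inj_on (?N a) ?S"
        by (rule AE_inj_on_node[OF S(1) x])
      then show ?thesis
      proof eventually_elim
      case (elim a)
      have "Pn n (\<lambda>j. \<i> * complex_of_real (a j)) x = word_sum (coupling x (?N a)) (?N a) ?S / of_real (\<Prod>j=1..n. x j)"
        using elim by (intro Pn_eq_word_sum n x) (auto simp: node_def)
      then show ?case by (simp add: gauss_prod_def)
      qed
    qed
    moreover have "(\<lambda>a. complex_of_real (\<Prod>j=1..n. exp (- ((a j) ^ 2) / (2 * x j))) * Pn n (\<lambda>j. \<i> * complex_of_real (a j)) x)
       \<in> borel_measurable (lborel_PiM ?S)"
    proof -
      have "(\<lambda>a. complex_of_real (\<Prod>j=1..n. exp (- ((a j) ^ 2) / (2 * x j)))) = gauss_prod x ?S"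
        by (simp add: fun_eq_iff gauss_prod_def)
      then show ?thesis
        using borel_measurable_integrable[OF gauss_prod_integrable[OF S(1) x]] Pn_measurable[of n x]
        by (auto intro: borel_measurable_times)
    qed
    moreover have "(\<lambda>a. gauss_prod x ?S a * word_sum (coupling x (?N a)) (?N a) ?S / of_real (\<Prod>j=1..n. x j))
       \<in> borel_measurable (lborel_PiM ?S)"
    proof -
      have "(\<lambda>f. chain (?N f) G' x 0 k ks) \<in> borel_measurable (lborel_PiM ?S)"
        if "k \<in> ?S" "ks \<in> permutations_of_set (?S - {k})" for k ks G'
        using that by (intro chain_measurable) (auto simp: permutations_of_set_def)
      then show ?thesis
        unfolding word_sum_eq_chain[OF S]
        by (intro borel_measurable_times borel_measurable_divide borel_measurable_const
            borel_measurable_integrable[OF gauss_prod_integrable[OF S(1) x]] borel_measurable_sum)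
    qed
    ultimately show ?thesis by (intro integral_cong_AE)
  qed
  also have "\<dots> = of_real ((\<Prod>j=1..n. 2 * pi * x j) * all_words ?G x 0 ?S 0) / of_real (\<Prod>j=1..n. x j)"
    using word_sum_integral[OF order.refl S(2) x] by (simp add: X_def)
  also have "\<dots> = of_real ((2 * pi) ^ n * all_words ?G x 0 ?S 0)"
  proof -
    have "(\<Prod>j=1..n. x j) \<noteq> 0" using x by (simp add: less_imp_neq[symmetric])
    moreover have "(\<Prod>j=1..n. 2 * pi * x j) = (2 * pi) ^ n * (\<Prod>j=1..n. x j)" by (simp add: prod.distrib)
    ultimately have "(\<Prod>j=1..n. 2 * pi * x j) * all_words ?G x 0 ?S 0 / (\<Prod>j=1..n. x j) = (2 * pi) ^ n * all_words ?G x 0 ?S 0"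
      by (simp only: nonzero_mult_div_cancel_left mult.assoc mult.left_commute[of "(2 * pi) ^ n"] not_False_eq_True)
    then show ?thesis by (simp only: of_real_divide[symmetric])
  qed
  finally have I: "(\<integral>a. complex_of_real (\<Prod>j=1..n. exp (- ((a j) ^ 2) / (2 * x j))) * Pn n (\<lambda>j. \<i> * complex_of_real (a j)) x \<partial>lborel_PiM ?S)
     = of_real ((2 * pi) ^ n * all_words ?G x 0 ?S 0)" .
  have A: "all_words ?G x 0 ?S 0 = (\<Sum>Is\<in>ordered_partitions {1..n}. block_bridge ?G x 0 Is 0)"
    by (rule all_words_eq_partitions[OF S x])
  have pi: "(\<Prod>j=1..n. sqrt (2 * pi * x j)) = (2 * pi) powr (real n / 2) * (\<Prod>j=1..n. sqrt (x j))"
  proof -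
    have "(\<Prod>j=1..n. sqrt (2 * pi * x j)) = sqrt (2 * pi) ^ n * (\<Prod>j=1..n. sqrt (x j))"
      by (simp add: real_sqrt_mult prod.distrib)
    also have "sqrt (2 * pi) ^ n = (2 * pi) powr (real n / 2)"
      by (simp add: powr_half_sqrt[symmetric] powr_realpow[symmetric] powr_powr)
    finally show ?thesis .
  qed
  \<comment> \<open>One half cancels the square roots in the definition of \<open>F_Bur\<close>; the
    other is the prefactor of the result.\<close>
  have pn: "(2 * pi) ^ n = (2 * pi) powr (real n / 2) * (2 * pi) powr (real n / 2)"
    unfolding powr_add[symmetric] by (simp add: powr_realpow del: powr_mult)
  show ?thesis
    unfolding F_Bur_def I A[symmetric] of_real_mult[symmetric] pi pn X_def[symmetric]
    by (simp add: mult_ac)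
qed

section \<open>Cyclic integrals\<close>

text \<open>\<open>r\<close> assigns to every index of the list the midpoint of its interval when intervals of lengths
  \<open>X\<close> are laid end to end from \<open>S\<close>, measured from the centre \<open>T/2\<close>.\<close>
fun midpoints :: "real \<Rightarrow> ('a \<Rightarrow> real) \<Rightarrow> ('a \<Rightarrow> real) \<Rightarrow> real \<Rightarrow> 'a \<Rightarrow> 'a list \<Rightarrow> bool" where
  "midpoints T r X S j [] \<longleftrightarrow> r j = S + X j / 2 - T / 2"
| "midpoints T r X S j (k # ks) \<longleftrightarrow> r j = S + X j / 2 - T / 2 \<and> midpoints T r X (S + X j) k ks"

lemma midpoints_head: "midpoints T r X S j ks \<Longrightarrow> r j = S + X j / 2 - T / 2"
  by (cases ks) auto

lemma midpoints_cong:
  "(\<And>i. i \<in> set (j # ks) \<Longrightarrow> r i = r' i) \<Longrightarrow> midpoints T r X S j ks = midpoints T r' X S j ks"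
  by (induction ks arbitrary: j S) auto

lemma midpoints_exist: "distinct (j # ks) \<Longrightarrow> \<exists>r. midpoints T r X S j ks"
proof (induction ks arbitrary: j S)
  case Nil
  show ?case by (intro exI[of _ "\<lambda>_. S + X j / 2 - T / 2"]) simp
next
  case (Cons k ks)
  then obtain r where r: "midpoints T r X (S + X j) k ks" by (metis distinct.simps(2))
  let ?r = "r(j := S + X j / 2 - T / 2)"
  have "midpoints T ?r X (S + X j) k ks = midpoints T r X (S + X j) k ks"
    using Cons.prems by (intro midpoints_cong) auto
  then have "midpoints T ?r X (S + X j) k ks" using r by simp
  moreover have "?r j = S + X j / 2 - T / 2" by simp
  ultimately show ?case unfolding midpoints.simps by (intro exI[of _ ?r] conjI)
qed

lemma midpoints_increasing:
  assumes "midpoints T r X S j ks" "\<And>i. i \<in> set (j # ks) \<Longrightarrow> X i > 0"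
  shows "\<forall>i\<in>set ks. r j < r i"
  using assms
proof (induction ks arbitrary: j S)
  case (Cons k ks)
  have "X j > 0" "X k > 0" using Cons.prems by auto
  then have "r j < r k" using Cons.prems(1) midpoints_head[of T r X "S + X j" k ks] by simp
  moreover have "\<forall>i\<in>set ks. r k < r i" using Cons by auto
  ultimately show ?case by force
qed simp

lemma midpoints_inj_on:
  assumes "midpoints T r X S j ks" "\<And>i. i \<in> set (j # ks) \<Longrightarrow> X i > 0"
  shows "inj_on r (set (j # ks))"
  using assms
proof (induction ks arbitrary: j S)
  case (Cons k ks)
  have "inj_on r (set (k # ks))" using Cons by auto
  moreover have "\<forall>i\<in>set (k # ks). r j < r i" by (rule midpoints_increasing[OF Cons.prems])
  ultimately show ?case by (auto simp: inj_on_insert)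
qed simp

lemma heat_tilt:
  assumes "X > 0"
  shows "heat X v * exp (r * v) = exp (r\<^sup>2 * X / 2) * heat X (v - X * r)"
proof -
  have "- v\<^sup>2 / (2 * X) + r * v = r\<^sup>2 * X / 2 + - (v - X * r)\<^sup>2 / (2 * X)"
    using assms by (simp add: field_simps power2_eq_square)
  then have "exp (- v\<^sup>2 / (2 * X)) * exp (r * v) = exp (r\<^sup>2 * X / 2) * exp (- (v - X * r)\<^sup>2 / (2 * X))"
    by (simp only: exp_add[symmetric])
  then show ?thesis using assms by (simp add: heat_eq)
qed

text \<open>Completing the square and shifting each integration variable by \<open>G\<close> turns the tilted bridge
  with threshold 0 into the heat bridge with threshold \<open>G\<close>.\<close>
lemma bridge_midpoints:
  assumes "midpoints T r X S j ks" "\<And>i. i \<in> set (j # ks) \<Longrightarrow> X i > 0" "S + (\<Sum>i\<leftarrow>j # ks. X i) = T"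
  defines "G \<equiv> (\<lambda>s. s * (T - s) / 2)"
  shows "bridge (tilted X r) (\<lambda>i k. r i < r k) (\<lambda>_. 0) X S j ks u
    = (\<Prod>i\<leftarrow>j # ks. 2 * pi * X i) * exp (((T / 2) ^ 3 - (S - T / 2) ^ 3) / 6 - (\<Sum>i\<leftarrow>j # ks. X i ^ 3) / 24)
      * bridge (\<lambda>i. heat (X i)) (\<lambda>_ _. True) G X S j ks (u + G S)"
  using assms(1-3)
proof (induction ks arbitrary: j S u)
  case (Nil j S u)
  have X: "X j > 0" using Nil by auto
  have S: "S = T - X j" using Nil by simp
  have r: "r j = S + X j / 2 - T / 2" using Nil by simp
  have "- u - X j * r j = - (u + G S)" unfolding r G_def S by (simp add: field_simps)
  moreover have "(r j)\<^sup>2 * X j / 2 = ((T / 2) ^ 3 - (S - T / 2) ^ 3) / 6 - X j ^ 3 / 24"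
    unfolding r S by (simp add: field_simps power2_eq_square power3_eq_cube)
  ultimately have "heat (X j) (- u) * exp (r j * (- u)) = exp (((T / 2) ^ 3 - (S - T / 2) ^ 3) / 6 - X j ^ 3 / 24) * heat (X j) (- (u + G S))"
    using heat_tilt[OF X, of "- u" "r j"] by simp
  then show ?case by (simp del: minus_add_distrib)
next
  case (Cons k ks j S u)
  have X: "X j > 0" using Cons by auto
  have rj: "r j = S + X j / 2 - T / 2" and m: "midpoints T r X (S + X j) k ks" using Cons.prems by auto
  have asc: "r j < r k" using midpoints_increasing[OF Cons.prems(1,2)] by auto
  let ?S = "S + X j"
  define c where "c = (\<Prod>i\<leftarrow>k # ks. 2 * pi * X i)"
  define e where "e = ((T / 2) ^ 3 - (?S - T / 2) ^ 3) / 6 - (\<Sum>i\<leftarrow>k # ks. X i ^ 3) / 24"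
  define e' where "e' = (r j)\<^sup>2 * X j / 2"
  let ?B = "bridge (\<lambda>i. heat (X i)) (\<lambda>_ _. True) G X ?S k ks"
  have IH: "bridge (tilted X r) (\<lambda>i k. r i < r k) (\<lambda>_. 0) X ?S k ks t
      = c * exp e * ?B (t + G ?S)" for t
    unfolding c_def e_def using Cons.prems m by (intro Cons.IH) auto
  \<comment> \<open>The drift \<open>X j * r j\<close> caused by the tilt equals
    \<open>G S - G (S + X j)\<close>, so displacing the path by \<open>G\<close> absorbs it.\<close>
  have shift: "t - u - X j * r j = (t + G ?S) - (u + G S)" for t
    unfolding rj G_def by (simp add: field_simps)
  \<comment> \<open>For an interval of length \<open>X\<close> centred at \<open>r\<close>,
    \<open>r^2 * X / 2\<close> is \<open>((r + X/2)^3 - (r - X/2)^3) / 6 - X^3 / 24\<close>; the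
    cubes of the endpoints telescope along the list.\<close>
  have ee: "e' + e = ((T / 2) ^ 3 - (S - T / 2) ^ 3) / 6 - (\<Sum>i\<leftarrow>j # k # ks. X i ^ 3) / 24"
    unfolding e_def e'_def rj by (simp add: field_simps power2_eq_square power3_eq_cube)
  let ?Q = "\<lambda>t. (2 * pi * X j * c * exp (e' + e)) * (kappa True (G ?S) t * heat (X j) (t - (u + G S)) * ?B t)"
  have "bridge (tilted X r) (\<lambda>i k. r i < r k) (\<lambda>_. 0) X S j (k # ks) u
    = (\<integral>t. ?Q (G ?S + 1 * t) \<partial>lborel)"
    unfolding bridge.simps IH
  proof (intro Bochner_Integration.integral_cong refl)
    fix t
    have k: "kappa (r j < r k) 0 t = kappa True (G ?S) (t + G ?S)"
      using asc by (simp add: kappa_def indicator_def)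
    have h: "heat (X j) (t - u) * exp (r j * (t - u)) = exp e' * heat (X j) ((t + G ?S) - (u + G S))"
      unfolding e'_def shift[symmetric] by (rule heat_tilt[OF X])
    have "kappa (r j < r k) 0 t * (2 * pi * X j * heat (X j) (t - u) * exp (r j * (t - u))) * (c * exp e * ?B (t + G ?S))
      = kappa (r j < r k) 0 t * (2 * pi * X j * (heat (X j) (t - u) * exp (r j * (t - u)))) * (c * exp e * ?B (t + G ?S))"
      by (simp only: mult.assoc)
    also have "\<dots> = ?Q (t + G ?S)"
      unfolding h k exp_add by (simp only: mult_ac)
    finally show "kappa (r j < r k) 0 t * (2 * pi * X j * heat (X j) (t - u) * exp (r j * (t - u))) * (c * exp e * ?B (t + G ?S))
       = ?Q (G ?S + 1 * t)" by (simp only: mult_1 add.commute)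
  qed
  also have "\<dots> = (\<integral>t. ?Q t \<partial>lborel)"
  proof -
    have "(\<integral>t. ?Q t \<partial>lborel) = \<bar>1\<bar> *\<^sub>R (\<integral>t. ?Q (G ?S + 1 * t) \<partial>lborel)"
      by (rule lborel_integral_real_affine) simp
    then show ?thesis by (simp only: abs_one scaleR_one)
  qed
  also have "\<dots> = (2 * pi * X j * c * exp (e' + e)) * (\<integral>t. kappa True (G ?S) t * heat (X j) (t - (u + G S)) * ?B t \<partial>lborel)"
    by (rule integral_mult_right_zero)
  finally show ?case unfolding ee by (simp add: c_def)
qed

definition cyc_den :: "('a \<Rightarrow> real) \<Rightarrow> ('a \<Rightarrow> real) \<Rightarrow> 'a \<Rightarrow> 'a \<Rightarrow> complex" where
  "cyc_den X f j k = \<i> * of_real (f j / X j - f k / X k) - of_real ((X j + X k) / 2)"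

lemma cyc_den_nonzero: "X j > 0 \<Longrightarrow> X k > 0 \<Longrightarrow> cyc_den X f j k \<noteq> 0"
  by (simp add: cyc_den_def complex_eq_iff)

text \<open>Consecutive midpoints differ by half the sum of the two lengths, which is the real part
  of \<open>cyc_den\<close> up to sign. The real constants in the denominators are thus nothing but
  shifts of the points.\<close>

lemma chain_midpoints:
  assumes "midpoints T r X S j ks"
  shows "chain (node X r f) (\<lambda>_. 0) X S j ks = (\<Prod>p<length ks. 1 / cyc_den X f ((j # ks) ! p) ((j # ks) ! Suc p))"
  using assms
proof (induction ks arbitrary: j S)
  case (Cons k ks)
  have "r j - r k = - (X j + X k) / 2"
    using Cons.prems midpoints_head[of T r X "S + X j" k ks] by (simp add: field_simps)
  then have "node X r f j - node X r f k = cyc_den X f j k"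
    by (simp add: node_def cyc_den_def complex_eq_iff field_simps)
  then show ?case using Cons by (simp add: prod.lessThan_Suc_shift del: prod.lessThan_Suc)
qed simp

lemma rotate_upt_nth: "p < l \<Longrightarrow> rotate m [0..<l] ! p = (m + p) mod l"
  by (simp add: nth_rotate)

lemma bij_betw_add_mod: "bij_betw (\<lambda>p. (m + p) mod l) {..<l} {..<l::nat}"
proof -
  have "bij_betw ((!) (rotate m [0..<l])) {..<l} {..<l}"
    by (rule bij_betw_nth) auto
  then show ?thesis
    by (rule bij_betw_cong[THEN iffD1, rotated]) (simp add: rotate_upt_nth)
qed

text \<open>Each rotation omits exactly one denominator, so over the common denominator the
  numerator is the sum of all \<open>D\<close>. Around the cycle the imaginary parts cancel and the
  real parts add up to minus the total.\<close>

lemma cyclic_sum_of_chains: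
  fixes X f :: "nat \<Rightarrow> real"
  assumes l: "l \<ge> 1" and X: "\<And>j. j < l \<Longrightarrow> X j > 0"
  defines "D \<equiv> (\<lambda>j. cyc_den X f j ((j + 1) mod l))"
  shows "(\<Sum>m<l. \<Prod>p<l-1. 1 / D ((m + p) mod l)) = - of_real (\<Sum>j<l. X j) / (\<Prod>j<l. D j)"
proof -
  have D0: "D j \<noteq> 0" if "j < l" for j using that X l unfolding D_def by (intro cyc_den_nonzero) auto
  have P0: "(\<Prod>j<l. D j) \<noteq> 0" using D0 by simp
  have "(\<Prod>p<l-1. 1 / D ((m + p) mod l)) = D ((l - 1 + m) mod l) / (\<Prod>j<l. D j)" for m
  proof -
    have "(\<Prod>j<l. D j) = (\<Prod>p<l. D ((m + p) mod l))"
      by (rule prod.reindex_bij_betw[OF bij_betw_add_mod, symmetric])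
    also have "\<dots> = (\<Prod>p\<in>insert (l - 1) {..<l-1}. D ((m + p) mod l))"
      using l by (intro prod.cong refl) auto
    also have "\<dots> = D ((m + (l - 1)) mod l) * (\<Prod>p<l-1. D ((m + p) mod l))"
      by (rule prod.insert) auto
    finally have e: "(\<Prod>j<l. D j) = D ((l - 1 + m) mod l) * (\<Prod>p<l-1. D ((m + p) mod l))"
      by (subst add.commute[of "l - 1" m])
    have "D ((l - 1 + m) mod l) \<noteq> 0" using l by (intro D0) auto
    then show ?thesis unfolding e by (simp add: prod_dividef)
  qed
  then have "(\<Sum>m<l. \<Prod>p<l-1. 1 / D ((m + p) mod l)) = (\<Sum>m<l. D ((l - 1 + m) mod l)) / (\<Prod>j<l. D j)"
    by (simp add: sum_divide_distrib)
  also have "(\<Sum>m<l. D ((l - 1 + m) mod l)) = (\<Sum>j<l. D j)"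
    by (rule sum.reindex_bij_betw[OF bij_betw_add_mod])
  also have "\<dots> = - of_real (\<Sum>j<l. X j)"
  proof -
    have s: "(\<Sum>j<l. h ((j + 1) mod l)) = (\<Sum>j<l. h j)" for h :: "nat \<Rightarrow> real"
      using sum.reindex_bij_betw[OF bij_betw_add_mod[of 1 l], of h] by (simp only: add.commute)
    have "(\<Sum>j<l. D j) = \<i> * of_real ((\<Sum>j<l. f j / X j) - (\<Sum>j<l. f ((j + 1) mod l) / X ((j + 1) mod l)))
        - of_real (((\<Sum>j<l. X j) + (\<Sum>j<l. X ((j + 1) mod l))) / 2)"
      by (simp only: D_def cyc_den_def sum_subtractf sum_distrib_left[symmetric] of_real_sum[symmetric]
          sum_divide_distrib[symmetric] sum.distrib)
    also have "(\<Sum>j<l. f ((j + 1) mod l) / X ((j + 1) mod l)) = (\<Sum>j<l. f j / X j)" by (rule s)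
    also have "(\<Sum>j<l. X ((j + 1) mod l)) = (\<Sum>j<l. X j)" by (rule s)
    finally show ?thesis by simp
  qed
  finally show ?thesis .
qed

text \<open>The \<open>l\<close> denominators cannot all be differences of shifted points, since
  differences around a cycle add up to 0 and these add up to \<open>- T\<close>. Dropping one link
  removes the obstruction, and each rotation gets midpoints \<open>r m\<close> of its own. As
  midpoints increase, every link is an ascent, which matches the kernels of
  \<open>block_bridge\<close>.\<close>

lemma cyclic_integral:
  fixes X :: "nat \<Rightarrow> real"
  assumes l: "l \<ge> 1" and X: "\<And>j. j < l \<Longrightarrow> X j > 0"
  defines "T \<equiv> \<Sum>j<l. X j"
  shows "(\<integral>f. gauss_prod X {..<l} f / (\<Prod>j<l. cyc_den X f j ((j + 1) mod l)) \<partial>lborel_PiM {..<l})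
    = - of_real ((\<Prod>j<l. 2 * pi * X j) * exp (T ^ 3 / 24 - (\<Sum>j<l. X j ^ 3) / 24) / T *
       (\<Sum>m<l. bridge (\<lambda>i. heat (X i)) (\<lambda>_ _. True) (\<lambda>s. s * (T - s) / 2) X 0
          (hd (rotate m [0..<l])) (tl (rotate m [0..<l])) 0))"
proof -
  let ?M = "lborel_PiM {..<l}"
  define j where "j = (\<lambda>m. hd (rotate m [0..<l]))"
  define ks where "ks = (\<lambda>m. tl (rotate m [0..<l]))"
  have jk: "j m # ks m = rotate m [0..<l]" for m
    using l unfolding j_def ks_def by (intro list.collapse) auto
  have dist: "distinct (j m # ks m)" and set: "set (j m # ks m) = {..<l}" and len: "length (ks m) = l - 1" for m
    unfolding jk using arg_cong[OF jk[of m], of length] by auto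
  have "\<exists>r. midpoints T r X 0 (j m) (ks m)" for m by (rule midpoints_exist[OF dist])
  then obtain r where r: "\<And>m. midpoints T (r m) X 0 (j m) (ks m)" by metis
  have Xs: "X i > 0" if "i \<in> set (j m # ks m)" for i m using that X unfolding set by simp
  have im: "inj_on (r m) (set (j m # ks m))" for m by (rule midpoints_inj_on[OF r Xs])
  have T0: "T > 0" unfolding T_def using X l by (intro sum_pos) (auto simp: lessThan_empty_iff)
  have ch: "chain (node X (r m) f) (\<lambda>_. 0) X 0 (j m) (ks m) = (\<Prod>p<l-1. 1 / cyc_den X f ((m + p) mod l) (((m + p) mod l + 1) mod l))" for m f
    unfolding chain_midpoints[OF r] len
  proof (intro prod.cong refl)
    fix p assume p: "p \<in> {..<l-1}"
    have "(j m # ks m) ! p = (m + p) mod l" "(j m # ks m) ! Suc p = ((m + p) mod l + 1) mod l"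
      unfolding jk using p by (simp_all add: rotate_upt_nth mod_Suc_eq)
    then show "1 / cyc_den X f ((j m # ks m) ! p) ((j m # ks m) ! Suc p) = 1 / cyc_den X f ((m + p) mod l) (((m + p) mod l + 1) mod l)"
      by (simp only:)
  qed
  let ?c = "\<lambda>m f. gauss_prod X {..<l} f * exp (- of_real 0 * node X (r m) f (j m)) * chain (node X (r m) f) (\<lambda>_. 0) X 0 (j m) (ks m)"
  have "gauss_prod X {..<l} f / (\<Prod>j<l. cyc_den X f j ((j + 1) mod l)) = - (1 / of_real T) * (\<Sum>m<l. ?c m f)" for f
  proof -
    have "(\<Sum>m<l. ?c m f) = gauss_prod X {..<l} f * (\<Sum>m<l. \<Prod>p<l-1. 1 / cyc_den X f ((m + p) mod l) (((m + p) mod l + 1) mod l))"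
      unfolding ch sum_distrib_left by simp
    also have "\<dots> = gauss_prod X {..<l} f * (- of_real T / (\<Prod>j<l. cyc_den X f j ((j + 1) mod l)))"
      unfolding T_def using cyclic_sum_of_chains[OF l X, where f = f] by (simp only:)
    finally have "(\<Sum>m<l. ?c m f) = gauss_prod X {..<l} f * (- of_real T / (\<Prod>j<l. cyc_den X f j ((j + 1) mod l)))" .
    then show ?thesis using T0 by simp
  qed
  then have "(\<integral>f. gauss_prod X {..<l} f / (\<Prod>j<l. cyc_den X f j ((j + 1) mod l)) \<partial>?M)
    = - (1 / of_real T) * (\<integral>f. (\<Sum>m<l. ?c m f) \<partial>?M)"
    by (simp only: integral_mult_right_zero)
  also have "(\<integral>f. (\<Sum>m<l. ?c m f) \<partial>?M) = (\<Sum>m<l. \<integral>f. ?c m f \<partial>?M)"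
  proof (rule Bochner_Integration.integral_sum)
    fix m
    show "integrable ?M (?c m)"
      using chain_integrable[OF dist[of m] im[of m] Xs[of _ m], where u = 0 and G = "\<lambda>_. 0" and Y = X and S = 0]
      unfolding set .
  qed
  also have "\<dots> = (\<Sum>m<l. of_real ((\<Prod>j<l. 2 * pi * X j) * exp (T ^ 3 / 24 - (\<Sum>j<l. X j ^ 3) / 24) *
      bridge (\<lambda>i. heat (X i)) (\<lambda>_ _. True) (\<lambda>s. s * (T - s) / 2) X 0 (j m) (ks m) 0))"
  proof (intro sum.cong refl)
    fix m
    have L: "(\<Sum>i\<leftarrow>j m # ks m. h i) = (\<Sum>j<l. h j)" for h :: "nat \<Rightarrow> real"
      using sum_list_distinct_conv_sum_set[OF dist[of m], of h] unfolding set .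
    have LP: "(\<Prod>i\<leftarrow>j m # ks m. h i) = (\<Prod>j<l. h j)" for h :: "nat \<Rightarrow> real"
      using prod.distinct_set_conv_list[OF dist[of m], of h] unfolding set by simp
    have "(\<integral>f. ?c m f \<partial>?M) = of_real (bridge (tilted X (r m)) (\<lambda>i k. r m i < r m k) (\<lambda>_. 0) X 0 (j m) (ks m) 0)"
      using chain_integral[OF dist[of m] im[of m] Xs[of _ m], where u = 0 and G = "\<lambda>_. 0" and Y = X and S = 0]
      unfolding set .
    also have "bridge (tilted X (r m)) (\<lambda>i k. r m i < r m k) (\<lambda>_. 0) X 0 (j m) (ks m) 0
      = (\<Prod>i\<leftarrow>j m # ks m. 2 * pi * X i) * exp (((T / 2) ^ 3 - (0 - T / 2) ^ 3) / 6 - (\<Sum>i\<leftarrow>j m # ks m. X i ^ 3) / 24)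
      * bridge (\<lambda>i. heat (X i)) (\<lambda>_ _. True) (\<lambda>s. s * (T - s) / 2) X 0 (j m) (ks m) (0 + 0 * (T - 0) / 2)"
      by (rule bridge_midpoints[OF r Xs]) (simp_all only: L T_def add_0)
    also have "((T / 2) ^ 3 - (0 - T / 2) ^ 3) / 6 = T ^ 3 / 24" by (simp add: power3_eq_cube)
    finally show "(\<integral>f. ?c m f \<partial>?M) = of_real ((\<Prod>j<l. 2 * pi * X j) * exp (T ^ 3 / 24 - (\<Sum>j<l. X j ^ 3) / 24) *
      bridge (\<lambda>i. heat (X i)) (\<lambda>_ _. True) (\<lambda>s. s * (T - s) / 2) X 0 (j m) (ks m) 0)"
      unfolding L LP by simp
  qed
  finally show ?thesis
    unfolding j_def ks_def by (simp add: sum_distrib_left[symmetric] of_real_sum[symmetric] del: of_real_sum)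
qed

section \<open>Cyclically ordered partitions\<close>

lemma ordered_partitions_length:
  assumes "Is \<in> ordered_partitions R" "finite R"
  shows "length Is \<le> card R"
  using assms
proof (induction Is arbitrary: R)
  case (Cons I Js)
  then have "I \<noteq> {}" "I \<subseteq> R" by (auto simp: ordered_partitions_def)
  have "Js \<in> ordered_partitions (R - I)"
    using Cons.prems(1) by (auto simp: ordered_partitions_def disjnt_def)
  then have "length Js \<le> card (R - I)" using Cons by auto
  moreover have "card (R - I) < card R"
    using \<open>I \<noteq> {}\<close> \<open>I \<subseteq> R\<close> Cons.prems by (intro psubset_card_mono) auto
  ultimately show ?case by simp
qed simp

lemma ord_parts_eq: "ord_parts n l = {Is \<in> ordered_partitions {1..n}. length Is = l}"
proof -
  have A: "(\<forall>i<length Is. \<forall>j<length Is. i \<noteq> j \<longrightarrow> Is!i \<inter> Is!j = {}) \<longleftrightarrow> sorted_wrt disjnt Is" for Is :: "nat set list"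
    unfolding sorted_wrt_iff_nth_less disjnt_def
  proof (intro iffI allI impI)
    fix i j assume *: "\<forall>i j. i < j \<longrightarrow> j < length Is \<longrightarrow> Is ! i \<inter> Is ! j = {}"
      "i < length Is" "j < length Is" "i \<noteq> j"
    then show "Is ! i \<inter> Is ! j = {}"
      by (cases "i < j") (auto simp: Int_commute[of "Is ! i"])
  qed auto
  have B: "(\<forall>i<length Is. Is!i \<noteq> {}) \<longleftrightarrow> {} \<notin> set Is" for Is :: "nat set list"
    by (auto simp: in_set_conv_nth)
  show ?thesis
  proof (rule set_eqI)
    fix Is :: "nat set list"
    have "Is \<in> ord_parts n l \<longleftrightarrow> length Is = l \<and> (\<forall>i<length Is. Is!i \<noteq> {}) \<and>
        (\<forall>i<length Is. \<forall>j<length Is. i \<noteq> j \<longrightarrow> Is!i \<inter> Is!j = {}) \<and> \<Union>(set Is) = {1..n}"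
      unfolding ord_parts_def by (simp cong: conj_cong)
    then show "Is \<in> ord_parts n l \<longleftrightarrow> Is \<in> {Is \<in> ordered_partitions {1..n}. length Is = l}"
      unfolding A B ordered_partitions_def by (simp only: mem_Collect_eq conj_ac)
  qed
qed

lemma ord_parts_distinct:
  assumes "Is \<in> ord_parts n l"
  shows "distinct Is"
  unfolding distinct_conv_nth
proof (intro allI impI)
  fix i j assume ij: "i < length Is" "j < length Is" "i \<noteq> j"
  then have "Is ! i \<inter> Is ! j = {}" "Is ! i \<noteq> {}" using assms by (simp_all add: ord_parts_def)
  then show "Is ! i \<noteq> Is ! j" by auto
qed

lemma ord_parts_rotate:
  assumes "Is \<in> ord_parts n l"
  shows "rotate m Is \<in> ord_parts n l"
proof -
  have r: "rotate m Is ! i = Is ! ((m + i) mod l)" if "i < l" for i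
    using assms that by (auto simp: ord_parts_def nth_rotate)
  have b: "(m + i) mod l < l" "i \<noteq> j \<Longrightarrow> (m + i) mod l \<noteq> (m + j) mod l" if "i < l" "j < l" for i j
  proof -
    show "(m + i) mod l < l" using that by simp
    show "(m + i) mod l \<noteq> (m + j) mod l" if "i \<noteq> j"
      using inj_onD[OF bij_betw_imp_inj_on[OF bij_betw_add_mod[of m l]], of i j] that \<open>i < l\<close> \<open>j < l\<close> by blast
  qed
  have "length (rotate m Is) = l" "set (rotate m Is) = set Is"
    using assms by (simp_all add: ord_parts_def)
  moreover have "rotate m Is ! i \<noteq> {}" if "i < l" for i
    using assms b(1)[OF that that] unfolding r[OF that] by (simp add: ord_parts_def)
  moreover have "rotate m Is ! i \<inter> rotate m Is ! j = {}" if "i < l" "j < l" "i \<noteq> j" for i j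
    using assms b(1)[OF that(1,1)] b(1)[OF that(2,2)] b(2)[OF that] unfolding r[OF that(1)] r[OF that(2)]
    by (simp add: ord_parts_def)
  ultimately show ?thesis
    using assms unfolding ord_parts_def by simp
qed

lemma equiv_cyc_rel: "equiv (ord_parts n l) (cyc_rel n l)"
proof (rule equivI)
  show "cyc_rel n l \<subseteq> ord_parts n l \<times> ord_parts n l" by (auto simp: cyc_rel_def)
  show "refl_on (ord_parts n l) (cyc_rel n l)"
    by (auto simp: refl_on_def cyc_rel_def intro: exI[of _ 0])
  show "sym (cyc_rel n l)"
  proof (rule symI)
    fix p q assume pq: "(p, q) \<in> cyc_rel n l"
    then obtain k where k: "q = rotate k p" and len: "length p = l" by (auto simp: cyc_rel_def ord_parts_def)
    have "p = rotate (l - k mod l) q"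
    proof (cases "l = 0")
      case True
      then show ?thesis using k len by simp
    next
      case False
      have "rotate (l - k mod l) q = rotate (l - k mod l + k mod l) p"
        unfolding k using rotate_conv_mod[of k p] len by (simp add: rotate_rotate)
      also have "l - k mod l + k mod l = length p" using False len by (simp add: mod_less_divisor less_imp_le)
      finally show ?thesis by (simp add: rotate_id)
    qed
    then show "(q, p) \<in> cyc_rel n l" using pq unfolding cyc_rel_def by auto
  qed
  show "trans (cyc_rel n l)"
    by (rule transI) (auto simp: cyc_rel_def rotate_rotate)
qed

text \<open>Blocks of a partition are distinct, so no nontrivial rotation fixes it and a class has
  exactly \<open>l\<close> members.\<close>

lemma cyc_class:
  assumes "Is \<in> ord_parts n l" "l \<ge> 1"
  shows "cyc_rel n l `` {Is} = (\<lambda>m. rotate m Is) ` {..<l}" "inj_on (\<lambda>m. rotate m Is) {..<l}"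
proof -
  have len: "length Is = l" using assms by (simp add: ord_parts_def)
  show "cyc_rel n l `` {Is} = (\<lambda>m. rotate m Is) ` {..<l}"
  proof (intro equalityI subsetI)
    fix q assume "q \<in> cyc_rel n l `` {Is}"
    then obtain k where "q = rotate k Is" by (auto simp: cyc_rel_def)
    then have "q = rotate (k mod l) Is" using rotate_conv_mod[of k Is] len by simp
    then show "q \<in> (\<lambda>m. rotate m Is) ` {..<l}" using assms by simp
  next
    fix q assume "q \<in> (\<lambda>m. rotate m Is) ` {..<l}"
    then show "q \<in> cyc_rel n l `` {Is}" using assms ord_parts_rotate by (auto simp: cyc_rel_def)
  qed
  show "inj_on (\<lambda>m. rotate m Is) {..<l}"
  proof (rule inj_onI)
    fix a b assume ab: "a \<in> {..<l}" "b \<in> {..<l}" "rotate a Is = rotate b Is"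
    then have "rotate a Is ! 0 = rotate b Is ! 0" by simp
    then have "Is ! (a mod l) = Is ! (b mod l)" using len assms(2) by (simp add: nth_rotate)
    then show "a = b" using ab ord_parts_distinct[OF assms(1)] len by (simp add: nth_eq_iff_index_eq)
  qed
qed

text \<open>The exponential prefactor of \<open>cyc_term\<close> cancels the cubes of the block
  weights left by completing squares. Only \<open>exp (T^3/24) / T\<close> survives, the same for
  all partitions and equal to the factor in \<open>F_bur\<close>'s counterpart
  \<open>F_Bur_eq_partition_sum\<close>.\<close>

lemma cyc_term_eq:
  assumes "n \<ge> 1" "\<And>j. j \<in> {1..n} \<Longrightarrow> x j > 0" and Is: "Is \<in> ord_parts n l"
  defines "T \<equiv> \<Sum>j=1..n. x j"
  shows "- cyc_term x Is = of_real (exp (T ^ 3 / 24) / T * (\<Sum>m<l. block_bridge (\<lambda>s. s * (T - s) / 2) x 0 (rotate m Is) 0))"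
proof -
  define X where "X = (\<lambda>j. sum x (Is ! j))"
  have len: "length Is = l" using Is by (simp add: ord_parts_def)
  have un: "(\<Union>j<l. Is ! j) = {1..n}"
  proof -
    have "set Is = (!) Is ` {..<l}" by (auto simp: set_conv_nth len)
    then show ?thesis using Is by (simp add: ord_parts_def)
  qed
  then have l: "l \<ge> 1" using assms(1) by (cases "l = 0") auto
  have sub: "Is ! j \<subseteq> {1..n}" "Is ! j \<noteq> {}" if "j < l" for j using un that Is by (auto simp: ord_parts_def)
  have X: "X j > 0" if "j < l" for j
  proof -
    have "finite (Is ! j)" using sub(1)[OF that] finite_subset by blast
    then show ?thesis unfolding X_def using sub[OF that] assms(2) by (intro sum_pos) auto
  qed
  have T: "(\<Sum>j<l. X j) = T"
  proof -
    have "(\<Sum>j<l. X j) = sum x (\<Union>j<l. Is ! j)"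
      unfolding X_def
    proof (intro sum.UNION_disjoint[symmetric] ballI impI)
      show "finite (Is ! j)" if "j \<in> {..<l}" for j using sub(1)[of j] that finite_subset[of "Is ! j"] by simp
      show "Is ! i \<inter> Is ! j = {}" if "i \<in> {..<l}" "j \<in> {..<l}" "i \<noteq> j" for i j
        using Is that by (simp add: ord_parts_def)
    qed simp
    then show ?thesis by (simp add: un T_def)
  qed
  have bb: "bridge (\<lambda>i. heat (X i)) (\<lambda>_ _. True) (\<lambda>s. s * (T - s) / 2) X 0 (hd (rotate m [0..<l])) (tl (rotate m [0..<l])) 0
     = block_bridge (\<lambda>s. s * (T - s) / 2) x 0 (rotate m Is) 0" for m
  proof -
    have mp: "map ((!) Is) (rotate m [0..<l]) = rotate m Is"
      using map_nth[of Is] len by (simp add: rotate_map[symmetric])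
    have ne: "rotate m [0..<l] \<noteq> []" using l by simp
    have "hd (rotate m Is) = Is ! hd (rotate m [0..<l])" "tl (rotate m Is) = map ((!) Is) (tl (rotate m [0..<l]))"
      unfolding mp[symmetric] by (rule hd_map[OF ne], rule map_tl[symmetric])
    then show ?thesis
      unfolding block_bridge_def X_def
      using bridge_map[of "\<lambda>I. heat (sum x I)" "\<lambda>_ _. True" "\<lambda>s. s * (T - s) / 2" "sum x" 0 "(!) Is"] by simp
  qed
  have XX: "(\<lambda>j. xI x (Is ! j)) = X" by (simp add: X_def xI_def)
  define P where "P = (\<Prod>j<l. X j)"
  define K where "K = (\<Sum>m<l. block_bridge (\<lambda>s. s * (T - s) / 2) x 0 (rotate m Is) 0)"
  define Q where "Q = (\<Sum>j<l. X j ^ 3) / 24"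
  have P0: "P > 0" unfolding P_def using X by (intro prod_pos) auto
  have "cyc_term x Is = of_real (exp Q / (2 * pi) ^ l) *
      (\<integral>f. (1 / of_real P) * (gauss_prod X {..<l} f / (\<Prod>j<l. cyc_den X f j ((j + 1) mod l))) \<partial>lborel_PiM {..<l})"
    unfolding cyc_term_def Let_def len XX Q_def P_def
    by (simp add: prod_dividef gauss_prod_def cyc_den_def)
  also have "\<dots> = of_real (exp Q / (2 * pi) ^ l) * ((1 / of_real P) *
      - of_real ((\<Prod>j<l. 2 * pi * X j) * exp (T ^ 3 / 24 - Q) / T * K))"
  proof -
    have "(\<integral>f. gauss_prod X {..<l} f / (\<Prod>j<l. cyc_den X f j ((j + 1) mod l)) \<partial>lborel_PiM {..<l})
      = - of_real ((\<Prod>j<l. 2 * pi * X j) * exp (T ^ 3 / 24 - Q) / T * K)"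
      using cyclic_integral[where X = X, OF l X] by (simp only: T bb K_def Q_def)
    then show ?thesis by (simp only: integral_mult_right_zero)
  qed
  also have "(\<Prod>j<l. 2 * pi * X j) = (2 * pi) ^ l * P"
    unfolding P_def by (simp add: prod.distrib)
  also have "of_real (exp Q / (2 * pi) ^ l) * ((1 / of_real P) * - of_real ((2 * pi) ^ l * P * exp (T ^ 3 / 24 - Q) / T * K))
    = - complex_of_real ((exp Q / (2 * pi) ^ l) * ((1 / P) * ((2 * pi) ^ l * P * exp (T ^ 3 / 24 - Q) / T * K)))"
    by simp
  also have "(exp Q / (2 * pi) ^ l) * ((1 / P) * ((2 * pi) ^ l * P * exp (T ^ 3 / 24 - Q) / T * K)) = exp (T ^ 3 / 24) / T * K"
  proof -
    have "(exp Q / (2 * pi) ^ l) * ((1 / P) * ((2 * pi) ^ l * P * exp (T ^ 3 / 24 - Q) / T * K)) = (exp Q * exp (T ^ 3 / 24 - Q)) / T * K"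
      using P0 by simp
    also have "exp Q * exp (T ^ 3 / 24 - Q) = exp (T ^ 3 / 24)" by (simp add: exp_add[symmetric])
    finally show ?thesis .
  qed
  finally show ?thesis by (simp add: K_def)
qed

text \<open>The rotations of any representative run once through its class, so the choice made by
  \<open>SOME\<close> does not matter.\<close>

lemma sum_cyc_parts:
  fixes g :: "nat set list \<Rightarrow> real"
  assumes l: "l \<ge> 1" and F: "\<And>Is. Is \<in> ord_parts n l \<Longrightarrow> F Is = (\<Sum>m<l. g (rotate m Is))"
  shows "(\<Sum>C\<in>cyc_parts n l. F (SOME Is. Is \<in> C)) = (\<Sum>Is\<in>ord_parts n l. g Is)"
proof -
  have fin: "finite (ord_parts n l)"
    unfolding ord_parts_eq using finite_ordered_partitions[of "{1..n}"] by simp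
  have "F (SOME Is. Is \<in> C) = sum g C" if C: "C \<in> cyc_parts n l" for C
  proof -
    have C': "C \<in> ord_parts n l // cyc_rel n l" using C by (simp add: cyc_parts_def)
    obtain p where "p \<in> C" using in_quotient_imp_non_empty[OF equiv_cyc_rel C'] by blast
    then have s: "(SOME Is. Is \<in> C) \<in> C" by (rule someI)
    have so: "(SOME Is. Is \<in> C) \<in> ord_parts n l" using in_quotient_imp_subset[OF equiv_cyc_rel C'] s by blast
    have "C = cyc_rel n l `` {SOME Is. Is \<in> C}"
      using s so C' by (metis Image_singleton_iff equiv_class_eq equiv_cyc_rel quotientE)
    then have "sum g C = sum g ((\<lambda>m. rotate m (SOME Is. Is \<in> C)) ` {..<l})"
      using cyc_class(1)[OF so l] by simp
    also have "\<dots> = F (SOME Is. Is \<in> C)"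
      unfolding F[OF so] by (subst sum.reindex[OF cyc_class(2)[OF so l]]) simp
    finally show ?thesis ..
  qed
  then have "(\<Sum>C\<in>cyc_parts n l. F (SOME Is. Is \<in> C)) = (\<Sum>C\<in>cyc_parts n l. sum g C)" by simp
  also have "\<dots> = sum g (\<Union>(cyc_parts n l))"
    unfolding cyc_parts_def
  proof (rule sum.Union_disjoint[symmetric, unfolded o_def])
    show "\<forall>A\<in>ord_parts n l // cyc_rel n l. finite A"
      using finite_subset[OF in_quotient_imp_subset[OF equiv_cyc_rel] fin] by simp
    show "\<forall>A\<in>ord_parts n l // cyc_rel n l. \<forall>B\<in>ord_parts n l // cyc_rel n l. A \<noteq> B \<longrightarrow> A \<inter> B = {}"
    proof (intro ballI impI)
      fix A B assume "A \<in> ord_parts n l // cyc_rel n l" "B \<in> ord_parts n l // cyc_rel n l" "A \<noteq> B"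
      then show "A \<inter> B = {}" using quotient_disj[OF equiv_cyc_rel, of A n l B] by simp
    qed
  qed
  also have "\<Union>(cyc_parts n l) = ord_parts n l"
    unfolding cyc_parts_def by (rule Union_quotient[OF equiv_cyc_rel])
  finally show ?thesis .
qed

lemma F_Bur_eq_cyclic_sum:
  assumes n: "n \<ge> 1" and x: "\<And>j. j \<in> {1..n} \<Longrightarrow> x j > 0"
  shows "F_Bur n x = of_real ((2 * pi) powr (real n / 2) / (\<Prod>j=1..n. sqrt (x j)))
    * (\<Sum>l=1..n. \<Sum>C\<in>cyc_parts n l. - cyc_term x (SOME Is. Is \<in> C))"
proof -
  define T where "T = (\<Sum>j=1..n. x j)"
  define c where "c = exp (T ^ 3 / 24) / T"
  define b where "b = (\<lambda>Is. block_bridge (\<lambda>s. s * (T - s) / 2) x 0 Is 0)"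
  define F where "F = (\<lambda>Is. \<Sum>m<length Is. c * b (rotate m Is))"
  have t: "- cyc_term x Is = of_real (F Is)" if "Is \<in> ord_parts n l" for l Is
  proof -
    have "length Is = l" using that by (simp add: ord_parts_def)
    then show ?thesis
      using cyc_term_eq[OF n x that] by (simp add: F_def c_def b_def T_def sum_distrib_left)
  qed
  have r: "(SOME Is. Is \<in> C) \<in> ord_parts n l" if "C \<in> cyc_parts n l" for C l
  proof -
    have C': "C \<in> ord_parts n l // cyc_rel n l" using that by (simp add: cyc_parts_def)
    obtain p where "p \<in> C" using in_quotient_imp_non_empty[OF equiv_cyc_rel C'] by blast
    then have "(SOME Is. Is \<in> C) \<in> C" by (rule someI)
    then show ?thesis using in_quotient_imp_subset[OF equiv_cyc_rel C'] by blast
  qed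
  have "(\<Sum>l=1..n. \<Sum>C\<in>cyc_parts n l. - cyc_term x (SOME Is. Is \<in> C))
    = (\<Sum>l=1..n. \<Sum>C\<in>cyc_parts n l. of_real (F (SOME Is. Is \<in> C)))"
    by (intro sum.cong refl t r)
  also have "\<dots> = of_real (\<Sum>l=1..n. \<Sum>Is\<in>ord_parts n l. c * b Is)"
    unfolding of_real_sum
  proof (intro sum.cong refl)
    fix l assume "l \<in> {1..n}"
    then have l: "l \<ge> 1" by simp
    have "(\<Sum>C\<in>cyc_parts n l. F (SOME Is. Is \<in> C)) = (\<Sum>Is\<in>ord_parts n l. c * b Is)"
      by (rule sum_cyc_parts[OF l]) (simp add: F_def ord_parts_def)
    then show "(\<Sum>C\<in>cyc_parts n l. of_real (F (SOME Is. Is \<in> C))) = (\<Sum>Is\<in>ord_parts n l. complex_of_real (c * b Is))"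
      by (simp only: of_real_sum[symmetric])
  qed
  also have "(\<Sum>l=1..n. \<Sum>Is\<in>ord_parts n l. c * b Is) = (\<Sum>Is\<in>ordered_partitions {1..n}. c * b Is)"
  proof -
    have fin: "finite (ordered_partitions {1..n})" by (simp add: finite_ordered_partitions)
    have "1 \<le> length Is \<and> length Is \<le> n" if "Is \<in> ordered_partitions {1..n}" for Is
    proof -
      have "Is \<noteq> []" using that n by (auto simp: ordered_partitions_def)
      then have "1 \<le> length Is" by (cases Is) auto
      then show ?thesis using ordered_partitions_length[OF that] by simp
    qed
    then show ?thesis
      unfolding ord_parts_eq using fin by (intro sum.group) auto
  qed
  finally have s: "(\<Sum>l=1..n. \<Sum>C\<in>cyc_parts n l. - cyc_term x (SOME Is. Is \<in> C))
     = of_real (\<Sum>Is\<in>ordered_partitions {1..n}. c * b Is)" .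
  show ?thesis
    unfolding s of_real_mult[symmetric] sum_distrib_left[symmetric] c_def b_def T_def
    by (rule F_Bur_eq_partition_sum[OF n x, unfolded mult.assoc[of "_ / _" "_ / _"]])
qed

section \<open>The orthant integral\<close>

text \<open>Passing from the open to the closed half-line matches the orthant in
  \<open>E_fun\<close>; the scale \<open>c\<close> is kept free until it can be matched with the
  rescaled weights there.\<close>

lemma laplace_reciprocal:
  fixes D :: complex
  assumes "Re D < 0" "c > 0"
  shows "integrable lborel (\<lambda>s. of_real (indicator {0..} s) * exp (of_real (s * c) * D))"
    and "(CLBINT s. of_real (indicator {0..} s) * exp (of_real (s * c) * D)) = - 1 / (of_real c * D)"
proof -
  have D: "Re (of_real c * D) < 0" using assms by (simp add: mult_pos_neg)
  have ae: "AE s in lborel. indicator {0<..} s *\<^sub>R exp (of_real s * (of_real c * D)) = of_real (indicator {0..} s) * exp (of_real (s * c) * D)"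
    using AE_lborel_singleton[of "0::real"] by eventually_elim (auto simp: indicator_def mult.assoc)
  show "integrable lborel (\<lambda>s. of_real (indicator {0..} s) * exp (of_real (s * c) * D))"
    by (rule integrable_cong_AE_imp[OF complex_exp_tail(1)[OF D, of 0] _ ae]) measurable
  have "(CLBINT s. indicator {0<..} s *\<^sub>R exp (of_real s * (of_real c * D))) = (CLBINT s. of_real (indicator {0..} s) * exp (of_real (s * c) * D))"
    by (rule integral_cong_AE[OF _ _ ae]) measurable
  then show "(CLBINT s. of_real (indicator {0..} s) * exp (of_real (s * c) * D)) = - 1 / (of_real c * D)"
    using complex_exp_tail(2)[OF D, of 0] by simp
qed

lemma cyc_den_measurable:
  "j \<in> I \<Longrightarrow> k \<in> I \<Longrightarrow> (\<lambda>f. cyc_den X f j k) \<in> borel_measurable (lborel_PiM I)"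
  unfolding cyc_den_def by measurable

text \<open>Cyclic summation by parts: terms at the successor index are shifted back to
  \<open>j\<close>. The summand \<open>of_real 0\<close> keeps the shape of
  \<open>gaussian_fourier\<close> with \<open>r = 0\<close>.\<close>

lemma cyclic_exponent:
  fixes X f s :: "nat \<Rightarrow> real"
  assumes X: "\<And>j. j < l \<Longrightarrow> X j > 0"
  shows "(\<Sum>j<l. of_real (s ((j + 1) mod l) * c) * cyc_den X f j ((j + 1) mod l))
    = of_real (- (\<Sum>j<l. (s j + s ((j + 1) mod l)) * (c * X j) / 2))
      + (\<Sum>j<l. of_real (c * (s ((j + 1) mod l) - s j)) * (\<i> * of_real (f j) / of_real (X j) + of_real 0))"
proof -
  let ?n = "\<lambda>j. (j + 1) mod l"
  have shift: "(\<Sum>j<l. h (?n j)) = (\<Sum>j<l. h j)" for h :: "nat \<Rightarrow> real"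
    using sum.reindex_bij_betw[OF bij_betw_add_mod[of 1 l], of h] by (simp only: add.commute)
  have "Re (\<Sum>j<l. of_real (s (?n j) * c) * cyc_den X f j (?n j)) = (\<Sum>j<l. - (s (?n j) * c * X j / 2)) + (\<Sum>j<l. - (s (?n j) * c * X (?n j) / 2))"
    unfolding sum.distrib[symmetric] by (simp add: cyc_den_def algebra_simps add_divide_distrib)
  also have "(\<Sum>j<l. - (s (?n j) * c * X (?n j) / 2)) = (\<Sum>j<l. - (s j * c * X j / 2))" by (rule shift)
  finally have re: "Re (\<Sum>j<l. of_real (s (?n j) * c) * cyc_den X f j (?n j)) = - (\<Sum>j<l. (s j + s (?n j)) * (c * X j) / 2)"
    by (simp add: sum_negf[symmetric] sum.distrib[symmetric] algebra_simps add_divide_distrib)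
  have "Im (\<Sum>j<l. of_real (s (?n j) * c) * cyc_den X f j (?n j)) = (\<Sum>j<l. s (?n j) * c * (f j / X j)) - (\<Sum>j<l. s (?n j) * c * (f (?n j) / X (?n j)))"
    unfolding sum_subtractf[symmetric] by (simp add: cyc_den_def right_diff_distrib)
  also have "(\<Sum>j<l. s (?n j) * c * (f (?n j) / X (?n j))) = (\<Sum>j<l. s j * c * (f j / X j))" by (rule shift)
  finally have im: "Im (\<Sum>j<l. of_real (s (?n j) * c) * cyc_den X f j (?n j)) = (\<Sum>j<l. c * (s (?n j) - s j) * (f j / X j))"
    by (simp add: sum_subtractf[symmetric] algebra_simps diff_divide_distrib)
  show ?thesis
    using re im by (simp add: complex_eq_iff del: of_real_sum)
qed

text \<open>All \<open>l\<close> denominators have negative real part, so each gets its own Laplace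
  variable on the half-line and no link has to be dropped; the Gaussian variables then
  decouple.\<close>

lemma cyclic_integral_orthant:
  fixes X :: "nat \<Rightarrow> real"
  assumes l: "l \<ge> 1" and X: "\<And>j. j < l \<Longrightarrow> X j > 0" and c: "c > 0"
  shows "(\<integral>f. gauss_prod X {..<l} f / (\<Prod>j<l. cyc_den X f j ((j + 1) mod l)) \<partial>lborel_PiM {..<l})
    = of_real ((- c) ^ l * (\<integral>s. (\<Prod>j<l. indicator {0..} (s j)) * exp (- (\<Sum>j<l. (s j + s ((j + 1) mod l)) * (c * X j) / 2))
         * (\<Prod>j<l. 2 * pi * X j * heat (X j) (c * (s ((j + 1) mod l) - s j))) \<partial>lborel_PiM {..<l}))"
proof -
  let ?M = "lborel_PiM {..<l}"
  let ?n = "\<lambda>j. (j + 1) mod l"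
  \<comment> \<open>The cyclic predecessor. Attaching \<open>s k\<close> to the denominator between
    \<open>p k\<close> and \<open>k\<close> gives \<open>f j\<close> the coefficient
    \<open>s (j+1) - s j\<close>, the difference appearing in \<open>E_fun\<close>.\<close>
  define p where "p = (\<lambda>k. (k + (l - 1)) mod l)"
  have pl: "p k < l" for k using l by (simp add: p_def)
  have nl: "?n j < l" for j using l by simp
  have pn: "p (?n j) = j" if "j < l" for j
  proof -
    have "p (?n j) = (j + 1 + (l - 1)) mod l" unfolding p_def by (simp add: mod_simps)
    also have "\<dots> = j" using that by simp
    finally show ?thesis .
  qed
  have bij: "bij_betw ?n {..<l} {..<l}" using bij_betw_add_mod[of 1 l] by (simp add: add.commute)
  define D where "D = (\<lambda>f k. cyc_den X f (p k) k)"
  have D: "Re (D f k) = - (X (p k) + X k) / 2" for f k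
    unfolding D_def cyc_den_def by (simp add: add_divide_distrib)
  have Dneg: "Re (D f k) < 0" if "k < l" for f k
    using X[OF pl[of k]] X[OF that] by (simp add: D)
  define G where "G = (\<lambda>f s. gauss_prod X {..<l} f * (\<Prod>k<l. of_real (indicator {0..} (s k)) * exp (of_real (s k * c) * D f k)))"
  have step1: "gauss_prod X {..<l} f / (\<Prod>j<l. cyc_den X f j (?n j)) = (- of_real c) ^ l * (\<integral>s. G f s \<partial>?M)" for f
  proof -
    have "(\<integral>s. G f s \<partial>?M) = gauss_prod X {..<l} f *
        (\<Prod>k<l. CLBINT s. of_real (indicator {0..} s) * exp (of_real (s * c) * D f k))"
      unfolding G_def integral_mult_right_zero
    proof (subst lebesgue_product.product_integral_prod)
      show "complex_integrable lborel (\<lambda>s. of_real (indicator {0..} s) * exp (of_real (s * c) * D f k))" if "k \<in> {..<l}" for k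
        using that by (intro laplace_reciprocal(1) Dneg c) simp
    qed simp_all
    also have "(\<Prod>k<l. CLBINT s. of_real (indicator {0..} s) * exp (of_real (s * c) * D f k)) = (\<Prod>k<l. - 1 / (of_real c * D f k))"
      by (intro prod.cong refl laplace_reciprocal(2) Dneg c) simp
    also have "(\<Prod>k<l. - 1 / (of_real c * D f k)) = (\<Prod>j<l. - 1 / (of_real c * D f (?n j)))"
      by (rule prod.reindex_bij_betw[OF bij, symmetric])
    also have "\<dots> = (\<Prod>j<l. - 1 / (of_real c * cyc_den X f j (?n j)))"
      by (intro prod.cong refl) (simp add: D_def pn[simplified])
    also have "\<dots> = (- 1 / of_real c) ^ l / (\<Prod>j<l. cyc_den X f j (?n j))"
    proof -
      have "- 1 / (complex_of_real c * z) = (- 1 / of_real c) / z" for z by simp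
      then show ?thesis by (simp only: prod_dividef prod_constant card_lessThan power_divide)
    qed
    finally have e: "(\<integral>s. G f s \<partial>?M) = gauss_prod X {..<l} f * ((- 1 / of_real c) ^ l / (\<Prod>j<l. cyc_den X f j (?n j)))" .
    have "(- of_real c) ^ l * (- 1 / complex_of_real c) ^ l = 1"
      unfolding power_mult_distrib[symmetric] using c by simp
    then show ?thesis unfolding e by (simp add: mult.left_commute[of "(- of_real c) ^ l"] mult.assoc[symmetric])
  qed
  have nk: "norm (complex_of_real (indicator {0..} t) * exp (of_real (t * c) * D f k)) = indicator {0..} t * exp (- ((X (p k) + X k) / 2 * c) * t)" for t k f
  proof -
    have "Re (of_real (t * c) * D f k) = t * c * Re (D f k)" by simp
    also have "\<dots> = - ((X (p k) + X k) / 2 * c) * t" unfolding D by (simp add: field_simps)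
    finally show ?thesis
      by (simp only: norm_mult norm_exp_eq_Re norm_of_real) (simp add: indicator_def)
  qed
  \<comment> \<open>The real parts of the denominators do not involve \<open>f\<close>, so the
    modulus is a product of a function of \<open>f\<close> and functions of the single
    \<open>s k\<close>; this justifies exchanging the integrals.\<close>
  have Gnorm: "norm (G f s) = norm (gauss_prod X {..<l} f) * (\<Prod>k<l. indicator {0..} (s k) * exp (- ((X (p k) + X k) / 2 * c) * s k))" for f s
    unfolding G_def by (simp only: norm_mult[of "gauss_prod X {..<l} f"] prod_norm[symmetric] nk)
  have gi: "integrable ?M (gauss_prod X {..<l})" by (rule gauss_prod_integrable) (use X in auto)
  have Gint: "integrable (?M \<Otimes>\<^sub>M ?M) (\<lambda>(f, s). G f s)"
  proof -
    interpret fp: finite_product_sigma_finite "\<lambda>_. lborel :: real measure" "{..<l}" by standard auto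
    interpret pq: pair_sigma_finite ?M ?M by standard
    show ?thesis
    proof (rule pq.integrable_tensor_bound)
      show "(\<lambda>(f, s). G f s) \<in> borel_measurable (?M \<Otimes>\<^sub>M ?M)"
      proof -
        have g: "(\<lambda>q. gauss_prod X {..<l} (fst q)) \<in> borel_measurable (?M \<Otimes>\<^sub>M ?M)"
          using borel_measurable_integrable[OF gi] by (rule measurable_compose[OF measurable_fst])
        have d: "(\<lambda>q. D (fst q) k) \<in> borel_measurable (?M \<Otimes>\<^sub>M ?M)" if "k < l" for k
          unfolding D_def using that pl[of k]
          by (intro measurable_compose[OF measurable_fst cyc_den_measurable]) auto
        have s: "(\<lambda>q. snd q k) \<in> borel_measurable (?M \<Otimes>\<^sub>M ?M)" if "k < l" for k
        proof -
          have "k \<in> {..<l}" using that by simp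
          then have "(\<lambda>s. s k) \<in> borel_measurable ?M" by measurable
          then show ?thesis by (rule measurable_compose[OF measurable_snd])
        qed
        have e: "(\<lambda>q. complex_of_real (indicator {0..} (snd q k)) * exp (of_real (snd q k * c) * D (fst q) k)) \<in> borel_measurable (?M \<Otimes>\<^sub>M ?M)"
          if "k < l" for k
        proof -
          note [measurable] = d[OF that] s[OF that]
          show ?thesis by measurable
        qed
        have "(\<lambda>q. gauss_prod X {..<l} (fst q) * (\<Prod>k<l. of_real (indicator {0..} (snd q k)) * exp (of_real (snd q k * c) * D (fst q) k))) \<in> borel_measurable (?M \<Otimes>\<^sub>M ?M)"
          by (rule borel_measurable_times[OF g], rule borel_measurable_prod, rule e) simp
        then show ?thesis by (simp add: G_def split_def)
      qed
      show "integrable ?M (\<lambda>f. norm (gauss_prod X {..<l} f))" using gi by simp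
      show "integrable ?M (\<lambda>s. \<Prod>k<l. indicator {0..} (s k) * exp (- ((X (p k) + X k) / 2 * c) * s k))"
      proof (rule lebesgue_product.product_integrable_prod)
        fix k assume "k \<in> {..<l}"
        then have "integrable lborel (\<lambda>t. norm (complex_of_real (indicator {0..} t) * exp (of_real (t * c) * D (\<lambda>_. 0) k)))"
          by (intro integrable_norm laplace_reciprocal(1) Dneg c) simp
        then show "integrable lborel (\<lambda>s. indicator {0..} s * exp (- ((X (p k) + X k) / 2 * c) * s))"
          unfolding nk .
      qed simp
      show "norm (case (f, s) of (f, s) \<Rightarrow> G f s) \<le> norm (gauss_prod X {..<l} f) * (\<Prod>k<l. indicator {0..} (s k) * exp (- ((X (p k) + X k) / 2 * c) * s k))" for f s
        by (simp add: Gnorm)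
    qed
  qed
  have step3: "(\<integral>f. G f s \<partial>?M) = of_real ((\<Prod>j<l. indicator {0..} (s j)) * exp (- (\<Sum>j<l. (s j + s (?n j)) * (c * X j) / 2))
         * (\<Prod>j<l. 2 * pi * X j * heat (X j) (c * (s (?n j) - s j))))" for s
  proof -
    define A where "A = - (\<Sum>j<l. (s j + s (?n j)) * (c * X j) / 2)"
    define h where "h = (\<lambda>j a. complex_of_real (exp (- a\<^sup>2 / (2 * X j))) * exp (of_real (c * (s (?n j) - s j)) * (\<i> * of_real a / of_real (X j) + of_real 0)))"
    have "G f s = of_real ((\<Prod>j<l. indicator {0..} (s j)) * exp A) * (\<Prod>j<l. h j (f j))" for f
    proof -
      have "(\<Prod>k<l. exp (of_real (s k * c) * D f k)) = exp (\<Sum>k<l. of_real (s k * c) * D f k)"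
        by (simp add: exp_sum)
      also have "(\<Sum>k<l. of_real (s k * c) * D f k) = (\<Sum>j<l. of_real (s (?n j) * c) * D f (?n j))"
        by (rule sum.reindex_bij_betw[OF bij, symmetric])
      also have "\<dots> = (\<Sum>j<l. of_real (s (?n j) * c) * cyc_den X f j (?n j))"
        by (intro sum.cong refl) (simp add: D_def pn[simplified])
      also have "\<dots> = of_real A + (\<Sum>j<l. of_real (c * (s (?n j) - s j)) * (\<i> * of_real (f j) / of_real (X j) + of_real 0))"
        unfolding A_def by (rule cyclic_exponent[OF X])
      finally have "(\<Prod>k<l. exp (of_real (s k * c) * D f k)) = of_real (exp A) * (\<Prod>j<l. exp (of_real (c * (s (?n j) - s j)) * (\<i> * of_real (f j) / of_real (X j) + of_real 0)))"
        by (simp only: exp_add exp_sum[OF finite_lessThan] exp_of_real)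
      then show ?thesis
        unfolding G_def gauss_prod_def h_def prod.distrib by (simp only: of_real_mult of_real_prod mult_ac)
    qed
    then have "(\<integral>f. G f s \<partial>?M) = of_real ((\<Prod>j<l. indicator {0..} (s j)) * exp A) * (\<integral>f. (\<Prod>j<l. h j (f j)) \<partial>?M)"
      by (simp only: integral_mult_right_zero)
    also have "(\<integral>f. (\<Prod>j<l. h j (f j)) \<partial>?M) = (\<Prod>j<l. integral\<^sup>L lborel (h j))"
    proof (rule lebesgue_product.product_integral_prod)
      fix j assume j: "j \<in> {..<l}"
      show "integrable lborel (h j)"
      proof (rule Bochner_Integration.integrable_bound)
        show "integrable lborel (\<lambda>a. exp (- a\<^sup>2 / (2 * X j)))" using X j by (intro gaussian_integrable) auto
      qed (auto simp: h_def norm_mult)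
    qed simp
    also have "\<dots> = (\<Prod>j<l. complex_of_real (2 * pi * X j * heat (X j) (c * (s (?n j) - s j))))"
    proof (intro prod.cong refl)
      fix j assume "j \<in> {..<l}"
      then have "X j > 0" using X by simp
      from gaussian_fourier[OF this, of "c * (s (?n j) - s j)" 0]
      show "integral\<^sup>L lborel (h j) = complex_of_real (2 * pi * X j * heat (X j) (c * (s (?n j) - s j)))"
        unfolding h_def by simp
    qed
    finally show ?thesis unfolding A_def by (simp only: of_real_mult of_real_prod)
  qed
  have "(\<integral>f. gauss_prod X {..<l} f / (\<Prod>j<l. cyc_den X f j (?n j)) \<partial>?M) = (- of_real c) ^ l * (\<integral>f. \<integral>s. G f s \<partial>?M \<partial>?M)"
    by (simp only: step1 integral_mult_right_zero)
  also have "(\<integral>f. \<integral>s. G f s \<partial>?M \<partial>?M) = (\<integral>s. \<integral>f. G f s \<partial>?M \<partial>?M)"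
  proof -
    interpret fp: finite_product_sigma_finite "\<lambda>_. lborel :: real measure" "{..<l}" by standard auto
    interpret pq: pair_sigma_finite ?M ?M by standard
    show ?thesis by (rule pq.Fubini_integral[OF Gint, symmetric])
  qed
  finally show ?thesis
    unfolding step3 integral_complex_of_real of_real_mult[symmetric] of_real_minus[symmetric] of_real_power[symmetric] .
qed

lemma cyc_term_eq_E_fun:
  assumes X: "\<And>I. I \<in> set Is \<Longrightarrow> xI x I > 0" and ne: "Is \<noteq> []"
  shows "cyc_term x Is = (-1) ^ length Is * of_real (E_fun (map (\<lambda>I. xI x I / 2 powr (1/3)) Is))"
proof -
  let ?ys = "map (\<lambda>I. xI x I / 2 powr (1/3)) Is"
  define l where "l = length Is"
  define X where "X = (\<lambda>j. xI x (Is ! j))"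
  define c :: real where "c = 1 / 2 powr (1/3)"
  let ?M = "lborel_PiM {..<l}"
  let ?n = "\<lambda>j. (j + 1) mod l"
  have l: "l \<ge> 1" using ne by (cases Is) (auto simp: l_def)
  have X: "X j > 0" if "j < l" for j using X that by (simp add: X_def l_def)
  have c: "c > 0" by (simp add: c_def)
  \<comment> \<open>The relation behind the factor \<open>2 powr (1/3)\<close>. With
    \<open>y = c * X\<close> it turns \<open>X^3/24\<close> into \<open>y^3/12\<close>,
    \<open>(c v)^2 / (2 X)\<close> into \<open>v^2 / (4 y)\<close>, and
    \<open>c / sqrt (2 * pi * X)\<close> into \<open>1 / sqrt (4 * pi * y)\<close>.\<close>
  have c3: "2 * c ^ 3 = 1"
  proof -
    have "((2::real) powr (1/3)) ^ 3 = 2" by (simp add: powr_power)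
    then show ?thesis by (simp add: c_def power_divide)
  qed
  have ys: "?ys ! j = c * X j" if "j < l" for j
    using that by (simp add: X_def l_def c_def)
  have heat: "2 * pi * X j * heat (X j) (c * v) = sqrt (2 * pi * X j) * exp (- v\<^sup>2 / (4 * (c * X j)))" if "j < l" for j v
  proof -
    have "(c * v)\<^sup>2 / (2 * X j) = v\<^sup>2 / (4 * (c * X j)) * (2 * c ^ 3)"
      using c X[OF that] by (simp add: field_simps power2_eq_square power3_eq_cube)
    then have "(c * v)\<^sup>2 / (2 * X j) = v\<^sup>2 / (4 * (c * X j))" unfolding c3 by simp
    moreover have "2 * pi * X j / sqrt (2 * pi * X j) = sqrt (2 * pi * X j)"
      using X[OF that] by (intro real_div_sqrt) simp
    moreover have "2 * pi * X j * heat (X j) (c * v) = 2 * pi * X j / sqrt (2 * pi * X j) * exp (- ((c * v)\<^sup>2 / (2 * X j)))"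
      using X[OF that] by (simp add: heat_eq)
    ultimately show ?thesis by (simp only: minus_divide_left)
  qed
  define J where "J = (\<integral>s. (\<Prod>j<l. indicator {0..} (s j)) * exp (- (\<Sum>j<l. (s j - s (?n j))\<^sup>2 / (4 * (c * X j)) + (s j + s (?n j)) * (c * X j) / 2)) \<partial>?M)"
  define Q where "Q = (\<Sum>j<l. X j ^ 3) / 24"
  have E: "E_fun ?ys = exp Q / (\<Prod>j<l. sqrt (4 * pi * (c * X j))) * J"
  proof -
    have "(\<Sum>j<l. (?ys ! j) ^ 3) / 12 = Q"
    proof -
      have "(c * X j) ^ 3 / 12 = X j ^ 3 / 24" for j
      proof -
        have "(c * X j) ^ 3 / 12 = (2 * c ^ 3) * X j ^ 3 / 24" by (simp add: power_mult_distrib)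
        then show ?thesis unfolding c3 by simp
      qed
      then show ?thesis unfolding Q_def sum_divide_distrib by (intro sum.cong refl) (simp add: ys)
    qed
    moreover have "(\<Prod>j<l. sqrt (4 * pi * (?ys ! j))) = (\<Prod>j<l. sqrt (4 * pi * (c * X j)))"
      by (intro prod.cong refl) (simp add: ys)
    moreover have "indicator {s. \<forall>j<l. 0 \<le> s j} s *\<^sub>R
        exp (- (\<Sum>j<l. (s j - s (?n j))\<^sup>2 / (4 * (?ys ! j))
                         + (s j + s (?n j)) * (?ys ! j) / 2))
      = (\<Prod>j<l. indicator {0..} (s j)) * exp (- (\<Sum>j<l. (s j - s (?n j))\<^sup>2 / (4 * (c * X j)) + (s j + s (?n j)) * (c * X j) / 2))" for s
    proof -
      have "(indicator {s. \<forall>j<l. 0 \<le> s j} s :: real) = (\<Prod>j<l. indicator {0..} (s j))"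
        by (auto simp: indicator_def)
      moreover have "(\<Sum>j<l. (s j - s (?n j))\<^sup>2 / (4 * (?ys ! j))
                         + (s j + s (?n j)) * (?ys ! j) / 2)
          = (\<Sum>j<l. (s j - s (?n j))\<^sup>2 / (4 * (c * X j)) + (s j + s (?n j)) * (c * X j) / 2)"
        by (intro sum.cong refl) (simp add: ys)
      ultimately show ?thesis by simp
    qed
    ultimately show ?thesis
      unfolding E_fun_def Let_def length_map l_def[symmetric] set_lebesgue_integral_def J_def by (simp only:)
  qed
  have int: "(\<integral>f. gauss_prod X {..<l} f / (\<Prod>j<l. cyc_den X f j (?n j)) \<partial>?M) = of_real ((- c) ^ l * ((\<Prod>j<l. sqrt (2 * pi * X j)) * J))"
  proof -
    have "(\<Prod>j<l. indicator {0..} (s j)) * exp (- (\<Sum>j<l. (s j + s (?n j)) * (c * X j) / 2)) * (\<Prod>j<l. 2 * pi * X j * heat (X j) (c * (s (?n j) - s j)))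
      = (\<Prod>j<l. sqrt (2 * pi * X j)) * ((\<Prod>j<l. indicator {0..} (s j)) * exp (- (\<Sum>j<l. (s j - s (?n j))\<^sup>2 / (4 * (c * X j)) + (s j + s (?n j)) * (c * X j) / 2)))" for s
    proof -
      have "(\<Prod>j<l. 2 * pi * X j * heat (X j) (c * (s (?n j) - s j))) = (\<Prod>j<l. sqrt (2 * pi * X j) * exp (- ((s j - s (?n j))\<^sup>2 / (4 * (c * X j)))))"
        by (intro prod.cong refl) (simp add: heat power2_commute[of "s (_ mod _)"])
      also have "\<dots> = (\<Prod>j<l. sqrt (2 * pi * X j)) * exp (- (\<Sum>j<l. (s j - s (?n j))\<^sup>2 / (4 * (c * X j))))"
        by (simp only: prod.distrib exp_sum[OF finite_lessThan, symmetric] sum_negf)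
      finally show ?thesis
        by (simp only: sum.distrib minus_add_distrib exp_add mult_ac)
    qed
    then show ?thesis
      unfolding J_def using cyclic_integral_orthant[where X = X, OF l X c] by (simp only: integral_mult_right_zero)
  qed
  have XX: "(\<lambda>j. xI x (Is ! j)) = X" by (simp add: X_def)
  define P where "P = (\<Prod>j<l. X j)"
  have "cyc_term x Is = of_real (exp Q / (2 * pi) ^ l) *
      (\<integral>f. (1 / of_real P) * (gauss_prod X {..<l} f / (\<Prod>j<l. cyc_den X f j ((j + 1) mod l))) \<partial>lborel_PiM {..<l})"
    unfolding cyc_term_def Let_def l_def[symmetric] XX Q_def P_def
    by (simp add: prod_dividef gauss_prod_def cyc_den_def)
  also have "\<dots> = of_real (exp Q / (2 * pi) ^ l * ((1 / P) * ((- c) ^ l * ((\<Prod>j<l. sqrt (2 * pi * X j)) * J))))"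
    unfolding integral_mult_right_zero int by simp
  also have "exp Q / (2 * pi) ^ l * ((1 / P) * ((- c) ^ l * ((\<Prod>j<l. sqrt (2 * pi * X j)) * J)))
    = (-1) ^ l * (exp Q * (\<Prod>j<l. c * sqrt (2 * pi * X j) / (2 * pi * X j)) * J)"
    unfolding P_def by (simp add: prod_dividef prod.distrib power_minus[of c])
  also have "(\<Prod>j<l. c * sqrt (2 * pi * X j) / (2 * pi * X j)) = (\<Prod>j<l. 1 / sqrt (4 * pi * (c * X j)))"
  proof (intro prod.cong refl)
    fix j assume "j \<in> {..<l}"
    then have Xj: "X j > 0" using X by simp
    have "sqrt (4 * pi * (c * X j)) * c = sqrt (2 * pi * X j)"
    proof -
      have "sqrt (4 * pi * (c * X j)) * c = sqrt (4 * pi * (c * X j) * c\<^sup>2)"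
        using c by (simp add: real_sqrt_mult)
      also have "4 * pi * (c * X j) * c\<^sup>2 = (2 * c ^ 3) * (2 * pi * X j)"
        by (simp add: power2_eq_square power3_eq_cube)
      finally show ?thesis unfolding c3 by simp
    qed
    moreover have "sqrt (2 * pi * X j) * sqrt (2 * pi * X j) = 2 * pi * X j" using Xj by simp
    ultimately have "c * sqrt (2 * pi * X j) * sqrt (4 * pi * (c * X j)) = 2 * pi * X j"
      by (metis mult.assoc mult.commute)
    then show "c * sqrt (2 * pi * X j) / (2 * pi * X j) = 1 / sqrt (4 * pi * (c * X j))"
      using Xj c by (simp add: divide_eq_eq eq_divide_eq)
  qed
  also have "exp Q * (\<Prod>j<l. 1 / sqrt (4 * pi * (c * X j))) * J = E_fun ?ys"
    unfolding E by (simp add: prod_dividef)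
  finally show ?thesis unfolding l_def by simp
qed

theorem theorem5p1:
  fixes n :: nat and x :: "nat \<Rightarrow> real"
  assumes "n \<ge> 1" and "\<forall>j\<in>{1..n}. x j > 0"
  shows "F_Bur n x =
           complex_of_real ((2 * pi) powr (real n / 2) / (\<Prod>j=1..n. sqrt (x j)))
           * (\<Sum>l=1..n. \<Sum>C\<in>cyc_parts n l.
                - cyc_term x (SOME Is. Is \<in> C)) \<and>
         (\<forall>l\<in>{1..n}. \<forall>Is\<in>ord_parts n l.
           cyc_term x Is
             = (-1) ^ l * complex_of_real (E_fun (map (\<lambda>I. xI x I / 2 powr (1/3)) Is)))"
proof (intro conjI ballI)
  show "F_Bur n x =
           complex_of_real ((2 * pi) powr (real n / 2) / (\<Prod>j=1..n. sqrt (x j)))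
           * (\<Sum>l=1..n. \<Sum>C\<in>cyc_parts n l. - cyc_term x (SOME Is. Is \<in> C))"
    using assms by (intro F_Bur_eq_cyclic_sum) auto
next
  fix l Is assume "l \<in> {1..n}" and Is: "Is \<in> ord_parts n l"
  then have "length Is = l" "Is \<noteq> []" by (auto simp: ord_parts_def)
  moreover have "xI x I > 0" if "I \<in> set Is" for I
  proof -
    have I: "I \<subseteq> {1..n}" "I \<noteq> {}" using Is that by (auto simp: ord_parts_eq ordered_partitions_def)
    then have "finite I" using finite_subset by blast
    then show ?thesis unfolding xI_def using I assms(2) by (intro sum_pos) auto
  qed
  ultimately show "cyc_term x Is = (-1) ^ l * complex_of_real (E_fun (map (\<lambda>I. xI x I / 2 powr (1/3)) Is))"
    using cyc_term_eq_E_fun[of Is x] by simp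
qed

end
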